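(* Let $J$ be the real Jacobi matrix with diagonal $\{\lambda_n\}_{n=1}^\infty$ and off-diagonal $\{w_n\}_{n=1}^\infty$, where $\lambda_n>0$ and $w_n\in\mathbb{R}\setminus\{0\}$ for all $n$, $\lim_{n\to\infty}\lambda_n=+\infty$, and $$\sum_{n=1}^{\infty}\frac{w_n^{2}}{\lambda_n\lambda_{n+1}}<\infty,\qquad \sum_{n=1}^{\infty}\frac{1}{\lambda_n^{2}}<\infty .$$ Suppose that $J$ is invertible. Denote by $\lambda_n(J)$, $n\in\mathbb{N}$, the eigenvalues of $J$ (all of them are real and simple). Then $L^{-1}-J^{-1}$ is a trace class operator, $$\sum_{n=1}^{\infty}\lambda_n(J)^{-2}<\infty,$$ and for the regularized characteristic function of $J$ one has $$H_J(z)=F_J(0)\,e^{bz}\prod_{n=1}^{\infty}\left(1-\frac{z}{\lambda_n(J)}\right)e^{z/\lambda_n(J)},$$ where $$b=\operatorname{Tr}\left(L^{-1}-J^{-1}\right)=\sum_{n=1}^{\infty}\left(\frac{1}{\lambda_n}-\frac{1}{\lambda_n(J)}\right).$$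
   Context: $\mathbb{N}=\{1,2,3,\ldots\}$. The function $\mathfrak{F}$ is defined on $D=\{\{x_k\}_{k=1}^\infty\subset\mathbb{C};\ \sum_{k=1}^\infty|x_kx_{k+1}|<\infty\}$ by $$\mathfrak{F}(x)=1+\sum_{m=1}^{\infty}(-1)^m\sum_{k_1=1}^{\infty}\,\sum_{k_2=k_1+2}^{\infty}\cdots\sum_{k_m=k_{m-1}+2}^{\infty}x_{k_1}x_{k_1+1}x_{k_2}x_{k_2+1}\cdots x_{k_m}x_{k_m+1}.$$ The Jacobi matrix $J$ is the infinite symmetric tridiagonal matrix with $J_{n,n}=\lambda_n$, $J_{n,n+1}=J_{n+1,n}=w_n$ and all other entries zero. Under the stated assumptions it represents a unique self-adjoint operator on $\ell^2(\mathbb{N})$, also denoted $J$; its spectrum is discrete, simple and real. "Invertible" means that $0$ is not in the spectrum of $J$. $L$ is the diagonal operator $\mathrm{diag}(\lambda_1,\lambda_2,\ldots)$. Put $\gamma_{2k-1}=\prod_{j=1}^{k-1}\frac{w_{2j}}{w_{2j-1}}$ and $\gamma_{2k}=w_1\prod_{j=1}^{k-1}\frac{w_{2j+1}}{w_{2j}}$ for $k=1,2,\ldots$, so that $\gamma_k\gamma_{k+1}=w_k$. The characteristic function of $J$ is $$F_J(z)=\mathfrak{F}\left(\left\{\frac{\gamma_n^{2}}{\lambda_n-z}\right\}_{n=1}^{\infty}\right),\qquad z\in\mathbb{C}\setminus\{\lambda_n;\,n\in\mathbb{N}\},$$ which is meromorphic on $\mathbb{C}$, the order of a pole at $z$ being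 at most the number of occurrences of $z$ in the sequence $\{\lambda_n\}$. Let $\Phi_\lambda(z)=\prod_{n=1}^\infty\left(1-\frac{z}{\lambda_n}\right)e^{z/\lambda_n}$, an entire function. The regularized characteristic function of $J$ is the entire function $H_J(z)=\Phi_\lambda(z)F_J(z)$ (removable singularities at the points $\lambda_n$ being removed).
   Formalization: The last equality for b is stated for numberings with λ_m(J)<λ_n(J) whenever λ_m<λ_n (one is shown to exist), as it can fail for other numberings; J is the maximal operator of the matrix, since uniqueness of the self-adjoint operator can fail (the maximal operator is then not invertible). *)

theory Defs
  imports "HOL-Complex_Analysis.Complex_Analysis"
begin

text \<open>
  All sequences are indexed from 0: index \<open>n\<close> here is index \<open>n + 1\<close> for sequences indexed by
  \<open>{1, 2, 3, \<dots>}\<close>. Thus \<open>lam n\<close> stands for \<open>\<lambda>\<^sub>n\<^sub>+\<^sub>1\<close> and \<open>w n\<close> for \<open>w\<^sub>n\<^sub>+\<^sub>1\<close>.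
\<close>

section \<open>Operators on the Hilbert space of square-summable complex sequences\<close>

definition ell2 :: "(nat \<Rightarrow> complex) set"
  where "ell2 = {x. summable (\<lambda>n. (cmod (x n))\<^sup>2)}"

definition ell2_inner :: "(nat \<Rightarrow> complex) \<Rightarrow> (nat \<Rightarrow> complex) \<Rightarrow> complex"
  where "ell2_inner x y = (\<Sum>n. cnj (x n) * y n)"

definition ell2_norm :: "(nat \<Rightarrow> complex) \<Rightarrow> real"
  where "ell2_norm x = sqrt (\<Sum>n. (cmod (x n))\<^sup>2)"

definition unit_seq :: "nat \<Rightarrow> nat \<Rightarrow> complex"
  where "unit_seq n = (\<lambda>k. if k = n then 1 else 0)"

text \<open>
  Everywhere defined operators are functions; only their values on \<^const>\<open>ell2\<close> matter.
\<close>

definition bounded_op :: "((nat \<Rightarrow> complex) \<Rightarrow> (nat \<Rightarrow> complex)) \<Rightarrow> bool"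
  where "bounded_op A \<longleftrightarrow>
    (\<forall>x\<in>ell2. A x \<in> ell2) \<and>
    (\<forall>x\<in>ell2. \<forall>y\<in>ell2. \<forall>a b. A (\<lambda>n. a * x n + b * y n) = (\<lambda>n. a * A x n + b * A y n)) \<and>
    (\<exists>C. \<forall>x\<in>ell2. ell2_norm (A x) \<le> C * ell2_norm x)"

text \<open>
  \<open>P = \<bar>A\<bar>\<close>, that is, \<open>P\<close> is the positive square root of \<open>A\<^sup>*A\<close>. Positivity makes \<open>P\<close>
  self-adjoint, so that the last condition says \<open>P\<^sup>2 = A\<^sup>*A\<close>.
\<close>

definition is_abs_op ::
  "((nat \<Rightarrow> complex) \<Rightarrow> (nat \<Rightarrow> complex)) \<Rightarrow> ((nat \<Rightarrow> complex) \<Rightarrow> (nat \<Rightarrow> complex)) \<Rightarrow> bool"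
  where "is_abs_op A P \<longleftrightarrow>
    bounded_op P \<and>
    (\<forall>x\<in>ell2. ell2_inner x (P x) \<in> \<real>\<^sub>\<ge>\<^sub>0) \<and>
    (\<forall>x\<in>ell2. \<forall>y\<in>ell2. ell2_inner (P x) (P y) = ell2_inner (A x) (A y))"

definition trace_class :: "((nat \<Rightarrow> complex) \<Rightarrow> (nat \<Rightarrow> complex)) \<Rightarrow> bool"
  where "trace_class A \<longleftrightarrow>
    bounded_op A \<and>
    (\<exists>P. is_abs_op A P \<and> summable (\<lambda>n. Re (ell2_inner (unit_seq n) (P (unit_seq n)))))"

definition op_trace :: "((nat \<Rightarrow> complex) \<Rightarrow> (nat \<Rightarrow> complex)) \<Rightarrow> complex"
  where "op_trace A = (\<Sum>n. ell2_inner (unit_seq n) (A (unit_seq n)))"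

text \<open>Possibly unbounded operators are represented by their graphs.\<close>

type_synonym op_graph = "((nat \<Rightarrow> complex) \<times> (nat \<Rightarrow> complex)) set"

definition op_shift :: "op_graph \<Rightarrow> complex \<Rightarrow> op_graph"
  where "op_shift T z = {(x, \<lambda>n. y n - z * x n) |x y. (x, y) \<in> T}"

text \<open>
  \<open>z\<close> is a regular value if \<open>T - z\<close> has an everywhere defined bounded inverse \<open>R\<close>.
\<close>

definition op_spectrum :: "op_graph \<Rightarrow> complex set"
  where "op_spectrum T =
    {z. \<not> (\<exists>R. bounded_op R \<and> (op_shift T z)\<inverse> = {(y, R y) |y. y \<in> ell2})}"

definition op_invertible :: "op_graph \<Rightarrow> bool"
  where "op_invertible T \<longleftrightarrow> 0 \<notin> op_spectrum T"

definition op_inverse :: "op_graph \<Rightarrow> (nat \<Rightarrow> complex) \<Rightarrow> (nat \<Rightarrow> complex)"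
  where "op_inverse T y = (THE x. (x, y) \<in> T)"

definition eigenspace :: "op_graph \<Rightarrow> complex \<Rightarrow> (nat \<Rightarrow> complex) set"
  where "eigenspace T z = {x. (x, \<lambda>n. z * x n) \<in> T}"

definition eigenvalues :: "op_graph \<Rightarrow> complex set"
  where "eigenvalues T = {z. \<exists>x\<in>eigenspace T z. x \<noteq> (\<lambda>_. 0)}"

definition simple_eigenvalue :: "op_graph \<Rightarrow> complex \<Rightarrow> bool"
  where "simple_eigenvalue T z \<longleftrightarrow>
    (\<exists>v. v \<noteq> (\<lambda>_. 0) \<and> eigenspace T z = {\<lambda>n. c * v n |c. True})"

text \<open>An enumeration, without repetition, of the eigenvalues of an operator with real eigenvalues.\<close>

definition enumerates_eigenvalues :: "op_graph \<Rightarrow> (nat \<Rightarrow> real) \<Rightarrow> bool"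
  where "enumerates_eigenvalues T \<mu> \<longleftrightarrow>
    bij_betw (\<lambda>n. complex_of_real (\<mu> n)) UNIV (eigenvalues T)"

text \<open>
  \<open>\<mu>\<close> is arranged in the same order as \<open>lam\<close>; if \<open>lam\<close> is strictly increasing, this says that
  \<open>\<mu>\<close> is strictly increasing. The order matters for the series with terms
  \<open>1 / lam n - 1 / \<mu> n\<close>, because the series with terms \<open>1 / lam n\<close> may diverge.
\<close>

definition ordered_like :: "(nat \<Rightarrow> real) \<Rightarrow> (nat \<Rightarrow> real) \<Rightarrow> bool"
  where "ordered_like lam \<mu> \<longleftrightarrow> (\<forall>m n. lam m < lam n \<longrightarrow> \<mu> m < \<mu> n)"


section \<open>Jacobi operators\<close>

definition matrix_apply :: "(nat \<Rightarrow> nat \<Rightarrow> complex) \<Rightarrow> (nat \<Rightarrow> complex) \<Rightarrow> (nat \<Rightarrow> complex)"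
  where "matrix_apply M x = (\<lambda>i. \<Sum>j. M i j * x j)"

text \<open>
  The operator with the maximal domain \<open>{x \<in> \<ell>\<^sup>2. M x \<in> \<ell>\<^sup>2}\<close>. For a real Jacobi matrix it is the
  adjoint of the operator on finitely supported sequences. So, whenever the matrix represents a
  unique self-adjoint operator (the limit point case), this is that operator. In the limit circle
  case every complex number is an eigenvalue of the maximal operator, which then is not invertible.
\<close>

definition matrix_operator :: "(nat \<Rightarrow> nat \<Rightarrow> complex) \<Rightarrow> op_graph"
  where "matrix_operator M = {(x, matrix_apply M x) |x. x \<in> ell2 \<and> matrix_apply M x \<in> ell2}"

definition jacobi_matrix :: "(nat \<Rightarrow> real) \<Rightarrow> (nat \<Rightarrow> real) \<Rightarrow> nat \<Rightarrow> nat \<Rightarrow> complex"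
  where "jacobi_matrix lam w i j =
    (if i = j then of_real (lam i)
     else if j = Suc i then of_real (w i)
     else if i = Suc j then of_real (w j)
     else 0)"

definition jacobi_operator :: "(nat \<Rightarrow> real) \<Rightarrow> (nat \<Rightarrow> real) \<Rightarrow> op_graph"
  where "jacobi_operator lam w = matrix_operator (jacobi_matrix lam w)"

definition diag_operator :: "(nat \<Rightarrow> real) \<Rightarrow> op_graph"
  where "diag_operator lam = matrix_operator (\<lambda>i j. if i = j then of_real (lam i) else 0)"

definition inverse_difference ::
  "(nat \<Rightarrow> real) \<Rightarrow> (nat \<Rightarrow> real) \<Rightarrow> (nat \<Rightarrow> complex) \<Rightarrow> (nat \<Rightarrow> complex)"
  where "inverse_difference lam w y =
    (\<lambda>n. op_inverse (diag_operator lam) y n - op_inverse (jacobi_operator lam w) y n)"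


section \<open>Characteristic functions\<close>

text \<open>
  \<open>frakF_nested x m s\<close> is the \<open>m\<close>-fold iterated sum of
  \<open>x\<^sub>k\<^sub>1 x\<^sub>k\<^sub>1\<^sub>+\<^sub>1 \<cdots> x\<^sub>k\<^sub>m x\<^sub>k\<^sub>m\<^sub>+\<^sub>1\<close> over \<open>k\<^sub>1 \<ge> s\<close> and \<open>k\<^sub>i\<^sub>+\<^sub>1 \<ge> k\<^sub>i + 2\<close>.
\<close>

primrec frakF_nested :: "(nat \<Rightarrow> complex) \<Rightarrow> nat \<Rightarrow> nat \<Rightarrow> complex"
  where
    "frakF_nested x 0 s = 1"
  | "frakF_nested x (Suc m) s =
      (\<Sum>i. x (s + i) * x (s + i + 1) * frakF_nested x m (s + i + 2))"

definition frakF :: "(nat \<Rightarrow> complex) \<Rightarrow> complex"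
  where "frakF x = 1 + (\<Sum>m. (- 1) ^ Suc m * frakF_nested x (Suc m) 0)"

definition jacobi_gamma :: "(nat \<Rightarrow> real) \<Rightarrow> nat \<Rightarrow> real"
  where "jacobi_gamma w n =
    (if even n then (\<Prod>j<n div 2. w (2 * j + 1) / w (2 * j))
     else w 0 * (\<Prod>j<n div 2. w (2 * j + 2) / w (2 * j + 1)))"

lemma jacobi_gamma_mult_Suc:
  assumes "\<And>n. w n \<noteq> 0"
  shows "jacobi_gamma w n * jacobi_gamma w (Suc n) = w n"
proof (induction n)
  case 0
  show ?case by (simp add: jacobi_gamma_def)
next
  case (Suc n)
  have nz: "jacobi_gamma w n \<noteq> 0"
    using Suc.IH assms[of n] by auto
  have "jacobi_gamma w (Suc (Suc n)) = jacobi_gamma w n * (w (Suc n) / w n)"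
    by (auto simp: jacobi_gamma_def elim!: evenE oddE)
  moreover have "jacobi_gamma w (Suc n) = w n / jacobi_gamma w n"
    using Suc.IH nz by (simp add: field_simps)
  ultimately show ?case
    using nz assms[of n] by simp
qed

definition char_fun :: "(nat \<Rightarrow> real) \<Rightarrow> (nat \<Rightarrow> real) \<Rightarrow> complex \<Rightarrow> complex"
  where "char_fun lam w z =
    frakF (\<lambda>n. of_real ((jacobi_gamma w n)\<^sup>2) / (of_real (lam n) - z))"

definition Phi :: "(nat \<Rightarrow> real) \<Rightarrow> complex \<Rightarrow> complex"
  where "Phi lam z = (\<Prod>n. (1 - z / of_real (lam n)) * exp (z / of_real (lam n)))"

text \<open>
  The values of \<^const>\<open>char_fun\<close> at the points \<open>lam n\<close> are irrelevant here, since
  \<^const>\<open>remove_sings\<close> takes the limit of the function at each point.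
\<close>

definition reg_char_fun :: "(nat \<Rightarrow> real) \<Rightarrow> (nat \<Rightarrow> real) \<Rightarrow> complex \<Rightarrow> complex"
  where "reg_char_fun lam w = remove_sings (\<lambda>z. Phi lam z * char_fun lam w z)"

end

theory Submission
  imports Defs "HOL-Real_Asymp.Real_Asymp"
begin

text \<open>
  Put \<open>D = L\<^sup>-\<^sup>1\<^sup>/\<^sup>2\<close> and \<open>K = D (J - L) D\<close>. The operator \<open>K\<close> is Hilbert--Schmidt, \<open>I + K\<close> is injective
  because \<open>J\<close> is invertible, hence \<open>B = (I + K)\<^sup>-\<^sup>1\<close> is bounded and \<open>J\<^sup>-\<^sup>1 = D B D\<close>; the identity
  \<open>L\<^sup>-\<^sup>1 - J\<^sup>-\<^sup>1 = D K D - (K D)\<^sup>* B (K D)\<close> shows that the difference is trace class and that \<open>J\<^sup>-\<^sup>1\<close>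
  is Hilbert--Schmidt, so that \<open>J\<close> has an eigenbasis with square-summable inverse eigenvalues.

  The three-term recurrences satisfied by \<open>\<FF>\<close> of the initial and final segments of a sequence give the
  derivative \<open>F'/F = \<Sum>\<^sub>n (1/(\<lambda>\<^sub>n - z) - G\<^sub>n\<^sub>n(z))\<close> with the Green function \<open>G\<close> of \<open>J - z\<close>. Expanding
  \<open>G\<^sub>n\<^sub>n\<close> in eigenvectors, both sides of the product formula have the same logarithmic derivative at
  real points near \<open>0\<close>, and the formula extends by analytic continuation.

  For the ordered sum, \<open>J + c\<close> is bounded above, in the form sense, by the diagonal operator with entries
  \<open>(\<lambda>\<^sub>n + c) (1 + \<kappa>\<^sub>n)\<close>, \<open>\<kappa>\<close> square-summable. Comparing counting functions, the positive parts of
  \<open>1/(\<lambda>\<^sub>n + c) - 1/(\<lambda>\<^sub>n(J) + c)\<close> are summable. The negative parts are then controlled by letting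
  \<open>t \<rightarrow> -\<infinity>\<close> in the difference of the trace formulas at \<open>-c\<close> and at \<open>t\<close>, where \<open>F'/F\<close> tends to \<open>0\<close>.
\<close>

section \<open>The function \<open>\<FF>\<close>\<close>

text \<open>The series of the numbers 1/\<open>lam n\<close> may diverge, so the trace of L^-1 -
  J^-1 cannot be split into two sums. Every trace is therefore taken of a difference: diagonal
  entries against diagonal entries (\<open>tr\<close>), or 1/s against 1/(s - t), which is of order
  1/s^2 and can be summed over the eigenvalues in any order. This gives the product formula for
  every enumeration; only the series for b depends on the order.

  The points t at which F'/F is compared are real and lie below all \<open>lam n\<close>: there J -
  t is again a Jacobi matrix with positive diagonal, so that the Green function has to be built at 0
  only, and the spectral theory can stay in a real Hilbert space. Complex sequences are handled as
  pairs of real ones.\<close>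

definition frakF_tail :: "(nat \<Rightarrow> complex) \<Rightarrow> nat \<Rightarrow> complex"
  where "frakF_tail x s = (\<Sum>m. (- 1) ^ m * frakF_nested x m s)"

text \<open>The value at \<open>n\<close> is \<FF> of the finite sequence \<open>x 0\<close>, ...,
  \<open>x (n - 1)\<close>, a continuant. It is generated by its recurrence, so no iterated sums
  have to be truncated.\<close>

fun frakF_init :: "(nat \<Rightarrow> complex) \<Rightarrow> nat \<Rightarrow> complex"
  where
    "frakF_init x 0 = 1"
  | "frakF_init x (Suc 0) = 1"
  | "frakF_init x (Suc (Suc n)) = frakF_init x (Suc n) - x n * x (Suc n) * frakF_init x n"

text \<open>Makes the bound in \<open>nested_bound\<close> telescope: with a the first term and b
  the rest of a tail, the right-hand side is the drop of the power between consecutive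
  tails.\<close>

lemma power_add_diff_ge:
  fixes a b :: real
  assumes "a \<ge> 0" "b \<ge> 0"
  shows "real (Suc m) * a * b ^ m \<le> (a + b) ^ Suc m - b ^ Suc m"
proof (induction m)
  case (Suc m)
  have "real (Suc (Suc m)) * a * b ^ Suc m = b * (real (Suc m) * a * b ^ m) + a * b ^ Suc m"
    by (simp add: algebra_simps)
  also have "\<dots> \<le> (a + b) * ((a + b) ^ Suc m - b ^ Suc m) + a * b ^ Suc m"
  proof -
    have "b * (real (Suc m) * a * b ^ m) \<le> (a + b) * ((a + b) ^ Suc m - b ^ Suc m)"
      using Suc assms by (intro mult_mono) auto
    thus ?thesis by simp
  qed
  also have "\<dots> = (a + b) ^ Suc (Suc m) - b ^ Suc (Suc m)"
    by (simp add: algebra_simps)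
  finally show ?case .
qed simp

section \<open>Bounds, recurrences and limits of \<FF> on initial and final segments\<close>

context
  fixes x :: "nat \<Rightarrow> complex"
  assumes summable_x: "summable (\<lambda>n. cmod (x n * x (Suc n)))"
begin

definition tsum :: "nat \<Rightarrow> real"
  where "tsum s = (\<Sum>i. cmod (x (i + s) * x (Suc (i + s))))"

lemma summable_tsum: "summable (\<lambda>i. cmod (x (i + s) * x (Suc (i + s))))"
  using summable_ignore_initial_segment[OF summable_x, of s] by simp

lemma tsum_nonneg: "tsum s \<ge> 0"
  unfolding tsum_def by (intro suminf_nonneg summable_tsum) simp

lemma tsum_rec: "tsum s = cmod (x s * x (Suc s)) + tsum (Suc s)"
  using suminf_split_head[OF summable_tsum, of s] by (simp add: tsum_def)

lemma tsum_Suc_le: "tsum (Suc s) \<le> tsum s"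
  using tsum_rec[of s] by simp

lemma tsum_add_le: "tsum (s + i) \<le> tsum s"
proof (induction i)
  case (Suc i)
  thus ?case using tsum_Suc_le[of "s + i"] by simp
qed simp

lemma tsum_tendsto_0: "tsum \<longlonglongrightarrow> 0"
  unfolding tsum_def
  using suminf_exist_split2[OF summable_x] by simp

text \<open>The summation indices are increasing, so only one of the m! orderings of each tuple
  occurs. The resulting factorial makes the alternating series converge without any smallness of
  \<open>tsum\<close>. Summability and bound are interlocked, since the induction step needs the
  summability for the previous m.\<close>

lemma nested_bound:
  "cmod (frakF_nested x m s) \<le> tsum s ^ m / fact m"
  and summable_nested:
  "summable (\<lambda>i. cmod (x (s + i) * x (s + i + 1) * frakF_nested x m (s + i + 2)))"
proof -
  have *: "summable (\<lambda>i. cmod (x (s + i) * x (s + i + 1) * frakF_nested x m (s + i + 2)))"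
    if "\<And>s. cmod (frakF_nested x m s) \<le> tsum s ^ m / fact m" for m s
  proof (rule summable_comparison_test'[where N = 0])
    show "summable (\<lambda>i. cmod (x (i + s) * x (Suc (i + s))) * (tsum s ^ m / fact m))"
      by (intro summable_mult2 summable_tsum)
    fix i
    have "cmod (frakF_nested x m (s + i + 2)) \<le> tsum (s + i + 2) ^ m / fact m"
      by (rule that)
    also have "\<dots> \<le> tsum s ^ m / fact m"
      using tsum_add_le[of s "i + 2"] by (intro divide_right_mono power_mono tsum_nonneg) (auto simp: add_ac)
    finally show "norm (cmod (x (s + i) * x (s + i + 1) * frakF_nested x m (s + i + 2)))
        \<le> cmod (x (i + s) * x (Suc (i + s))) * (tsum s ^ m / fact m)"
      by (simp only: norm_mult abs_mult real_norm_def abs_norm_cancel add_ac Suc_eq_plus1)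
        (intro mult_left_mono, auto simp: add_ac)
  qed
  have bound: "cmod (frakF_nested x m s) \<le> tsum s ^ m / fact m" for s
  proof (induction m arbitrary: s)
    case (Suc m)
    have tel: "(\<lambda>i. tsum (s + i) ^ Suc m - tsum (s + Suc i) ^ Suc m) sums (tsum (s + 0) ^ Suc m - 0 ^ Suc m)"
    proof (rule telescope_sums')
      have "(\<lambda>i. tsum (i + s)) \<longlonglongrightarrow> 0"
        using LIMSEQ_ignore_initial_segment[OF tsum_tendsto_0] .
      thus "(\<lambda>i. tsum (s + i) ^ Suc m) \<longlonglongrightarrow> 0 ^ Suc m"
        by (intro tendsto_power) (simp add: add.commute)
    qed
    have "cmod (frakF_nested x (Suc m) s)
        \<le> (\<Sum>i. cmod (x (s + i) * x (s + i + 1) * frakF_nested x m (s + i + 2)))"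
      unfolding frakF_nested.simps by (rule summable_norm[OF *[OF Suc]])
    also have "\<dots> \<le> (\<Sum>i. (tsum (s + i) ^ Suc m - tsum (s + Suc i) ^ Suc m) / fact (Suc m))"
    proof (rule suminf_le)
      show "summable (\<lambda>i. (tsum (s + i) ^ Suc m - tsum (s + Suc i) ^ Suc m) / fact (Suc m))"
        using sums_summable[OF tel] by (rule summable_divide)
      fix i
      let ?a = "cmod (x (s + i) * x (s + i + 1))"
      have "cmod (frakF_nested x m (s + i + 2)) \<le> tsum (s + i + 2) ^ m / fact m"
        by (rule Suc)
      \<comment> \<open>The next index starts two places later; enlarging the tail by one term puts
        it in the form required for telescoping.\<close>
      also have "\<dots> \<le> tsum (s + Suc i) ^ m / fact m"
        using tsum_Suc_le[of "s + Suc i"] by (intro divide_right_mono power_mono tsum_nonneg) auto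
      finally have "?a * cmod (frakF_nested x m (s + i + 2)) \<le> ?a * (tsum (s + Suc i) ^ m / fact m)"
        by (rule mult_left_mono) simp
      also have "\<dots> = real (Suc m) * ?a * tsum (s + Suc i) ^ m / fact (Suc m)"
        by (simp add: field_simps del: of_nat_Suc)
      also have "\<dots> \<le> (tsum (s + i) ^ Suc m - tsum (s + Suc i) ^ Suc m) / fact (Suc m)"
        using power_add_diff_ge[of ?a "tsum (s + Suc i)" m] tsum_rec[of "s + i"]
        by (intro divide_right_mono) (auto simp: tsum_nonneg)
      finally show "cmod (x (s + i) * x (s + i + 1) * frakF_nested x m (s + i + 2))
          \<le> (tsum (s + i) ^ Suc m - tsum (s + Suc i) ^ Suc m) / fact (Suc m)"
        by (simp add: norm_mult)
    qed (rule *[OF Suc])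
    also have "\<dots> = tsum s ^ Suc m / fact (Suc m)"
      using sums_unique[OF sums_divide[OF tel, of "fact (Suc m)"]] by simp
    finally show ?case .
  qed simp
  show "cmod (frakF_nested x m s) \<le> tsum s ^ m / fact m" by (rule bound)
  show "summable (\<lambda>i. cmod (x (s + i) * x (s + i + 1) * frakF_nested x m (s + i + 2)))"
    by (rule * [OF bound])
qed

text \<open>Tuples are sorted by whether the first index equals s; if it does, the remaining ones
  start at s + 2.\<close>

lemma nested_rec:
  "frakF_nested x (Suc m) s =
     x s * x (Suc s) * frakF_nested x m (Suc (Suc s)) + frakF_nested x (Suc m) (Suc s)"
  using suminf_split_head[OF summable_norm_cancel[OF summable_nested], of s m] by (simp add: algebra_simps)

lemma exp_tsum_sums: "(\<lambda>m. tsum s ^ m / fact m) sums exp (tsum s)"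
  using exp_converges[of "tsum s"] by (simp add: divide_inverse mult.commute)

lemma summable_tail: "summable (\<lambda>m. (- 1) ^ m * frakF_nested x m s)"
  by (rule summable_comparison_test'[OF sums_summable[OF exp_tsum_sums], of 0 _ s])
    (use nested_bound in \<open>simp add: norm_mult norm_power\<close>)

lemma frakF_tail_split: "frakF_tail x s = 1 + (\<Sum>m. (- 1) ^ Suc m * frakF_nested x (Suc m) s)"
  unfolding frakF_tail_def using suminf_split_head[OF summable_tail, of s] by simp

lemma frakF_eq_tail: "frakF x = frakF_tail x 0"
  by (simp add: frakF_def frakF_tail_split del: frakF_nested.simps)

lemma frakF_tail_rec:
  "frakF_tail x s = frakF_tail x (Suc s) - x s * x (Suc s) * frakF_tail x (Suc (Suc s))"
proof -
  have "(\<Sum>m. (- 1) ^ Suc m * frakF_nested x (Suc m) s) =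
      (\<Sum>m. (- 1) ^ Suc m * frakF_nested x (Suc m) (Suc s)
        - x s * x (Suc s) * ((- 1) ^ m * frakF_nested x m (Suc (Suc s))))"
    by (subst nested_rec) (simp add: algebra_simps del: frakF_nested.simps)
  also have "\<dots> = (\<Sum>m. (- 1) ^ Suc m * frakF_nested x (Suc m) (Suc s)) -
      x s * x (Suc s) * frakF_tail x (Suc (Suc s))"
    unfolding frakF_tail_def
    by (subst suminf_diff[symmetric])
      (use summable_tail summable_tail[of "Suc s", THEN summable_Suc_iff[THEN iffD2]] in
        \<open>auto intro: summable_mult simp: suminf_mult simp del: frakF_nested.simps\<close>)
  finally show ?thesis
    by (simp add: frakF_tail_split del: frakF_nested.simps)
qed

lemma frakF_tail_bound: "cmod (frakF_tail x s - 1) \<le> exp (tsum s) - 1"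
proof -
  have s: "(\<lambda>m. tsum s ^ Suc m / fact (Suc m)) sums (exp (tsum s) - 1)"
    using exp_tsum_sums[of s] by (subst sums_Suc_iff) simp
  have "cmod (frakF_tail x s - 1) = cmod (\<Sum>m. (- 1) ^ Suc m * frakF_nested x (Suc m) s)"
    by (simp add: frakF_tail_split del: frakF_nested.simps)
  also have "\<dots> \<le> (\<Sum>m. tsum s ^ Suc m / fact (Suc m))"
    by (rule norm_suminf_le)
      (use nested_bound[of "Suc _" s] sums_summable[OF s] in
        \<open>auto simp: norm_mult norm_power simp del: frakF_nested.simps power_Suc fact_Suc\<close>)
  also have "\<dots> = exp (tsum s) - 1"
    using s by (rule sums_unique[symmetric])
  finally show ?thesis .
qed

lemma norm_frakF_tail_le: "cmod (frakF_tail x s) \<le> exp (tsum 0)"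
proof -
  have "cmod (frakF_tail x s) \<le> cmod (frakF_tail x s - 1) + cmod 1"
    by (metis diff_add_cancel norm_triangle_ineq)
  also have "\<dots> \<le> exp (tsum s)"
    using frakF_tail_bound[of s] by simp
  also have "\<dots> \<le> exp (tsum 0)"
    using tsum_add_le[of 0 s] by simp
  finally show ?thesis .
qed

lemma frakF_tail_tendsto_1: "frakF_tail x \<longlonglongrightarrow> 1"
proof -
  have "(\<lambda>s. exp (tsum s) - 1) \<longlonglongrightarrow> exp 0 - 1"
    by (intro tendsto_intros tsum_tendsto_0)
  hence "(\<lambda>s. exp (tsum s) - 1) \<longlonglongrightarrow> 0" by simp
  hence "(\<lambda>s. frakF_tail x s - 1) \<longlonglongrightarrow> 0"
    by (rule Lim_null_comparison[rotated]) (simp add: frakF_tail_bound)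
  thus ?thesis by (rule LIM_zero_cancel)
qed

lemma norm_frakF_init_le: "cmod (frakF_init x n) \<le> exp (tsum 0)"
proof -
  \<comment> \<open>The recurrence has two steps, so two consecutive values are bounded together.
    The same exponent serves both, because \<open>frakF_init x (Suc n)\<close> involves only the
    products with j < n.\<close>
  have "cmod (frakF_init x n) \<le> exp (\<Sum>j<n. cmod (x j * x (Suc j))) \<and>
        cmod (frakF_init x (Suc n)) \<le> exp (\<Sum>j<n. cmod (x j * x (Suc j)))" for n
  proof (induction n)
    case (Suc n)
    let ?a = "cmod (x n * x (Suc n))" and ?E = "exp (\<Sum>j<n. cmod (x j * x (Suc j)))"
    have "cmod (frakF_init x (Suc (Suc n))) \<le> cmod (frakF_init x (Suc n)) + ?a * cmod (frakF_init x n)"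
      using norm_triangle_ineq4[of "frakF_init x (Suc n)" "x n * x (Suc n) * frakF_init x n"]
      by (simp add: norm_mult)
    also have "\<dots> \<le> ?E + ?a * ?E"
      using Suc by (intro add_mono mult_left_mono) auto
    also have "\<dots> = (1 + ?a) * ?E" by (simp add: algebra_simps)
    also have "\<dots> \<le> exp ?a * ?E"
      by (intro mult_right_mono exp_ge_add_one_self) simp
    finally have 1: "cmod (frakF_init x (Suc (Suc n))) \<le> exp (\<Sum>j<Suc n. cmod (x j * x (Suc j)))"
      by (simp add: exp_add[symmetric] add.commute)
    have "cmod (frakF_init x (Suc n)) \<le> ?E" using Suc by simp
    also have "\<dots> \<le> exp (\<Sum>j<Suc n. cmod (x j * x (Suc j)))" by simp
    finally show ?case using 1 by blast
  qed simp
  hence "cmod (frakF_init x n) \<le> exp (\<Sum>j<n. cmod (x j * x (Suc j)))" by blast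
  also have "\<dots> \<le> exp (tsum 0)"
    unfolding tsum_def using sum_le_suminf[OF summable_x, of "{..<n}"] by simp
  finally show ?thesis .
qed

text \<open>Tuples are sorted by whether they use the pair (n, n + 1). Equivalently, the left-hand
  side is a discrete Wronskian of the two recurrences and hence constant in n.\<close>

lemma frakF_split:
  "frakF_init x (Suc n) * frakF_tail x (Suc n)
     - x n * x (Suc n) * frakF_init x n * frakF_tail x (Suc (Suc n)) = frakF x"
proof (induction n)
  case 0
  show ?case using frakF_tail_rec[of 0] by (simp add: frakF_eq_tail)
next
  case (Suc n)
  show ?case
    unfolding Suc[symmetric] frakF_tail_rec[of "Suc n"] by (simp add: algebra_simps)
qed

lemma frakF_init_tendsto: "frakF_init x \<longlonglongrightarrow> frakF x"
proof -
  have q: "(\<lambda>n. cmod (x n * x (Suc n))) \<longlonglongrightarrow> 0"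
    using summable_LIMSEQ_zero[OF summable_x] .
  have "(\<lambda>n. x n * x (Suc n) * (frakF_init x n * frakF_tail x (Suc (Suc n)))) \<longlonglongrightarrow> 0"
  proof (rule Lim_null_comparison)
    show "(\<lambda>n. cmod (x n * x (Suc n)) * (exp (tsum 0) * exp (tsum 0))) \<longlonglongrightarrow> 0"
      using tendsto_mult_right[OF q] by simp
    show "\<forall>\<^sub>F n in sequentially. norm (x n * x (Suc n) * (frakF_init x n * frakF_tail x (Suc (Suc n))))
        \<le> cmod (x n * x (Suc n)) * (exp (tsum 0) * exp (tsum 0))"
      unfolding norm_mult[of "_ * _" "_ * _"] norm_mult[of "frakF_init x _"]
      by (intro always_eventually allI mult_left_mono mult_mono norm_frakF_init_le norm_frakF_tail_le) auto
  qed
  \<comment> \<open>\<open>frakF_split\<close> is solved for \<open>frakF_init x (Suc n)\<close>;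
    the division is legitimate for large n because the tails tend to 1.\<close>
  hence "(\<lambda>n. (frakF x + x n * x (Suc n) * (frakF_init x n * frakF_tail x (Suc (Suc n)))) / frakF_tail x (Suc n))
     \<longlonglongrightarrow> (frakF x + 0) / 1"
    by (intro tendsto_intros frakF_tail_tendsto_1 filterlim_compose[OF frakF_tail_tendsto_1 filterlim_Suc]) auto
  moreover have "\<forall>\<^sub>F n in sequentially.
     (frakF x + x n * x (Suc n) * (frakF_init x n * frakF_tail x (Suc (Suc n)))) / frakF_tail x (Suc n) = frakF_init x (Suc n)"
  proof -
    have "\<forall>\<^sub>F n in sequentially. frakF_tail x (Suc n) \<noteq> 0"
      using tendsto_imp_eventually_ne[OF filterlim_compose[OF frakF_tail_tendsto_1 filterlim_Suc], of 0] by simp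
    thus ?thesis
    proof eventually_elim
      case (elim n)
      show ?case using frakF_split[of n] elim by (simp add: field_simps)
    qed
  qed
  ultimately have "(\<lambda>n. frakF_init x (Suc n)) \<longlonglongrightarrow> frakF x"
    using Lim_transform_eventually by fastforce
  thus ?thesis by (rule filterlim_sequentially_Suc[THEN iffD1])
qed

end

text \<open>Telescoping through the hybrids \<open>?X n\<close>, which take the neighbouring
  products up to index n from x and the later ones from y. This exact increment formula later yields
  the derivative of the characteristic function without differentiating iterated sums.\<close>

lemma frakF_diff_sums:
  assumes x: "summable (\<lambda>n. cmod (x n * x (Suc n)))"
    and y: "summable (\<lambda>n. cmod (y n * y (Suc n)))"
  shows "(\<lambda>n. - frakF_init x n * (x n * x (Suc n) - y n * y (Suc n)) * frakF_tail y (Suc (Suc n)))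
    sums (frakF x - frakF y)"
proof -
  let ?t = "\<lambda>n. - frakF_init x n * (x n * x (Suc n) - y n * y (Suc n)) * frakF_tail y (Suc (Suc n))"
  let ?X = "\<lambda>n. frakF_init x (Suc n) * frakF_tail y (Suc n)
     - x n * x (Suc n) * (frakF_init x n * frakF_tail y (Suc (Suc n)))"
  have X: "(\<Sum>j<Suc n. ?t j) = ?X n - frakF y" for n
  proof (induction n)
    case 0
    show ?case unfolding frakF_eq_tail[OF y] frakF_tail_rec[OF y, of 0] by (simp add: algebra_simps)
  next
    case (Suc n)
    show ?case
      unfolding sum.lessThan_Suc[of _ "Suc n"] Suc frakF_tail_rec[OF y, of "Suc n"]
      by (simp add: algebra_simps)
  qed
  have q: "(\<lambda>n. cmod (x n * x (Suc n))) \<longlonglongrightarrow> 0"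
    using summable_LIMSEQ_zero[OF x] .
  hence q0: "(\<lambda>n. x n * x (Suc n)) \<longlonglongrightarrow> 0"
    by (simp only: tendsto_norm_zero_iff)
  note T = frakF_tail_tendsto_1[OF y]
  have T1: "(\<lambda>n. frakF_tail y (Suc n)) \<longlonglongrightarrow> 1"
    by (rule LIMSEQ_Suc[OF T])
  have T2: "(\<lambda>n. frakF_tail y (Suc (Suc n))) \<longlonglongrightarrow> 1"
    by (rule LIMSEQ_Suc[OF T1])
  note P = frakF_init_tendsto[OF x]
  have "?X \<longlonglongrightarrow> frakF x * 1 - 0 * (frakF x * 1)"
    by (rule tendsto_diff[OF tendsto_mult[OF LIMSEQ_Suc[OF P] T1] tendsto_mult[OF q0 tendsto_mult[OF P T2]]])
  hence "(\<lambda>n. ?X n - frakF y) \<longlonglongrightarrow> frakF x - frakF y"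
    by (intro tendsto_intros) simp
  hence "(\<lambda>n. \<Sum>j<Suc n. ?t j) \<longlonglongrightarrow> frakF x - frakF y"
    by (simp only: X)
  thus ?thesis
    unfolding sums_def by (rule filterlim_sequentially_Suc[THEN iffD1])
qed

section \<open>Compact self-adjoint operators on a Hilbert space\<close>

definition orthonormal :: "'a::real_inner set \<Rightarrow> bool"
  where "orthonormal E \<longleftrightarrow> (\<forall>v\<in>E. norm v = 1) \<and> pairwise orthogonal E"

lemma orthonormal_inner:
  assumes "orthonormal E" "u \<in> E" "v \<in> E"
  shows "inner u v = (if u = v then 1 else 0)"
  using assms by (auto simp: orthonormal_def pairwise_def orthogonal_def dot_square_norm)

lemma orthonormal_subset: "orthonormal E \<Longrightarrow> F \<subseteq> E \<Longrightarrow> orthonormal F"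
  unfolding orthonormal_def by (auto intro: pairwise_mono)

lemma bessel_finite:
  fixes x :: "'a::real_inner"
  assumes "orthonormal F" "finite F"
  shows "(\<Sum>v\<in>F. (inner x v)\<^sup>2) \<le> (norm x)\<^sup>2"
proof -
  let ?s = "\<Sum>v\<in>F. inner x v *\<^sub>R v"
  have *: "inner x ?s = (\<Sum>v\<in>F. (inner x v)\<^sup>2)"
    by (simp add: inner_sum_right power2_eq_square)
  have "inner ?s ?s = (\<Sum>u\<in>F. \<Sum>v\<in>F. inner x u * (inner x v * inner u v))"
    by (simp add: inner_sum_right inner_sum_left sum_distrib_left inner_commute mult_ac)
  also have "\<dots> = (\<Sum>u\<in>F. \<Sum>v\<in>F. if u = v then (inner x u)\<^sup>2 else 0)"
    by (intro sum.cong) (auto simp: orthonormal_inner[OF assms(1)] power2_eq_square)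
  also have "\<dots> = (\<Sum>v\<in>F. (inner x v)\<^sup>2)"
    using assms(2) by simp
  finally have **: "inner ?s ?s = (\<Sum>v\<in>F. (inner x v)\<^sup>2)" .
  have "0 \<le> inner (x - ?s) (x - ?s)" by simp
  also have "\<dots> = inner x x - inner x ?s - inner ?s x + inner ?s ?s"
    by (simp only: inner_diff_left inner_diff_right)
  also have "\<dots> = inner x x - (\<Sum>v\<in>F. (inner x v)\<^sup>2)"
    using * ** inner_commute[of x ?s] by linarith
  finally show ?thesis by (simp add: dot_square_norm)
qed

lemma bessel_summable:
  assumes "orthonormal E"
  shows "(\<lambda>v. (inner x v)\<^sup>2) summable_on E"
proof (rule nonneg_bdd_above_summable_on)
  show "bdd_above (sum (\<lambda>v. (inner x v)\<^sup>2) ` {F. F \<subseteq> E \<and> finite F})"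
    using bessel_finite[OF orthonormal_subset[OF assms]] by (intro bdd_aboveI2[of _ _ "(norm x)\<^sup>2"]) auto
qed simp

definition compact_op :: "('a::real_normed_vector \<Rightarrow> 'b::real_normed_vector) \<Rightarrow> bool"
  where "compact_op T \<longleftrightarrow> (\<forall>x::nat \<Rightarrow> 'a. (\<forall>n. norm (x n) \<le> 1) \<longrightarrow>
    (\<exists>l r. strict_mono (r :: nat \<Rightarrow> nat) \<and> (\<lambda>n. T (x (r n))) \<longlonglongrightarrow> l))"

definition self_adjoint :: "('a::real_inner \<Rightarrow> 'a) \<Rightarrow> bool"
  where "self_adjoint T \<longleftrightarrow> (\<forall>x y. inner (T x) y = inner x (T y))"

lemma self_adjointD: "self_adjoint T \<Longrightarrow> inner (T x) y = inner x (T y)"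
  by (simp add: self_adjoint_def)

text \<open>
  A maximising sequence for \<open>norm (T x)\<close> on the unit sphere of \<open>M\<close> is asymptotically an
  eigenvector of \<open>T\<^sup>2\<close> for \<open>\<beta>\<^sup>2\<close>; then \<open>v\<close> or \<open>T v + \<beta> v\<close> is an eigenvector of \<open>T\<close>.
\<close>

lemma compact_self_adjoint_eigenvector:
  fixes T :: "'a::real_inner \<Rightarrow> 'a"
  assumes T: "bounded_linear T" "self_adjoint T" "compact_op T"
    and M: "subspace M" "closed M" "\<And>x. x \<in> M \<Longrightarrow> T x \<in> M"
    and x0: "x0 \<in> M" "T x0 \<noteq> 0"
  obtains v c where "v \<in> M" "norm v = 1" "c \<noteq> 0" "T v = c *\<^sub>R v"
proof -
  interpret T: bounded_linear T by fact
  let ?S = "(\<lambda>x. norm (T x)) ` {x\<in>M. norm x = 1}"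
  define \<beta> where "\<beta> = Sup ?S"
  have bdd: "bdd_above ?S"
  proof (rule bdd_aboveI2)
    fix x assume "x \<in> {x\<in>M. norm x = 1}"
    thus "norm (T x) \<le> onorm T"
      using onorm[OF T(1), of x] by simp
  qed
  have x0': "x0 \<noteq> 0" using x0(2) T.zero by auto
  have le: "norm (T x) \<le> \<beta> * norm x" if "x \<in> M" for x
  proof (cases "x = 0")
    case False
    have "norm (T (x /\<^sub>R norm x)) \<le> \<beta>"
      unfolding \<beta>_def using that False M(1)
      by (intro cSup_upper bdd imageI) (auto simp: subspace_def)
    thus ?thesis using False by (simp add: T.scaleR field_simps)
  qed (simp add: T.zero)
  have pos: "\<beta> > 0"
    using le[OF x0(1)] x0(2) x0' by (smt (verit) mult_nonpos_nonneg norm_ge_zero zero_less_norm_iff)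
  have ne: "?S \<noteq> {}"
    using x0 x0' M(1) by (auto intro!: exI[of _ "x0 /\<^sub>R norm x0"] simp: subspace_def)
  have "\<exists>x. x \<in> M \<and> norm x = 1 \<and> norm (T x) > \<beta> - inverse (Suc n)" for n
  proof -
    have "\<exists>y\<in>?S. \<beta> - inverse (Suc n) < y"
      using ne bdd by (subst less_cSup_iff[symmetric]) (auto simp: \<beta>_def)
    thus ?thesis by auto
  qed
  then obtain x where x: "\<And>n. x n \<in> M" "\<And>n. norm (x n) = 1" "\<And>n. norm (T (x n)) > \<beta> - inverse (Suc n)"
    by metis
  have lim: "(\<lambda>n. norm (T (x n))) \<longlonglongrightarrow> \<beta>"
  proof (rule tendsto_sandwich)
    show "\<forall>\<^sub>F n in sequentially. \<beta> - inverse (Suc n) \<le> norm (T (x n))"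
      using x(3) by (simp add: less_imp_le)
    show "\<forall>\<^sub>F n in sequentially. norm (T (x n)) \<le> \<beta>"
      using le[OF x(1)] by (simp add: x(2))
    show "(\<lambda>n. \<beta> - inverse (real (Suc n))) \<longlonglongrightarrow> \<beta>"
      using tendsto_diff[OF tendsto_const LIMSEQ_inverse_real_of_nat] by fastforce
  qed simp
  have "\<exists>l r. strict_mono (r :: nat \<Rightarrow> nat) \<and> (\<lambda>n. T (x (r n))) \<longlonglongrightarrow> l"
    using T(3) x(2) unfolding compact_op_def by (metis order_refl)
  then obtain l r where r: "strict_mono (r :: nat \<Rightarrow> nat)" "(\<lambda>n. T (x (r n))) \<longlonglongrightarrow> l"
    by blast
  have lim_r: "(\<lambda>n. norm (T (x (r n)))) \<longlonglongrightarrow> \<beta>"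
    using LIMSEQ_subseq_LIMSEQ[OF lim r(1)] by (simp add: o_def)
  have d: "(norm (T (T (x n)) - \<beta>\<^sup>2 *\<^sub>R x n))\<^sup>2 \<le> \<beta>\<^sup>2 * (\<beta>\<^sup>2 - (norm (T (x n)))\<^sup>2)" for n
  proof -
    have "(norm (T (T (x n)) - \<beta>\<^sup>2 *\<^sub>R x n))\<^sup>2 =
      (norm (T (T (x n))))\<^sup>2 - 2 * \<beta>\<^sup>2 * inner (T (T (x n))) (x n) + (\<beta>\<^sup>2)\<^sup>2 * (norm (x n))\<^sup>2"
      unfolding power2_norm_eq_inner
      by (simp add: inner_diff_left inner_diff_right inner_commute power2_eq_square algebra_simps)
    also have "\<dots> = (norm (T (T (x n))))\<^sup>2 - 2 * \<beta>\<^sup>2 * (norm (T (x n)))\<^sup>2 + (\<beta>\<^sup>2)\<^sup>2"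
      using self_adjointD[OF T(2), of "T (x n)" "x n"] by (simp add: x(2) power2_norm_eq_inner)
    also have "(norm (T (T (x n))))\<^sup>2 \<le> (\<beta> * norm (T (x n)))\<^sup>2"
      using le[OF M(3)[OF x(1)]] by (intro power_mono) auto
    finally show ?thesis by (simp add: power_mult_distrib algebra_simps power2_eq_square)
  qed
  have "(\<lambda>n. T (T (x (r n))) - \<beta>\<^sup>2 *\<^sub>R x (r n)) \<longlonglongrightarrow> 0"
  proof -
    have "(\<lambda>n. \<beta>\<^sup>2 * (\<beta>\<^sup>2 - (norm (T (x (r n))))\<^sup>2)) \<longlonglongrightarrow> \<beta>\<^sup>2 * (\<beta>\<^sup>2 - \<beta>\<^sup>2)"
      by (intro tendsto_intros lim_r)
    hence "(\<lambda>n. \<beta>\<^sup>2 * (\<beta>\<^sup>2 - (norm (T (x (r n))))\<^sup>2)) \<longlonglongrightarrow> 0" by simp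
    hence "(\<lambda>n. (norm (T (T (x (r n))) - \<beta>\<^sup>2 *\<^sub>R x (r n)))\<^sup>2) \<longlonglongrightarrow> 0"
      by (rule Lim_null_comparison[rotated]) (use d in auto)
    hence "(\<lambda>n. sqrt ((norm (T (T (x (r n))) - \<beta>\<^sup>2 *\<^sub>R x (r n)))\<^sup>2)) \<longlonglongrightarrow> sqrt 0"
      by (intro tendsto_intros)
    thus ?thesis by (simp add: tendsto_norm_zero_iff)
  qed
  \<comment> \<open>The vectors \<open>x (r n)\<close> themselves converge, since T T x converges
    and differs from \<beta>^2 x by a null sequence. No completeness of the space enters.\<close>
  hence "(\<lambda>n. (T (T (x (r n))) - (T (T (x (r n))) - \<beta>\<^sup>2 *\<^sub>R x (r n))) /\<^sub>R \<beta>\<^sup>2) \<longlonglongrightarrow> (T l - 0) /\<^sub>R \<beta>\<^sup>2"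
    by (intro tendsto_intros T.tendsto r(2))
  hence xr: "(\<lambda>n. x (r n)) \<longlonglongrightarrow> T l /\<^sub>R \<beta>\<^sup>2"
    using pos by simp
  define u where "u = T l /\<^sub>R \<beta>\<^sup>2"
  have uM: "u \<in> M"
    using closed_sequentially[OF M(2) _ xr] x(1) by (simp add: u_def)
  have nu: "norm u = 1"
    using tendsto_norm[OF xr] by (simp add: x(2) u_def LIMSEQ_const_iff)
  have "T u = l"
    using LIMSEQ_unique[OF r(2) T.tendsto[OF xr]] by (simp add: u_def)
  hence TT: "T (T u) = \<beta>\<^sup>2 *\<^sub>R u"
    using pos by (simp add: u_def)
  show thesis
  proof (cases "T u = (-\<beta>) *\<^sub>R u")
    case True
    thus ?thesis using that[of u "-\<beta>"] uM nu pos by simp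
  next
    case False
    define y where "y = T u + \<beta> *\<^sub>R u"
    have y0: "y \<noteq> 0"
      using False by (auto simp: y_def add_eq_0_iff2)
    have "T y = \<beta> *\<^sub>R y"
      by (simp add: y_def T.add T.scaleR TT algebra_simps power2_eq_square)
    moreover have "y \<in> M"
      unfolding y_def using M uM by (auto simp: subspace_def)
    ultimately show ?thesis
      using that[of "y /\<^sub>R norm y" \<beta>] y0 pos M(1) by (simp add: T.scaleR subspace_def)
  qed
qed

text \<open>E is a maximal orthonormal set of eigenvectors with nonzero eigenvalue. Its orthogonal
  complement is closed and invariant; if T did not vanish there, the previous lemma would supply a
  further eigenvector. The kernel of T is left out of E.\<close>

lemma compact_self_adjoint_eigenbasis:
  fixes T :: "'a::real_inner \<Rightarrow> 'a"
  assumes T: "bounded_linear T" "self_adjoint T" "compact_op T"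
  obtains E c where "orthonormal E" "\<And>v. v \<in> E \<Longrightarrow> T v = c v *\<^sub>R v" "\<And>v. v \<in> E \<Longrightarrow> c v \<noteq> 0"
    "\<And>x. (\<And>v. v \<in> E \<Longrightarrow> inner x v = 0) \<Longrightarrow> T x = 0"
proof -
  interpret T: bounded_linear T by fact
  define \<E> where "\<E> = {E. orthonormal E \<and> (\<forall>v\<in>E. \<exists>c. c \<noteq> 0 \<and> T v = c *\<^sub>R v)}"
  have "\<exists>E\<in>\<E>. \<forall>F\<in>\<E>. E \<subseteq> F \<longrightarrow> F = E"
  proof (rule subset_Zorn_nonempty)
    show "\<E> \<noteq> {}" by (auto simp: \<E>_def orthonormal_def intro!: exI[of _ "{}"])
    fix C assume C: "C \<noteq> {}" "subset.chain \<E> C"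
    have ch: "pairwise orthogonal (\<Union>C)"
      unfolding pairwise_def
    proof safe
      fix u v X Y assume *: "u \<in> X" "X \<in> C" "v \<in> Y" "Y \<in> C" "u \<noteq> v"
      have "X \<subseteq> Y \<or> Y \<subseteq> X"
        using C(2) *(2,4) by (auto simp: subset.chain_def)
      moreover have "pairwise orthogonal X" "pairwise orthogonal Y"
        using C(2) * by (auto simp: subset.chain_def \<E>_def orthonormal_def)
      ultimately show "orthogonal u v"
        using * by (auto simp: pairwise_def)
    qed
    show "\<Union>C \<in> \<E>"
    proof -
      have "X \<in> \<E>" if "X \<in> C" for X
        using C(2) that by (auto simp: subset.chain_def)
      hence "norm v = 1 \<and> (\<exists>c. c \<noteq> 0 \<and> T v = c *\<^sub>R v)" if "v \<in> \<Union>C" for v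
        using that by (force simp: \<E>_def orthonormal_def)
      thus ?thesis using ch by (simp add: \<E>_def orthonormal_def)
    qed
  qed
  then obtain E where E: "E \<in> \<E>" "\<And>F. F \<in> \<E> \<Longrightarrow> E \<subseteq> F \<Longrightarrow> F = E" by blast
  hence on: "orthonormal E" and eig: "\<forall>v\<in>E. \<exists>c. c \<noteq> 0 \<and> T v = c *\<^sub>R v"
    by (auto simp: \<E>_def)
  from eig obtain c where c: "\<And>v. v \<in> E \<Longrightarrow> c v \<noteq> 0" "\<And>v. v \<in> E \<Longrightarrow> T v = c v *\<^sub>R v"
    by metis
  define M where "M = {x. \<forall>v\<in>E. inner x v = 0}"
  have T0: "T x = 0" if "x \<in> M" for x
  proof (rule ccontr)
    assume "T x \<noteq> 0"
    moreover have "subspace M"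
      by (auto simp: subspace_def M_def inner_add_left)
    moreover have "closed M"
    proof -
      have "M = (\<Inter>v\<in>E. {x. inner x v = 0})" by (auto simp: M_def)
      moreover have "closed {x. inner x v = 0}" for v :: 'a
        by (intro closed_Collect_eq continuous_intros)
      ultimately show ?thesis by auto
    qed
    moreover have "T y \<in> M" if "y \<in> M" for y
      using that c self_adjointD[OF T(2), of y] by (auto simp: M_def)
    ultimately obtain v k where v: "v \<in> M" "norm v = 1" "k \<noteq> 0" "T v = k *\<^sub>R v"
      using compact_self_adjoint_eigenvector[OF T] \<open>x \<in> M\<close> by metis
    have "insert v E \<in> \<E>"
      using on eig v by (auto simp: \<E>_def orthonormal_def M_def pairwise_insert orthogonal_def inner_commute)
    hence "v \<in> E" using E(2)[of "insert v E"] by auto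
    hence "inner v v = 0" using v(1) by (auto simp: M_def)
    thus False using v(2) by auto
  qed
  show thesis
    by (rule that[OF on, of c]) (use c T0 in \<open>auto simp: M_def\<close>)
qed

text \<open>Functions of an operator in an orthonormal eigenfamily. For square-summable f the series
  converges absolutely in norm by Bessel's inequality, so that unordered sums over the set E are
  available.\<close>

definition diag_sum :: "'a::{real_inner,banach} set \<Rightarrow> ('a \<Rightarrow> real) \<Rightarrow> 'a \<Rightarrow> 'a"
  where "diag_sum E f x = (\<Sum>\<^sub>\<infinity>v\<in>E. (f v * inner x v) *\<^sub>R v)"

context
  fixes E :: "'a::{real_inner,banach} set" and f :: "'a \<Rightarrow> real"
  assumes on: "orthonormal E" and f: "(\<lambda>v. (f v)\<^sup>2) summable_on E"
begin

lemma diag_sum_summable: "(\<lambda>v. norm ((f v * inner x v) *\<^sub>R v)) summable_on E"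
proof (rule summable_on_comparison_test)
  show "(\<lambda>v. (f v)\<^sup>2 + (inner x v)\<^sup>2) summable_on E"
    by (intro summable_on_add f bessel_summable on)
  fix v assume "v \<in> E"
  hence "norm v = 1" using on by (auto simp: orthonormal_def)
  moreover have "2 * \<bar>f v * inner x v\<bar> \<le> (f v)\<^sup>2 + (inner x v)\<^sup>2"
    using sum_squares_bound[of "\<bar>f v\<bar>" "\<bar>inner x v\<bar>"] by (simp add: abs_mult)
  ultimately show "norm ((f v * inner x v) *\<^sub>R v) \<le> (f v)\<^sup>2 + (inner x v)\<^sup>2"
    by simp
qed auto

lemma diag_sum_has_sum: "((\<lambda>v. (f v * inner x v) *\<^sub>R v) has_sum diag_sum E f x) E"
  unfolding diag_sum_def using abs_summable_summable[OF diag_sum_summable] by simp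

lemma diag_sum_inner_has_sum:
  "((\<lambda>v. f v * inner x v * inner y v) has_sum inner (diag_sum E f x) y) E"
  using has_sum_bounded_linear[OF bounded_linear_inner_left diag_sum_has_sum, of x y]
  by (simp add: inner_commute)

lemma diag_sum_bound: "norm (diag_sum E f x) \<le> (infsum (\<lambda>v. (f v)\<^sup>2) E + 1) * norm x"
proof (cases "x = 0")
  case True
  thus ?thesis by (simp add: diag_sum_def)
next
  case False
  let ?F = "infsum (\<lambda>v. (f v)\<^sup>2) E"
  have "norm (diag_sum E f x) \<le> (\<Sum>\<^sub>\<infinity>v\<in>E. norm ((f v * inner x v) *\<^sub>R v))"
    unfolding diag_sum_def by (rule norm_infsum_bound) (rule diag_sum_summable)
  also have "\<dots> \<le> (?F + 1) * norm x"
  proof (rule infsum_le_finite_sums[OF diag_sum_summable])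
    fix G assume G: "finite G" "G \<subseteq> E"
    have "(\<Sum>v\<in>G. norm ((f v * inner x v) *\<^sub>R v)) = (\<Sum>v\<in>G. \<bar>f v\<bar> * \<bar>inner x v\<bar>)"
      using on G by (intro sum.cong) (auto simp: orthonormal_def abs_mult)
    also have "\<dots> \<le> (\<Sum>v\<in>G. (norm x * (f v)\<^sup>2 + (inner x v)\<^sup>2 / norm x))"
    proof (rule sum_mono)
      fix v
      \<comment> \<open>The two factors are balanced by the square root of \<open>norm x\<close>, so
        that both terms of the bound become linear in \<open>norm x\<close>.\<close>
      have "2 * (sqrt (norm x) * \<bar>f v\<bar>) * (\<bar>inner x v\<bar> / sqrt (norm x))
          \<le> (sqrt (norm x) * \<bar>f v\<bar>)\<^sup>2 + (\<bar>inner x v\<bar> / sqrt (norm x))\<^sup>2"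
        by (rule sum_squares_bound)
      hence "2 * (\<bar>f v\<bar> * \<bar>inner x v\<bar>) \<le> norm x * (f v)\<^sup>2 + (inner x v)\<^sup>2 / norm x"
        using False by (simp add: power_mult_distrib power_divide)
      moreover have "0 \<le> \<bar>f v\<bar> * \<bar>inner x v\<bar>" by simp
      ultimately show "\<bar>f v\<bar> * \<bar>inner x v\<bar> \<le> norm x * (f v)\<^sup>2 + (inner x v)\<^sup>2 / norm x"
        by linarith
    qed
    also have "\<dots> = norm x * (\<Sum>v\<in>G. (f v)\<^sup>2) + (\<Sum>v\<in>G. (inner x v)\<^sup>2) / norm x"
      by (simp add: sum.distrib sum_distrib_left sum_divide_distrib)
    also have "\<dots> \<le> norm x * ?F + (norm x)\<^sup>2 / norm x"
      using G by (intro add_mono mult_left_mono divide_right_mono finite_sum_le_infsum f bessel_finite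
          orthonormal_subset[OF on]) auto
    also have "\<dots> = (?F + 1) * norm x"
      using False by (simp add: field_simps power2_eq_square)
    finally show "(\<Sum>v\<in>G. norm ((f v * inner x v) *\<^sub>R v)) \<le> (?F + 1) * norm x" .
  qed
  finally show ?thesis .
qed

lemma diag_sum_bounded_linear: "bounded_linear (diag_sum E f)"
proof (rule bounded_linear_intro)
  fix x y :: 'a and r :: real
  have "((\<lambda>v. (f v * inner x v) *\<^sub>R v + (f v * inner y v) *\<^sub>R v) has_sum
      (diag_sum E f x + diag_sum E f y)) E"
    by (intro has_sum_add diag_sum_has_sum)
  hence "((\<lambda>v. (f v * inner (x + y) v) *\<^sub>R v) has_sum (diag_sum E f x + diag_sum E f y)) E"
    by (simp add: inner_add_left algebra_simps)
  thus "diag_sum E f (x + y) = diag_sum E f x + diag_sum E f y"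
    using diag_sum_has_sum has_sum_unique by blast
  have "((\<lambda>v. r *\<^sub>R ((f v * inner x v) *\<^sub>R v)) has_sum r *\<^sub>R diag_sum E f x) E"
    by (intro has_sum_scaleR diag_sum_has_sum)
  hence "((\<lambda>v. (f v * inner (r *\<^sub>R x) v) *\<^sub>R v) has_sum r *\<^sub>R diag_sum E f x) E"
    by (simp add: algebra_simps)
  thus "diag_sum E f (r *\<^sub>R x) = r *\<^sub>R diag_sum E f x"
    using diag_sum_has_sum has_sum_unique by blast
  show "norm (diag_sum E f x) \<le> norm x * (infsum (\<lambda>v. (f v)\<^sup>2) E + 1)"
    using diag_sum_bound[of x] by (simp add: mult.commute)
qed

lemma diag_sum_self_adjoint: "self_adjoint (diag_sum E f)"
  unfolding self_adjoint_def
proof (intro allI)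
  fix x y
  show "inner (diag_sum E f x) y = inner x (diag_sum E f y)"
    using has_sum_unique[OF diag_sum_inner_has_sum[of x y]] diag_sum_inner_has_sum[of y x]
    by (simp add: inner_commute mult_ac)
qed

lemma diag_sum_in:
  assumes "u \<in> E"
  shows "diag_sum E f u = f u *\<^sub>R u"
proof -
  have "((\<lambda>v. (f v * inner u v) *\<^sub>R v) has_sum f u *\<^sub>R u) E"
    by (rule has_sum_finite_neutralI[of "{u}"])
      (use assms on in \<open>auto simp: orthonormal_inner\<close>)
  thus ?thesis using diag_sum_has_sum has_sum_unique by blast
qed

lemma diag_sum_orthogonal: "(\<And>v. v \<in> E \<Longrightarrow> inner x v = 0) \<Longrightarrow> diag_sum E f x = 0"
  unfolding diag_sum_def by (simp add: infsum_0)

text \<open>The difference of both sides is self-adjoint with square \<open>0\<close>.\<close>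

lemma eq_diag_sum:
  assumes T: "bounded_linear T" "self_adjoint T" "\<And>v. v \<in> E \<Longrightarrow> T v = f v *\<^sub>R v"
    "\<And>x. (\<And>v. v \<in> E \<Longrightarrow> inner x v = 0) \<Longrightarrow> T x = 0"
  shows "T x = diag_sum E f x"
proof -
  define R where "R x = T x - diag_sum E f x" for x
  have sa: "inner (R x) y = inner x (R y)" for x y
    using self_adjointD[OF T(2)] self_adjointD[OF diag_sum_self_adjoint]
    by (simp add: R_def inner_diff_left inner_diff_right)
  have "inner (R x) v = 0" if "v \<in> E" for v
    using sa[of x v] that T(3) diag_sum_in by (simp add: R_def)
  hence "R (R x) = 0"
    using T(4)[of "R x"] diag_sum_orthogonal[of "R x"] by (simp add: R_def[of "R x"])
  hence "inner (R x) (R x) = 0"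
    by (simp add: sa)
  thus ?thesis by (simp add: R_def)
qed

end

section \<open>The real Hilbert space of square-summable sequences\<close>

text \<open>Real scalars suffice because the matrix is real: eigenvectors can be chosen real, and a
  complex sequence is a pair of elements of \<open>l2\<close>.\<close>

typedef l2 = "{x :: nat \<Rightarrow> real. summable (\<lambda>n. (x n)\<^sup>2)}"
  morphisms coord seq_l2
  by (rule exI[of _ "\<lambda>_. 0"]) simp

setup_lifting type_definition_l2

lemma coord_seq_l2: "summable (\<lambda>n. (x n)\<^sup>2) \<Longrightarrow> coord (seq_l2 x) n = x n"
  by (simp add: seq_l2_inverse)

lemma l2_eqI: "(\<And>n. coord x n = coord y n) \<Longrightarrow> x = y"
  by (simp add: coord_inject[symmetric] fun_eq_iff)

lemma summable_coord_power2: "summable (\<lambda>n. (coord x n)\<^sup>2)"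
  using coord[of x] by simp

lemma power2_add_le: "(a + b)\<^sup>2 \<le> 2 * (a\<^sup>2 + b\<^sup>2)" for a b :: real
  using sum_squares_bound[of a b] by (simp add: power2_sum)

lemma summable_power2_add:
  fixes a b :: "nat \<Rightarrow> real"
  assumes "summable (\<lambda>n. (a n)\<^sup>2)" "summable (\<lambda>n. (b n)\<^sup>2)"
  shows "summable (\<lambda>n. (a n + b n)\<^sup>2)"
proof (rule summable_comparison_test'[where N = 0])
  show "summable (\<lambda>n. 2 * (a n)\<^sup>2 + 2 * (b n)\<^sup>2)"
    by (intro summable_add summable_mult assms)
  show "norm ((a n + b n)\<^sup>2) \<le> 2 * (a n)\<^sup>2 + 2 * (b n)\<^sup>2" for n
    using sum_squares_bound[of "a n" "b n"] zero_le_power2[of "a n + b n"]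
    unfolding real_norm_def abs_of_nonneg[OF zero_le_power2] power2_sum by linarith
qed

lemma summable_power2_mult:
  fixes a b :: "nat \<Rightarrow> real"
  assumes "summable (\<lambda>n. (a n)\<^sup>2)" "summable (\<lambda>n. (b n)\<^sup>2)"
  shows "summable (\<lambda>n. \<bar>a n * b n\<bar>)"
proof (rule summable_comparison_test'[where N = 0])
  show "summable (\<lambda>n. (a n)\<^sup>2 + (b n)\<^sup>2)"
    by (intro summable_add assms)
  show "norm \<bar>a n * b n\<bar> \<le> (a n)\<^sup>2 + (b n)\<^sup>2" for n
  proof -
    have "2 * (\<bar>a n\<bar> * \<bar>b n\<bar>) \<le> (a n)\<^sup>2 + (b n)\<^sup>2"
      using sum_squares_bound[of "\<bar>a n\<bar>" "\<bar>b n\<bar>"] by simp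
    moreover have "0 \<le> \<bar>a n\<bar> * \<bar>b n\<bar>" by simp
    ultimately show ?thesis unfolding abs_mult real_norm_def by linarith
  qed
qed

instantiation l2 :: real_vector
begin

lift_definition zero_l2 :: l2 is "\<lambda>_. 0" by simp
lift_definition plus_l2 :: "l2 \<Rightarrow> l2 \<Rightarrow> l2" is "\<lambda>x y n. x n + y n"
  by (rule summable_power2_add)
lift_definition uminus_l2 :: "l2 \<Rightarrow> l2" is "\<lambda>x n. - x n" by simp
lift_definition minus_l2 :: "l2 \<Rightarrow> l2 \<Rightarrow> l2" is "\<lambda>x y n. x n - y n"
  using summable_power2_add[of _ "\<lambda>n. - _ n"] by fastforce
lift_definition scaleR_l2 :: "real \<Rightarrow> l2 \<Rightarrow> l2" is "\<lambda>r x n. r * x n"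
  by (simp add: power_mult_distrib summable_mult)

instance
  by standard (transfer; simp add: fun_eq_iff algebra_simps; fail)+

end

lemma coord_simps [simp]:
  "coord 0 n = 0" "coord (x + y) n = coord x n + coord y n" "coord (- x) n = - coord x n"
  "coord (x - y) n = coord x n - coord y n" "coord (r *\<^sub>R x) n = r * coord x n"
  by (transfer; simp)+

lemma summable_coord_mult: "summable (\<lambda>n. coord x n * coord y n)"
  by (rule summable_rabs_cancel[OF summable_power2_mult]) (rule summable_coord_power2)+

instantiation l2 :: real_inner
begin

definition inner_l2 :: "l2 \<Rightarrow> l2 \<Rightarrow> real"
  where "inner_l2 x y = (\<Sum>n. coord x n * coord y n)"
definition norm_l2 :: "l2 \<Rightarrow> real"
  where "norm_l2 x = sqrt (inner x x)"
definition dist_l2 :: "l2 \<Rightarrow> l2 \<Rightarrow> real"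
  where "dist_l2 x y = norm (x - y)"
definition sgn_l2 :: "l2 \<Rightarrow> l2"
  where "sgn_l2 x = x /\<^sub>R norm x"
definition uniformity_l2 :: "(l2 \<times> l2) filter"
  where "uniformity_l2 = (INF e\<in>{0<..}. principal {(x, y). dist x y < e})"
definition open_l2 :: "l2 set \<Rightarrow> bool"
  where "open_l2 U = (\<forall>x\<in>U. eventually (\<lambda>(x', y). x' = x \<longrightarrow> y \<in> U) uniformity)"

instance
proof
  fix x y z :: l2 and r :: real
  show "dist x y = norm (x - y)" by (rule dist_l2_def)
  show "sgn x = x /\<^sub>R norm x" by (rule sgn_l2_def)
  show "uniformity = (INF e\<in>{0<..}. principal {(x::l2, y). dist x y < e})" by (rule uniformity_l2_def)
  show "open U = (\<forall>x\<in>U. \<forall>\<^sub>F (x', y) in uniformity. x' = x \<longrightarrow> y \<in> U)" for U :: "l2 set"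
    by (rule open_l2_def)
  show "inner x y = inner y x" by (simp add: inner_l2_def mult.commute)
  show "inner (x + y) z = inner x z + inner y z"
    by (simp add: inner_l2_def distrib_right suminf_add[symmetric] summable_coord_mult)
  show "inner (r *\<^sub>R x) y = r * inner x y"
    by (simp add: inner_l2_def mult.assoc suminf_mult summable_coord_mult)
  show "0 \<le> inner x x"
    unfolding inner_l2_def by (rule suminf_nonneg[OF summable_coord_mult]) simp
  show "(inner x x = 0) = (x = 0)"
    unfolding inner_l2_def
    by (subst suminf_eq_zero_iff[OF summable_coord_mult]) (auto intro: l2_eqI)
  show "norm x = sqrt (inner x x)" by (rule norm_l2_def)
qed

end

lemma inner_l2_sums: "(\<lambda>n. coord x n * coord y n) sums inner x y"
  unfolding inner_l2_def using summable_coord_mult by (rule summable_sums)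

lemma norm_l2_sums: "(\<lambda>n. (coord x n)\<^sup>2) sums (norm x)\<^sup>2"
  using inner_l2_sums[of x x] unfolding power2_norm_eq_inner by (simp add: power2_eq_square)

lemma sum_coord_le: "finite I \<Longrightarrow> (\<Sum>n\<in>I. (coord x n)\<^sup>2) \<le> (norm x)\<^sup>2"
  using sum_le_suminf[OF summable_coord_power2, of I x] norm_l2_sums[of x] by (simp add: sums_iff)

lemma abs_coord_le: "\<bar>coord x n\<bar> \<le> norm x"
  using sum_coord_le[of "{n}" x] by (simp add: power2_le_iff_abs_le)

lemma norm_l2_le:
  assumes "\<And>n. (coord x n)\<^sup>2 \<le> f n" "f sums s" "s \<le> B\<^sup>2" "B \<ge> 0"
  shows "norm x \<le> B"
proof -
  have "(norm x)\<^sup>2 \<le> s"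
    by (rule sums_le[OF assms(1) norm_l2_sums assms(2)])
  hence "(norm x)\<^sup>2 \<le> B\<^sup>2" using assms(3) by (rule order_trans)
  thus ?thesis using assms(4) by (rule power2_le_imp_le)
qed

text \<open>Fatou's lemma for coordinatewise limits: each finite partial sum of squares passes to
  the limit. It serves both for completeness and for extracting weak limits.\<close>

lemma seq_l2_limit:
  assumes "\<And>i. (\<lambda>n. coord (X n) i) \<longlonglongrightarrow> c i" "\<And>n. norm (X n) \<le> B"
  shows "summable (\<lambda>i. (c i)\<^sup>2)" "norm (seq_l2 c) \<le> B"
proof -
  have B: "0 \<le> B" using assms(2)[of 0] norm_ge_zero order_trans by blast
  have le: "(\<Sum>i<k. (c i)\<^sup>2) \<le> B\<^sup>2" for k
  proof (rule tendsto_upperbound)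
    show "(\<lambda>n. \<Sum>i<k. (coord (X n) i)\<^sup>2) \<longlonglongrightarrow> (\<Sum>i<k. (c i)\<^sup>2)"
      by (intro tendsto_intros assms)
    have "(\<Sum>i<k. (coord (X n) i)\<^sup>2) \<le> B\<^sup>2" for n
      using sum_coord_le[of "{..<k}" "X n"] power_mono[OF assms(2)[of n], of 2] by simp
    thus "\<forall>\<^sub>F n in sequentially. (\<Sum>i<k. (coord (X n) i)\<^sup>2) \<le> B\<^sup>2" by simp
  qed simp
  show sm: "summable (\<lambda>i. (c i)\<^sup>2)"
    by (rule summableI_nonneg_bounded[of _ "B\<^sup>2"]) (use le in auto)
  have "(\<Sum>i. (c i)\<^sup>2) \<le> B\<^sup>2"
    by (rule suminf_le_const[OF sm le])
  thus "norm (seq_l2 c) \<le> B"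
    using norm_l2_sums[of "seq_l2 c"] power2_le_imp_le[OF _ B]
    by (simp add: coord_seq_l2[OF sm] sums_iff)
qed

instance l2 :: banach
proof
  fix X :: "nat \<Rightarrow> l2" assume X: "Cauchy X"
  have "Cauchy (\<lambda>n. coord (X n) i)" for i
    unfolding Cauchy_def
  proof (intro allI impI)
    fix e :: real assume "e > 0"
    then obtain M where "\<forall>m\<ge>M. \<forall>n\<ge>M. dist (X m) (X n) < e" using X by (auto simp: Cauchy_def)
    moreover have "dist (coord (X m) i) (coord (X n) i) \<le> dist (X m) (X n)" for m n
      using abs_coord_le[of "X m - X n" i] by (simp add: dist_norm)
    ultimately show "\<exists>M. \<forall>m\<ge>M. \<forall>n\<ge>M. dist (coord (X m) i) (coord (X n) i) < e"
      by (meson order_le_less_trans)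
  qed
  hence "\<forall>i. \<exists>l. (\<lambda>n. coord (X n) i) \<longlonglongrightarrow> l"
    by (metis Cauchy_convergent_iff convergentD)
  then obtain c where c: "\<And>i. (\<lambda>n. coord (X n) i) \<longlonglongrightarrow> c i" by metis
  obtain B where B: "\<And>n. norm (X n) \<le> B"
    using cauchy_imp_bounded[OF X] by (auto simp: bounded_iff)
  have sm: "summable (\<lambda>i. (c i)\<^sup>2)" by (rule seq_l2_limit[OF c B])
  have "X \<longlonglongrightarrow> seq_l2 c"
    unfolding LIMSEQ_iff
  proof (intro allI impI)
    fix e :: real assume e: "e > 0"
    then obtain M where M: "\<And>m n. m \<ge> M \<Longrightarrow> n \<ge> M \<Longrightarrow> norm (X m - X n) < e / 2"
      using X unfolding Cauchy_iff by (meson half_gt_zero)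
    have "norm (X m - seq_l2 c) < e" if "m \<ge> M" for m
    proof -
      \<comment> \<open>With m fixed, the Cauchy bound on all \<open>X m - X (n + M)\<close> is
        inherited by their coordinatewise limit.\<close>
      have 1: "(\<lambda>n. coord (X m - X (n + M)) i) \<longlonglongrightarrow> coord (X m) i - c i" for i
        using LIMSEQ_ignore_initial_segment[OF c[of i], of M] by (auto intro: tendsto_diff)
      have "norm (seq_l2 (\<lambda>i. coord (X m) i - c i)) \<le> e / 2"
        by (rule seq_l2_limit(2)[OF 1]) (use M that in \<open>simp add: less_imp_le\<close>)
      moreover have "seq_l2 (\<lambda>i. coord (X m) i - c i) = X m - seq_l2 c"
      proof (rule l2_eqI)
        have "norm (X m - X (n + M)) \<le> e / 2" for n
          using M that by (simp add: less_imp_le)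
        from seq_l2_limit(1)[OF 1 this]
        show "coord (seq_l2 (\<lambda>i. coord (X m) i - c i)) n = coord (X m - seq_l2 c) n" for n
          by (simp add: coord_seq_l2[OF sm] coord_seq_l2)
      qed
      ultimately show ?thesis using e by simp
    qed
    thus "\<exists>no. \<forall>n\<ge>no. norm (X n - seq_l2 c) < e" by blast
  qed
  thus "convergent X" by (auto simp: convergent_def)
qed

definition basis_l2 :: "nat \<Rightarrow> l2"
  where "basis_l2 n = seq_l2 (\<lambda>k. if k = n then 1 else 0)"

lemma coord_basis_l2: "coord (basis_l2 n) k = (if k = n then 1 else 0)"
  unfolding basis_l2_def
  by (rule coord_seq_l2, rule summable_finite[of "{n}"]) auto

lemma inner_basis_l2 [simp]: "inner x (basis_l2 n) = coord x n" "inner (basis_l2 n) x = coord x n"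
proof -
  show "inner x (basis_l2 n) = coord x n"
    unfolding inner_l2_def by (subst suminf_finite[of "{n}"]) (auto simp: coord_basis_l2)
  thus "inner (basis_l2 n) x = coord x n" by (simp add: inner_commute)
qed

lemma norm_basis_l2 [simp]: "norm (basis_l2 n) = 1"
  by (simp add: norm_eq_sqrt_inner coord_basis_l2)

lemma sum_orthonormal_coord_le:
  assumes "orthonormal F" "finite F"
  shows "(\<Sum>v\<in>F. (coord v n)\<^sup>2) \<le> 1"
  using bessel_finite[OF assms, of "basis_l2 n"] by simp

section \<open>Hilbert--Schmidt operators\<close>

lemma basis_l2_expansion: "(\<lambda>N. \<Sum>n<N. coord x n *\<^sub>R basis_l2 n) \<longlonglongrightarrow> x"
proof -
  have c: "coord (\<Sum>n<N. coord x n *\<^sub>R basis_l2 n) k = (if k < N then coord x k else 0)" for N k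
    by (induction N) (auto simp: coord_basis_l2 less_Suc_eq)
  have "(norm (x - (\<Sum>n<N. coord x n *\<^sub>R basis_l2 n)))\<^sup>2 = (\<Sum>n. (coord x (n + N))\<^sup>2)" for N
  proof -
    let ?y = "x - (\<Sum>n<N. coord x n *\<^sub>R basis_l2 n)"
    have "(\<Sum>n. (coord ?y n)\<^sup>2) = (\<Sum>n. (coord ?y (n + N))\<^sup>2) + (\<Sum>n<N. (coord ?y n)\<^sup>2)"
      by (rule suminf_split_initial_segment) (rule summable_coord_power2)
    thus ?thesis using norm_l2_sums[of ?y] by (simp add: sums_iff c)
  qed
  moreover have "(\<lambda>N. \<Sum>n. (coord x (n + N))\<^sup>2) \<longlonglongrightarrow> 0"
    using suminf_exist_split2[OF summable_coord_power2[of x]] by simp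
  ultimately have "(\<lambda>N. sqrt ((norm (x - (\<Sum>n<N. coord x n *\<^sub>R basis_l2 n)))\<^sup>2)) \<longlonglongrightarrow> sqrt 0"
    by (intro tendsto_real_sqrt) simp
  hence "(\<lambda>N. norm ((\<Sum>n<N. coord x n *\<^sub>R basis_l2 n) - x)) \<longlonglongrightarrow> 0"
    by (simp add: norm_minus_commute)
  thus ?thesis unfolding tendsto_norm_zero_iff by (rule LIM_zero_cancel)
qed

lemma coordwise_limit_imp_weak_limit:
  assumes "\<And>i. (\<lambda>n. coord (y n) i) \<longlonglongrightarrow> 0" "\<And>n. norm (y n) \<le> B"
  shows "(\<lambda>n. inner (y n) z) \<longlonglongrightarrow> 0"
proof (rule LIMSEQ_I)
  fix e :: real assume e: "e > 0"
  have B: "B \<ge> 0" using assms(2)[of 0] norm_ge_zero order_trans by blast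
  let ?z = "\<lambda>N. \<Sum>n<N. coord z n *\<^sub>R basis_l2 n"
  obtain N where N: "norm (z - ?z N) < e / (2 * (B + 1))"
    using LIMSEQ_D[OF basis_l2_expansion[of z], of "e / (2 * (B + 1))"] e B
    by (auto simp: norm_minus_commute)
  have "(\<lambda>n. \<Sum>i<N. coord z i * coord (y n) i) \<longlonglongrightarrow> (\<Sum>i<N. coord z i * 0)"
    by (intro tendsto_intros assms)
  then obtain M where M: "\<And>n. n \<ge> M \<Longrightarrow> \<bar>\<Sum>i<N. coord z i * coord (y n) i\<bar> < e / 2"
    using LIMSEQ_D[of _ 0 "e / 2"] e by fastforce
  have "norm (inner (y n) z - 0) < e" if "n \<ge> M" for n
  proof -
    have "inner (y n) z = inner (y n) (z - ?z N) + (\<Sum>i<N. coord z i * coord (y n) i)"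
      by (simp add: inner_diff_right inner_sum_right)
    moreover have "\<bar>inner (y n) (z - ?z N)\<bar> \<le> B * (e / (2 * (B + 1)))"
      using Cauchy_Schwarz_ineq2[of "y n" "z - ?z N"] mult_mono[OF assms(2)[of n] less_imp_le[OF N]] B
      by fastforce
    moreover have "B * (e / (2 * (B + 1))) \<le> e / 2"
      using B e by (simp add: field_simps)
    ultimately show ?thesis using M[OF that] unfolding real_norm_def diff_zero by linarith
  qed
  thus "\<exists>no. \<forall>n\<ge>no. norm (inner (y n) z - 0) < e" by blast
qed

definition hilbert_schmidt :: "(l2 \<Rightarrow> l2) \<Rightarrow> bool"
  where "hilbert_schmidt T \<longleftrightarrow> summable (\<lambda>n. (norm (T (basis_l2 n)))\<^sup>2)"

lemma coord_self_adjoint: "self_adjoint T \<Longrightarrow> coord (T x) n = inner x (T (basis_l2 n))"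
  by (metis inner_basis_l2(1) self_adjointD)

text \<open>A diagonal subsequence of a bounded sequence converges coordinatewise, hence weakly
  after subtracting the limit. The squared norm of the image is a series of squared inner products
  with the vectors T e_i, and dominated convergence turns weak into norm convergence.\<close>

lemma hilbert_schmidt_compact:
  assumes T: "bounded_linear T" "self_adjoint T" "hilbert_schmidt T"
  shows "compact_op T"
  unfolding compact_op_def
proof (intro allI impI)
  interpret T: bounded_linear T by fact
  fix x :: "nat \<Rightarrow> l2" assume x: "\<forall>n. norm (x n) \<le> 1"
  have "norm (coord (x n) i) \<le> 1" for n i
    using abs_coord_le[of "x n" i] x order_trans by (metis real_norm_def)
  then obtain r where r: "strict_mono (r :: nat \<Rightarrow> nat)"
    "\<And>i. i \<in> UNIV \<Longrightarrow> \<exists>l. (\<lambda>n. coord (x (r n)) i) \<longlonglongrightarrow> l"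
    using function_convergent_subsequence[of UNIV "\<lambda>n. coord (x n)" 1] by blast
  then obtain c where c: "\<And>i. (\<lambda>n. coord (x (r n)) i) \<longlonglongrightarrow> c i" by (metis UNIV_I)
  have n1: "norm (x (r n)) \<le> 1" for n using x by blast
  have sm: "summable (\<lambda>i. (c i)\<^sup>2)" and cn: "norm (seq_l2 c) \<le> 1"
    by (rule seq_l2_limit[OF c n1])+
  let ?y = "\<lambda>n. x (r n) - seq_l2 c"
  have y0: "(\<lambda>n. coord (?y n) i) \<longlonglongrightarrow> 0" for i
    using c[of i] by (simp add: coord_seq_l2[OF sm] LIM_zero)
  have y2: "norm (?y n) \<le> 2" for n
    using norm_triangle_ineq4[of "x (r n)" "seq_l2 c"] n1[of n] cn by linarith
  have weak: "(\<lambda>n. inner (?y n) z) \<longlonglongrightarrow> 0" for z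
    by (rule coordwise_limit_imp_weak_limit[OF y0 y2])
  have "(\<lambda>n. \<Sum>i. (inner (?y n) (T (basis_l2 i)))\<^sup>2) \<longlonglongrightarrow> (\<Sum>i. 0)"
  proof (rule tannerys_theorem[THEN conjunct2, THEN conjunct2])
    show "summable (\<lambda>i. 4 * (norm (T (basis_l2 i)))\<^sup>2)"
      \<comment> \<open>The factor 4 is the square of the bound 2 on \<open>?y n\<close>.\<close>
      using T(3) by (simp add: hilbert_schmidt_def summable_mult)
    show "(\<lambda>n. (inner (?y n) (T (basis_l2 i)))\<^sup>2) \<longlonglongrightarrow> 0" for i
      using tendsto_power[OF weak, of "T (basis_l2 i)" 2] by simp
    have "norm ((inner (?y n) (T (basis_l2 i)))\<^sup>2) \<le> 4 * (norm (T (basis_l2 i)))\<^sup>2" for n i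
    proof -
      have "\<bar>inner (?y n) (T (basis_l2 i))\<bar> \<le> 2 * norm (T (basis_l2 i))"
        using Cauchy_Schwarz_ineq2 mult_right_mono[OF y2 norm_ge_zero] order_trans by blast
      from power_mono[OF this, of 2] show ?thesis by (simp add: power_mult_distrib)
    qed
    thus "\<forall>\<^sub>F (i, n) in at_top \<times>\<^sub>F sequentially.
        norm ((inner (?y n) (T (basis_l2 i)))\<^sup>2) \<le> 4 * (norm (T (basis_l2 i)))\<^sup>2"
      by (intro always_eventually) auto
  qed simp
  hence "(\<lambda>n. (norm (T (?y n)))\<^sup>2) \<longlonglongrightarrow> 0"
    using norm_l2_sums[of "T (?y _)"] by (simp add: sums_iff coord_self_adjoint[OF T(2)])
  hence "(\<lambda>n. sqrt ((norm (T (?y n)))\<^sup>2)) \<longlonglongrightarrow> sqrt 0"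
    by (rule tendsto_real_sqrt)
  hence "(\<lambda>n. T (x (r n)) - T (seq_l2 c)) \<longlonglongrightarrow> 0"
    by (simp add: tendsto_norm_zero_iff T.diff)
  hence "(\<lambda>n. T (x (r n))) \<longlonglongrightarrow> T (seq_l2 c)"
    by (rule LIM_zero_cancel)
  thus "\<exists>l r. strict_mono (r :: nat \<Rightarrow> nat) \<and> (\<lambda>n. T (x (r n))) \<longlonglongrightarrow> l"
    using r(1) by blast
qed

text \<open>The half of basis independence needed to make eigenvalues square-summable:
  self-adjointness moves T to the standard basis, the sums are exchanged, and Bessel's inequality is
  applied to each T e_n.\<close>

lemma hilbert_schmidt_orthonormal_sum:
  assumes T: "self_adjoint T" "hilbert_schmidt T" and F: "orthonormal F" "finite F"
  shows "(\<Sum>v\<in>F. (norm (T v))\<^sup>2) \<le> (\<Sum>n. (norm (T (basis_l2 n)))\<^sup>2)"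
proof -
  have s: "(\<lambda>n. (inner v (T (basis_l2 n)))\<^sup>2) sums (norm (T v))\<^sup>2" for v
    using norm_l2_sums[of "T v"] by (simp add: coord_self_adjoint[OF T(1)])
  have *: "(\<lambda>n. \<Sum>v\<in>F. (inner v (T (basis_l2 n)))\<^sup>2) sums (\<Sum>v\<in>F. (norm (T v))\<^sup>2)"
    by (rule sums_sum) (rule s)
  have "(\<Sum>v\<in>F. (inner v (T (basis_l2 n)))\<^sup>2) \<le> (norm (T (basis_l2 n)))\<^sup>2" for n
    using bessel_finite[OF F, of "T (basis_l2 n)"] by (simp add: inner_commute)
  from sums_le[OF this * summable_sums[OF T(2)[unfolded hilbert_schmidt_def]]] show ?thesis .
qed

theorem hilbert_schmidt_spectral:
  assumes T: "bounded_linear T" "self_adjoint T" "hilbert_schmidt T"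
  obtains E c where "orthonormal E" "(\<lambda>v. (c v)\<^sup>2) summable_on E" "\<And>v. v \<in> E \<Longrightarrow> c v \<noteq> 0"
    "\<And>v. v \<in> E \<Longrightarrow> T v = c v *\<^sub>R v" "\<And>x. T x = diag_sum E c x"
    "\<And>x. (\<And>v. v \<in> E \<Longrightarrow> inner x v = 0) \<Longrightarrow> T x = 0"
proof -
  obtain E c where E: "orthonormal E" "\<And>v. v \<in> E \<Longrightarrow> T v = c v *\<^sub>R v" "\<And>v. v \<in> E \<Longrightarrow> c v \<noteq> 0"
    "\<And>x. (\<And>v. v \<in> E \<Longrightarrow> inner x v = 0) \<Longrightarrow> T x = 0"
    using compact_self_adjoint_eigenbasis[OF T(1,2) hilbert_schmidt_compact[OF T]] by metis
  have sm: "(\<lambda>v. (c v)\<^sup>2) summable_on E"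
  proof (rule nonneg_bdd_above_summable_on)
    show "bdd_above (sum (\<lambda>v. (c v)\<^sup>2) ` {F. F \<subseteq> E \<and> finite F})"
    proof (rule bdd_aboveI2)
      fix F assume F: "F \<in> {F. F \<subseteq> E \<and> finite F}"
      have "(\<Sum>v\<in>F. (c v)\<^sup>2) = (\<Sum>v\<in>F. (norm (T v))\<^sup>2)"
        using F E(1,2) by (intro sum.cong) (auto simp: orthonormal_def)
      also have "\<dots> \<le> (\<Sum>n. (norm (T (basis_l2 n)))\<^sup>2)"
        using F by (intro hilbert_schmidt_orthonormal_sum T orthonormal_subset[OF E(1)]) auto
      finally show "(\<Sum>v\<in>F. (c v)\<^sup>2) \<le> (\<Sum>n. (norm (T (basis_l2 n)))\<^sup>2)" .
    qed
  qed simp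
  show thesis
    by (rule that[OF E(1) sm E(3) E(2) eq_diag_sum[OF E(1) sm T(1,2)]]) (use E in auto)
qed

section \<open>Diagonal and off-diagonal operators\<close>

lemma summable_Bseq_mult:
  assumes "Bseq a" "summable (\<lambda>n. (x n)\<^sup>2)"
  shows "summable (\<lambda>n. (a n * x n :: real)\<^sup>2)"
proof -
  obtain B where B: "\<And>n. \<bar>a n\<bar> \<le> B" using assms(1) unfolding Bseq_def by auto
  show ?thesis
  proof (rule summable_comparison_test'[where N = 0])
    show "summable (\<lambda>n. B\<^sup>2 * (x n)\<^sup>2)" by (intro summable_mult assms)
    show "norm ((a n * x n)\<^sup>2) \<le> B\<^sup>2 * (x n)\<^sup>2" for n
      using power_mono[OF B[of n], of 2] by (simp add: power_mult_distrib mult_right_mono)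
  qed
qed

definition diag_l2 :: "(nat \<Rightarrow> real) \<Rightarrow> l2 \<Rightarrow> l2"
  where "diag_l2 a x = seq_l2 (\<lambda>n. a n * coord x n)"

lemma coord_diag_l2: "Bseq a \<Longrightarrow> coord (diag_l2 a x) n = a n * coord x n"
  unfolding diag_l2_def by (rule coord_seq_l2[OF summable_Bseq_mult[OF _ summable_coord_power2]])

lemma bounded_linear_diag_l2:
  assumes "Bseq a"
  shows "bounded_linear (diag_l2 a)"
proof -
  obtain B where B: "\<And>n. \<bar>a n\<bar> \<le> B" using assms(1) unfolding Bseq_def by auto
  have B0: "B \<ge> 0" using B[of 0] by simp
  show ?thesis
  proof (rule bounded_linear_intro)
    show "norm (diag_l2 a x) \<le> norm x * B" for x
    proof (rule norm_l2_le[OF _ sums_mult[OF norm_l2_sums[of x], of "B\<^sup>2"]])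
      show "(coord (diag_l2 a x) n)\<^sup>2 \<le> B\<^sup>2 * (coord x n)\<^sup>2" for n
        using power_mono[OF B[of n], of 2]
        by (simp add: coord_diag_l2[OF assms] power_mult_distrib mult_right_mono)
    qed (use B0 in \<open>simp_all add: power_mult_distrib mult.commute\<close>)
  qed (auto intro!: l2_eqI simp: coord_diag_l2[OF assms] algebra_simps)
qed

lemma self_adjoint_diag_l2: "Bseq a \<Longrightarrow> self_adjoint (diag_l2 a)"
  unfolding self_adjoint_def inner_l2_def by (simp add: coord_diag_l2 mult_ac)

definition lshift :: "l2 \<Rightarrow> l2"
  where "lshift x = seq_l2 (\<lambda>n. coord x (Suc n))"

definition rshift :: "l2 \<Rightarrow> l2"
  where "rshift x = seq_l2 (\<lambda>n. case n of 0 \<Rightarrow> 0 | Suc m \<Rightarrow> coord x m)"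

lemma coord_lshift: "coord (lshift x) n = coord x (Suc n)"
  unfolding lshift_def
  by (rule coord_seq_l2, rule summable_Suc_iff[THEN iffD2]) (rule summable_coord_power2)

lemma coord_rshift: "coord (rshift x) n = (case n of 0 \<Rightarrow> 0 | Suc m \<Rightarrow> coord x m)"
  unfolding rshift_def
proof (rule coord_seq_l2)
  show "summable (\<lambda>n. (case n of 0 \<Rightarrow> 0 | Suc m \<Rightarrow> coord x m)\<^sup>2)"
    by (subst summable_Suc_iff[symmetric]) (simp add: summable_coord_power2)
qed

lemma inner_rshift: "inner x (rshift y) = inner (lshift x) y"
proof -
  have "(\<lambda>n. coord x (Suc n) * coord (rshift y) (Suc n)) sums inner (lshift x) y"
    using inner_l2_sums[of "lshift x" y] by (simp add: coord_lshift coord_rshift)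
  hence "(\<lambda>n. coord x n * coord (rshift y) n) sums inner (lshift x) y"
    by (subst (asm) sums_Suc_iff) (simp add: coord_rshift)
  thus ?thesis using inner_l2_sums sums_unique2 by blast
qed

lemma norm_rshift: "norm (rshift x) = norm x"
  by (simp add: norm_eq_sqrt_inner inner_rshift)
    (simp add: inner_l2_def coord_lshift coord_rshift)

lemma norm_lshift_le: "norm (lshift x) \<le> norm x"
proof -
  have "(norm (lshift x))\<^sup>2 \<le> norm x * norm (lshift x)"
    using Cauchy_Schwarz_ineq2[of x "rshift (lshift x)"]
    by (simp add: inner_rshift norm_rshift dot_square_norm)
  thus ?thesis by (cases "norm (lshift x) = 0") (auto simp: power2_eq_square)
qed

lemma bounded_linear_lshift: "bounded_linear lshift"
  by (rule bounded_linear_intro[of _ 1])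
    (auto intro!: l2_eqI simp: coord_lshift norm_lshift_le)

lemma bounded_linear_rshift: "bounded_linear rshift"
  by (rule bounded_linear_intro[of _ 1])
    (auto intro!: l2_eqI simp: coord_rshift norm_rshift split: nat.split)

definition offdiag :: "(nat \<Rightarrow> real) \<Rightarrow> l2 \<Rightarrow> l2"
  where "offdiag a x = diag_l2 a (lshift x) + rshift (diag_l2 a x)"

lemma coord_offdiag:
  "Bseq a \<Longrightarrow> coord (offdiag a x) n =
     a n * coord x (Suc n) + (case n of 0 \<Rightarrow> 0 | Suc m \<Rightarrow> a m * coord x m)"
  by (simp add: offdiag_def coord_diag_l2 coord_lshift coord_rshift split: nat.split)

lemma bounded_linear_offdiag: "Bseq a \<Longrightarrow> bounded_linear (offdiag a)"
  unfolding offdiag_def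
  by (intro bounded_linear_add bounded_linear_compose[OF bounded_linear_diag_l2 bounded_linear_lshift]
      bounded_linear_compose[OF bounded_linear_rshift bounded_linear_diag_l2])

lemma inner_offdiag_sums:
  assumes "Bseq a"
  shows "(\<lambda>n. a n * (coord x n * coord y (Suc n) + coord x (Suc n) * coord y n)) sums inner x (offdiag a y)"
proof -
  have "inner x (offdiag a y) = inner x (diag_l2 a (lshift y)) + inner (lshift x) (diag_l2 a y)"
    by (simp add: offdiag_def inner_add_right inner_rshift)
  thus ?thesis
    using sums_add[OF inner_l2_sums[of x "diag_l2 a (lshift y)"] inner_l2_sums[of "lshift x" "diag_l2 a y"]]
    by (simp add: coord_diag_l2[OF assms] coord_lshift algebra_simps)
qed

lemma self_adjoint_offdiag: "Bseq a \<Longrightarrow> self_adjoint (offdiag a)"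
  unfolding self_adjoint_def
proof (intro allI)
  fix x y assume a: "Bseq a"
  have "inner y (offdiag a x) = inner x (offdiag a y)"
    using sums_unique2[OF inner_offdiag_sums[OF a, of x y]] inner_offdiag_sums[OF a, of y x]
    by (simp add: mult_ac add_ac)
  thus "inner (offdiag a x) y = inner x (offdiag a y)" by (simp add: inner_commute)
qed

lemma norm_offdiag_le:
  assumes a: "Bseq a"
  shows "(norm (offdiag a x))\<^sup>2 \<le> 2 * (\<Sum>n. (a n)\<^sup>2 * ((coord x n)\<^sup>2 + (coord x (Suc n))\<^sup>2))"
    and "summable (\<lambda>n. (a n)\<^sup>2 * ((coord x n)\<^sup>2 + (coord x (Suc n))\<^sup>2))"
proof -
  have s: "(\<lambda>n. (a n)\<^sup>2 * ((coord x n)\<^sup>2 + (coord x (Suc n))\<^sup>2)) sums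
      ((norm (diag_l2 a x))\<^sup>2 + (norm (diag_l2 a (lshift x)))\<^sup>2)"
    using sums_add[OF norm_l2_sums[of "diag_l2 a x"] norm_l2_sums[of "diag_l2 a (lshift x)"]]
    by (simp add: coord_diag_l2[OF a] coord_lshift power_mult_distrib algebra_simps)
  have "norm (offdiag a x) \<le> norm (diag_l2 a (lshift x)) + norm (diag_l2 a x)"
    unfolding offdiag_def using norm_triangle_ineq[of "diag_l2 a (lshift x)" "rshift (diag_l2 a x)"]
    by (simp add: norm_rshift)
  hence "(norm (offdiag a x))\<^sup>2 \<le> (norm (diag_l2 a (lshift x)) + norm (diag_l2 a x))\<^sup>2"
    by (rule power_mono) simp
  also have "\<dots> \<le> 2 * ((norm (diag_l2 a x))\<^sup>2 + (norm (diag_l2 a (lshift x)))\<^sup>2)"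
    using sum_squares_bound[of "norm (diag_l2 a (lshift x))" "norm (diag_l2 a x)"]
    by (simp add: power2_sum)
  finally show "(norm (offdiag a x))\<^sup>2 \<le> 2 * (\<Sum>n. (a n)\<^sup>2 * ((coord x n)\<^sup>2 + (coord x (Suc n))\<^sup>2))"
    using s by (simp add: sums_iff)
  show "summable (\<lambda>n. (a n)\<^sup>2 * ((coord x n)\<^sup>2 + (coord x (Suc n))\<^sup>2))"
    using s by (rule sums_summable)
qed

lemma offdiag_basis:
  "Bseq a \<Longrightarrow> offdiag a (basis_l2 n) =
     a n *\<^sub>R basis_l2 (Suc n) + (case n of 0 \<Rightarrow> 0 | Suc m \<Rightarrow> a m *\<^sub>R basis_l2 m)"
  by (rule l2_eqI) (auto simp: coord_offdiag coord_basis_l2 split: nat.splits)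

lemma norm_offdiag_basis_le:
  assumes "Bseq a"
  shows "(norm (offdiag a (basis_l2 n)))\<^sup>2 \<le> 2 * ((a n)\<^sup>2 + (case n of 0 \<Rightarrow> 0 | Suc m \<Rightarrow> (a m)\<^sup>2))"
proof -
  have "norm (offdiag a (basis_l2 n)) \<le> \<bar>a n\<bar> + (case n of 0 \<Rightarrow> 0 | Suc m \<Rightarrow> \<bar>a m\<bar>)"
    unfolding offdiag_basis[OF assms]
    by (rule order_trans[OF norm_triangle_ineq]) (simp split: nat.split)
  hence "(norm (offdiag a (basis_l2 n)))\<^sup>2 \<le> (\<bar>a n\<bar> + (case n of 0 \<Rightarrow> 0 | Suc m \<Rightarrow> \<bar>a m\<bar>))\<^sup>2"
    by (rule power_mono) simp
  also have "\<dots> \<le> 2 * (\<bar>a n\<bar>\<^sup>2 + (case n of 0 \<Rightarrow> 0 | Suc m \<Rightarrow> \<bar>a m\<bar>)\<^sup>2)"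
    by (rule power2_add_le)
  finally show ?thesis by (simp split: nat.splits)
qed

lemma summable_case_nat: "summable (\<lambda>n. case n of 0 \<Rightarrow> c | Suc m \<Rightarrow> f m) \<longleftrightarrow> summable (f :: nat \<Rightarrow> real)"
  by (subst summable_Suc_iff[symmetric]) simp

lemma hilbert_schmidt_offdiag:
  assumes "Bseq a" "summable (\<lambda>n. (a n)\<^sup>2)"
  shows "hilbert_schmidt (offdiag a)"
  unfolding hilbert_schmidt_def
proof (rule summable_comparison_test'[where N = 0])
  show "summable (\<lambda>n. 2 * ((a n)\<^sup>2 + (case n of 0 \<Rightarrow> 0 | Suc m \<Rightarrow> (a m)\<^sup>2)))"
    by (intro summable_mult summable_add assms) (simp add: summable_case_nat assms)
qed (use norm_offdiag_basis_le[OF assms(1)] in simp)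

section \<open>Summability tools, over eigenfamilies and over coordinates\<close>

lemma summable_on_finite_ge:
  fixes f :: "'a \<Rightarrow> real"
  assumes "f summable_on E" "\<And>v. v \<in> E \<Longrightarrow> f v \<ge> 0" "e > 0"
  shows "finite {v\<in>E. f v \<ge> e}"
proof (rule ccontr)
  assume inf: "infinite {v\<in>E. f v \<ge> e}"
  obtain n :: nat where n: "real n * e > infsum f E"
    using assms(3) reals_Archimedean3 by blast
  obtain F where F: "F \<subseteq> {v\<in>E. f v \<ge> e}" "finite F" "card F = n"
    using infinite_arbitrarily_large[OF inf] by blast
  have "real n * e \<le> sum f F"
    using sum_bounded_below[of F e f] F by auto
  also have "\<dots> \<le> infsum f E"
    using F assms by (intro finite_sum_le_infsum) auto
  finally show False using n by simp
qed

text \<open>Injectivity of identity plus a Hilbert--Schmidt operator becomes a lower bound: the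
  values \<open>c v\<close> accumulate only at 0, so all but finitely many factors are at least 1/2
  in modulus.\<close>

lemma summable_on_bounded_away:
  fixes c :: "'a \<Rightarrow> real"
  assumes c: "(\<lambda>v. (c v)\<^sup>2) summable_on E" and nz: "\<And>v. v \<in> E \<Longrightarrow> 1 + c v \<noteq> 0"
  obtains m where "m > 0" "\<And>v. v \<in> E \<Longrightarrow> \<bar>1 + c v\<bar> \<ge> m"
proof -
  \<comment> \<open>Outside this finite set the modulus of \<open>c v\<close> is below 1/2.\<close>
  let ?X = "{v\<in>E. (c v)\<^sup>2 \<ge> 1/4}"
  define m where "m = Min (insert (1/2) ((\<lambda>v. \<bar>1 + c v\<bar>) ` ?X))"
  have fin: "finite ?X"
    by (rule summable_on_finite_ge[OF c]) auto
  have m: "m > 0" unfolding m_def using fin nz by (subst Min_gr_iff) auto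
  have ge: "\<bar>1 + c v\<bar> \<ge> m" if "v \<in> E" for v
  proof (cases "(c v)\<^sup>2 \<ge> 1/4")
    case True
    thus ?thesis unfolding m_def using fin that by (intro Min_le) blast+
  next
    case False
    have "\<bar>c v\<bar> < 1/2"
    proof (rule power2_less_imp_less)
      show "\<bar>c v\<bar>\<^sup>2 < (1/2)\<^sup>2" using False by (simp add: power_divide)
    qed simp
    moreover have "m \<le> 1/2" unfolding m_def using fin by (intro Min_le) auto
    ultimately show ?thesis by linarith
  qed
  show thesis by (rule that[OF m ge])
qed

lemma has_sum_sum_lessThan:
  fixes f :: "nat \<Rightarrow> 'a \<Rightarrow> real"
  assumes "\<And>n. (f n has_sum s n) E"
  shows "((\<lambda>v. \<Sum>n<N. f n v) has_sum (\<Sum>n<N. s n)) E"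
  by (induction N) (auto intro!: has_sum_add assms)

lemma summable_power2_imp_LIMSEQ:
  fixes a :: "nat \<Rightarrow> real"
  assumes "summable (\<lambda>n. (a n)\<^sup>2)"
  shows "a \<longlonglongrightarrow> 0"
proof -
  have "(\<lambda>n. sqrt ((a n)\<^sup>2)) \<longlonglongrightarrow> sqrt 0"
    by (rule tendsto_real_sqrt) (rule summable_LIMSEQ_zero[OF assms])
  thus ?thesis by (simp add: tendsto_rabs_zero_iff)
qed

lemma summable_power2_imp_Bseq: "summable (\<lambda>n. (a n)\<^sup>2) \<Longrightarrow> Bseq (a :: nat \<Rightarrow> real)"
  using summable_power2_imp_LIMSEQ convergentI convergent_imp_Bseq by blast

lemma summable_imp_summable_power2:
  fixes a :: "nat \<Rightarrow> real"
  assumes "summable (\<lambda>n. \<bar>a n\<bar>)"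
  shows "summable (\<lambda>n. (a n)\<^sup>2)"
proof -
  have "Bseq a"
    using convergent_imp_Bseq[OF convergentI[OF summable_LIMSEQ_zero[OF summable_rabs_cancel[OF assms]]]] .
  then obtain B where B: "\<And>n. \<bar>a n\<bar> \<le> B" unfolding Bseq_def by auto
  show ?thesis
  proof (rule summable_comparison_test'[where N = 0])
    show "summable (\<lambda>n. B * \<bar>a n\<bar>)" by (intro summable_mult assms)
    show "norm ((a n)\<^sup>2) \<le> B * \<bar>a n\<bar>" for n
      using mult_right_mono[OF B[of n], of "\<bar>a n\<bar>"] by (simp add: power2_eq_square)
  qed
qed

text \<open>For a fixed coordinate the squares over an orthonormal family add up to at most 1, so
  exchanging the sums costs two copies of \<open>suminf a\<close>. This is the estimate behind the
  trace class property.\<close>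

lemma orthonormal_shift_sum:
  assumes F: "orthonormal F" "finite F" and a: "\<And>n. a n \<ge> 0" "summable a"
  shows "(\<Sum>v\<in>F. \<Sum>n. a n * ((coord v n)\<^sup>2 + (coord v (Suc n))\<^sup>2)) \<le> 2 * suminf a" (is ?th1)
    and "summable (\<lambda>n. a n * ((coord x n)\<^sup>2 + (coord x (Suc n))\<^sup>2))" (is ?th2)
proof -
  have sm: "summable (\<lambda>n. a n * ((coord v n)\<^sup>2 + (coord v (Suc n))\<^sup>2))" for v
  proof (rule summable_comparison_test'[where N = 0])
    show "summable (\<lambda>n. a n * (2 * (norm v)\<^sup>2))" by (intro summable_mult2 a)
    show "norm (a n * ((coord v n)\<^sup>2 + (coord v (Suc n))\<^sup>2)) \<le> a n * (2 * (norm v)\<^sup>2)" for n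
      using sum_coord_le[of "{n}" v] sum_coord_le[of "{Suc n}" v] a(1)[of n]
      by (auto intro!: mult_left_mono)
  qed
  have "(\<Sum>v\<in>F. \<Sum>n. a n * ((coord v n)\<^sup>2 + (coord v (Suc n))\<^sup>2)) =
      (\<Sum>n. \<Sum>v\<in>F. a n * ((coord v n)\<^sup>2 + (coord v (Suc n))\<^sup>2))"
    by (rule suminf_sum[symmetric]) (rule sm)
  also have "\<dots> \<le> (\<Sum>n. a n * 2)"
  proof (rule suminf_le)
    show "(\<Sum>v\<in>F. a n * ((coord v n)\<^sup>2 + (coord v (Suc n))\<^sup>2)) \<le> a n * 2" for n
      unfolding sum_distrib_left[symmetric] sum.distrib
      using sum_orthonormal_coord_le[OF F, of n] sum_orthonormal_coord_le[OF F, of "Suc n"] a(1)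
      by (intro mult_left_mono) auto
    show "summable (\<lambda>n. \<Sum>v\<in>F. a n * ((coord v n)\<^sup>2 + (coord v (Suc n))\<^sup>2))"
      by (intro summable_sum sm)
  qed (intro summable_mult2 a)
  also have "\<dots> = 2 * suminf a"
    using suminf_mult2[OF a(2), of 2] by simp
  finally show ?th1 .
  show ?th2 by (rule sm)
qed

section \<open>The inverse of a Jacobi operator\<close>

text \<open>The matrix action as a three-term recurrence, polymorphic so that it covers the real
  coordinates of \<open>l2\<close> as well as complex sequences.\<close>

definition japp :: "(nat \<Rightarrow> real) \<Rightarrow> (nat \<Rightarrow> real) \<Rightarrow> (nat \<Rightarrow> 'a::real_vector) \<Rightarrow> nat \<Rightarrow> 'a"
  where "japp lam w x n =
    lam n *\<^sub>R x n + w n *\<^sub>R x (Suc n) + (case n of 0 \<Rightarrow> 0 | Suc m \<Rightarrow> w m *\<^sub>R x m)"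

locale jacobi =
  fixes lam w :: "nat \<Rightarrow> real"
  assumes lam_pos: "\<And>n. lam n > 0"
    and w_nonzero: "\<And>n. w n \<noteq> 0"
    and lam_lim: "filterlim lam at_top sequentially"
    and w_summable: "summable (\<lambda>n. (w n)\<^sup>2 / (lam n * lam (Suc n)))"
    and lam_summable: "summable (\<lambda>n. 1 / (lam n)\<^sup>2)"
begin

lemma lam_lower: obtains \<delta> where "\<delta> > 0" "\<And>n. lam n \<ge> \<delta>"
proof -
  obtain N where N: "\<And>n. n \<ge> N \<Longrightarrow> lam n \<ge> 1"
    using lam_lim unfolding filterlim_at_top eventually_sequentially by meson
  let ?\<delta> = "Min (insert 1 (lam ` {..<N}))"
  have "?\<delta> > 0" by (subst Min_gr_iff) (auto simp: lam_pos)
  moreover have "lam n \<ge> ?\<delta>" for n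
  proof (cases "n < N")
    case False
    have "?\<delta> \<le> 1" by (intro Min_le) auto
    also have "1 \<le> lam n" using N[of n] False by simp
    finally show ?thesis .
  qed (auto intro!: Min_le)
  ultimately show thesis by (rule that)
qed

text \<open>In these terms the hypothesis on w says that \<open>k\<close> is square-summable, which
  is why \<open>K\<close> is Hilbert--Schmidt.\<close>

definition k where "k n = w n / sqrt (lam n * lam (Suc n))"
definition d where "d n = 1 / sqrt (lam n)"

lemma k_summable: "summable (\<lambda>n. (k n)\<^sup>2)"
  using w_summable lam_pos by (simp add: k_def power_divide less_imp_le)

lemma Bseq_k: "Bseq k"
  by (rule summable_power2_imp_Bseq[OF k_summable])

lemma d_pos: "d n > 0"
  using lam_pos by (simp add: d_def)

lemma d_power2: "(d n)\<^sup>2 = 1 / lam n"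
  using lam_pos by (simp add: d_def power_divide less_imp_le)

lemma Bseq_d: "Bseq d"
proof -
  obtain \<delta> where \<delta>: "\<delta> > 0" "\<And>n. lam n \<ge> \<delta>" using lam_lower by metis
  have "norm (d n) \<le> 1 / sqrt \<delta>" for n
    using \<delta> lam_pos[of n] by (auto simp: d_def intro!: divide_left_mono)
  thus ?thesis by (rule BseqI')
qed

lemma Bseq_inverse_lam: "Bseq (\<lambda>n. 1 / lam n)"
  by (rule summable_power2_imp_Bseq) (use lam_summable in \<open>simp add: power_divide\<close>)

abbreviation K where "K \<equiv> offdiag k"
abbreviation D where "D \<equiv> diag_l2 d"

lemmas linear_K = bounded_linear_offdiag[OF Bseq_k]
lemmas linear_D = bounded_linear_diag_l2[OF Bseq_d]
lemmas coord_D = coord_diag_l2[OF Bseq_d]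
lemmas coord_K = coord_offdiag[OF Bseq_k]

text \<open>This is J D = L^(1/2) (I + K). It is kept on the level of coordinates because L^(1/2) is
  unbounded.\<close>

lemma japp_D: "japp lam w (coord (D x)) n = sqrt (lam n) * coord (x + K x) n"
  using lam_pos[of n] lam_pos[of "Suc n"] lam_pos[of "n - 1"]
  by (cases n) (simp_all add: japp_def coord_D coord_K k_def d_def real_sqrt_mult divide_simps distrib_left
      algebra_simps real_sqrt_mult_self[symmetric] del: real_sqrt_mult_self, auto simp: less_imp_le)

end

text \<open>Injectivity on \<open>l2\<close> is all that is extracted from invertibility; the
  bounded inverse is then rebuilt from the Fredholm alternative for I + K.\<close>

locale jacobi_invertible = jacobi +
  assumes japp_kernel: "\<And>x :: l2. (\<And>n. japp lam w (coord x) n = 0) \<Longrightarrow> x = 0"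
begin

lemma IK_kernel:
  assumes "x + K x = 0"
  shows "x = 0"
proof -
  have "D x = 0"
    by (rule japp_kernel) (simp only: japp_D assms coord_simps mult_zero_right)
  hence "d n * coord x n = 0" for n
    by (metis coord_D coord_simps(1))
  thus ?thesis using d_pos by (intro l2_eqI) (auto simp: less_le)
qed

text \<open>The inverse is sought as I - G with G = K (I + K)^-1, which has the eigenvalues c / (1 +
  c) on the eigenvectors of K. In this form the kernel of K, on which E says nothing, needs no
  separate expansion.\<close>

lemma IK_inverse: "\<exists>B. bounded_linear B \<and> self_adjoint B \<and> (\<forall>x. B x + K (B x) = x)"
proof -
  interpret K: bounded_linear K by (rule linear_K)
  obtain E c where E: "orthonormal E" "(\<lambda>v. (c v)\<^sup>2) summable_on E"
    "\<And>v. v \<in> E \<Longrightarrow> K v = c v *\<^sub>R v" "\<And>x. K x = diag_sum E c x"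
    using hilbert_schmidt_spectral[OF linear_K self_adjoint_offdiag[OF Bseq_k]
        hilbert_schmidt_offdiag[OF Bseq_k k_summable]] by metis
  have nz: "1 + c v \<noteq> 0" if "v \<in> E" for v
  proof
    assume "1 + c v = 0"
    hence "v + K v = 0" using E(3)[OF that] by (metis scaleR_left_distrib scaleR_one scaleR_zero_left)
    hence "v = 0" by (rule IK_kernel)
    thus False using E(1) that by (auto simp: orthonormal_def)
  qed
  obtain m where m: "m > 0" and ge: "\<And>v. v \<in> E \<Longrightarrow> \<bar>1 + c v\<bar> \<ge> m"
    using summable_on_bounded_away[OF E(2) nz] by metis
  define g where "g v = c v / (1 + c v)" for v
  have g: "(\<lambda>v. (g v)\<^sup>2) summable_on E"
  proof (rule summable_on_comparison_test)
    show "(\<lambda>v. (c v)\<^sup>2 * (1 / m\<^sup>2)) summable_on E"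
      by (intro summable_on_cmult_left E(2))
    show "(g v)\<^sup>2 \<le> (c v)\<^sup>2 * (1 / m\<^sup>2)" if "v \<in> E" for v
    proof -
      have "m\<^sup>2 \<le> (1 + c v)\<^sup>2" using power_mono[OF ge[OF that], of 2] m by simp
      hence "(c v)\<^sup>2 / (1 + c v)\<^sup>2 \<le> (c v)\<^sup>2 / m\<^sup>2"
        using m nz[OF that] by (intro divide_left_mono) auto
      thus ?thesis by (simp add: g_def power_divide)
    qed
  qed auto
  let ?G = "diag_sum E g"
  have G: "K x = ?G x + K (?G x)" for x
  proof -
    have *: "((\<lambda>v. (g v * inner x v) *\<^sub>R v + K ((g v * inner x v) *\<^sub>R v)) has_sum (?G x + K (?G x))) E"
      using diag_sum_has_sum[OF E(1) g, of x]
      by (intro has_sum_add has_sum_bounded_linear[OF linear_K])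
    have **: "(g v * inner x v) *\<^sub>R v + K ((g v * inner x v) *\<^sub>R v) = (c v * inner x v) *\<^sub>R v"
      if "v \<in> E" for v
    proof -
      have "(g v * inner x v) *\<^sub>R v + K ((g v * inner x v) *\<^sub>R v) = (g v * (1 + c v) * inner x v) *\<^sub>R v"
        by (simp add: K.scaleR E(3)[OF that] algebra_simps)
      thus ?thesis using nz[OF that] by (simp add: g_def)
    qed
    have "((\<lambda>v. (c v * inner x v) *\<^sub>R v) has_sum (?G x + K (?G x))) E"
      by (rule has_sum_cong[THEN iffD1, OF ** *])
    thus ?thesis using has_sum_unique[OF diag_sum_has_sum[OF E(1,2), of x]] E(4) by simp
  qed
  show ?thesis
  proof (intro exI[of _ "\<lambda>x. x - ?G x"] conjI allI)
    show "bounded_linear (\<lambda>x. x - ?G x)"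
      by (intro bounded_linear_sub bounded_linear_ident diag_sum_bounded_linear E(1) g)
    show "self_adjoint (\<lambda>x. x - ?G x)"
      using self_adjointD[OF diag_sum_self_adjoint[OF E(1) g]]
      by (simp add: self_adjoint_def inner_diff_left inner_diff_right)
    show "x - ?G x + K (x - ?G x) = x" for x
      using G[of x] by (simp add: K.diff)
  qed
qed

definition B where "B = (SOME B. bounded_linear B \<and> self_adjoint B \<and> (\<forall>x. B x + K (B x) = x))"

lemma linear_B: "bounded_linear B" and self_adjoint_B: "self_adjoint B" and IK_B: "B x + K (B x) = x"
  using someI_ex[OF IK_inverse] unfolding B_def by blast+

text \<open>Taking adjoints turns the right inverse into a left inverse, as both B and K are
  self-adjoint.\<close>

lemma B_IK: "B (x + K x) = x"
proof -
  interpret B: bounded_linear B by (rule linear_B)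
  have "inner (B (x + K x) - x) y = 0" for y
  proof -
    have "inner (B (x + K x)) y = inner x (B y + K (B y))"
      using self_adjointD[OF self_adjoint_B] self_adjointD[OF self_adjoint_offdiag[OF Bseq_k]]
      by (simp add: inner_add_left inner_add_right)
    thus ?thesis by (simp add: IK_B inner_diff_left)
  qed
  thus ?thesis by (metis eq_iff_diff_eq_0 inner_eq_zero_iff)
qed

definition A where "A x = D (B (D x))"

lemma linear_A: "bounded_linear A"
  unfolding A_def by (intro bounded_linear_compose[OF linear_D] bounded_linear_compose[OF linear_B linear_D])

lemma self_adjoint_A: "self_adjoint A"
  using self_adjointD[OF self_adjoint_B] self_adjointD[OF self_adjoint_diag_l2[OF Bseq_d]]
  by (simp add: self_adjoint_def A_def)

lemma japp_A: "japp lam w (coord (A x)) n = coord x n"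
  unfolding A_def japp_D IK_B coord_D using lam_pos[of n] by (simp add: d_def)

lemma japp_diff: "japp lam w (coord (x - y)) n = japp lam w (coord x) n - japp lam w (coord y) n"
  by (simp add: japp_def algebra_simps split: nat.split)

lemma A_unique: "(\<And>n. japp lam w (coord y) n = coord x n) \<Longrightarrow> y = A x"
  using japp_kernel[of "y - A x"] by (simp add: japp_diff japp_A)

lemma A_eq_0_iff: "A x = 0 \<longleftrightarrow> x = 0"
proof
  assume *: "A x = 0"
  have "coord x n = 0" for n
    using japp_A[of x n] unfolding * by (simp add: japp_def split: nat.splits)
  thus "x = 0" by (intro l2_eqI) simp
qed (simp add: bounded_linear.linear[OF linear_A] linear_0)

section \<open>The difference of the inverses and its trace class property\<close>

definition C where "C x = diag_l2 (\<lambda>n. 1 / lam n) x - A x"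

definition a where "a n = w n / (lam n * lam (Suc n))"

lemma a_eq: "a n = d n * k n * d (Suc n)"
proof -
  have "k n = w n * d n * d (Suc n)"
    by (simp add: k_def d_def real_sqrt_mult)
  hence "d n * k n * d (Suc n) = w n * ((d n)\<^sup>2 * (d (Suc n))\<^sup>2)"
    by (simp add: power2_eq_square)
  thus ?thesis by (simp add: d_power2 a_def)
qed

text \<open>Cauchy--Schwarz applied to k_n and d_n d_(n+1): the squares of the latter are 1/(lam_n
  lam_(n+1)), summable by a second Cauchy--Schwarz from the hypothesis on
  \<open>lam\<close>.\<close>

lemma summable_a: "summable (\<lambda>n. \<bar>a n\<bar>)"
proof -
  obtain \<delta> where \<delta>: "\<delta> > 0" "\<And>n. lam n \<ge> \<delta>" using lam_lower by metis
  have "summable (\<lambda>n. \<bar>k n * (d n * d (Suc n))\<bar>)"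
  proof (rule summable_power2_mult[OF k_summable])
    have "(d n * d (Suc n))\<^sup>2 = 1 / lam n * (1 / lam (Suc n))" for n
      by (simp only: power_mult_distrib d_power2)
    moreover have "summable (\<lambda>n. \<bar>1 / lam n * (1 / lam (Suc n))\<bar>)"
      by (rule summable_power2_mult)
        (use lam_summable lam_summable[THEN summable_Suc_iff[THEN iffD2]] in \<open>simp_all add: power_divide\<close>)
    ultimately show "summable (\<lambda>n. (d n * d (Suc n))\<^sup>2)"
      using lam_pos by (simp add: less_imp_le abs_of_nonneg)
  qed
  thus ?thesis by (simp add: a_eq mult_ac)
qed

lemma Bseq_a: "Bseq a"
  by (rule summable_power2_imp_Bseq[OF summable_imp_summable_power2[OF summable_a]])

lemma C_eq: "C x = offdiag a x - D (K (B (K (D x))))"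
proof -
  interpret K: bounded_linear K by (rule linear_K)
  interpret B: bounded_linear B by (rule linear_B)
  interpret D: bounded_linear D by (rule linear_D)
  \<comment> \<open>The identity B = I - K B is used once, and B = I - B K is then inserted on its
    right-hand side.\<close>
  have "y - B y = K y - K (B (K y))" for y
  proof -
    have 1: "y - B y = K (B y)" using IK_B[of y] by (simp add: algebra_simps)
    have "B y = y - B (K y)" using B_IK[of y] by (simp add: B.add algebra_simps)
    hence "K (B y) = K y - K (B (K y))" by (metis K.diff)
    thus ?thesis using 1 by simp
  qed
  from this[of "D x"] have "D (D x) - A x = D (K (D x)) - D (K (B (K (D x))))"
    by (metis A_def D.diff)
  moreover have "D (D x) = diag_l2 (\<lambda>n. 1 / lam n) x"
  proof (rule l2_eqI)
    fix n
    have "d n * (d n * coord x n) = (d n)\<^sup>2 * coord x n" by (simp add: power2_eq_square)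
    thus "coord (D (D x)) n = coord (diag_l2 (\<lambda>n. 1 / lam n) x) n"
      by (simp add: coord_D coord_diag_l2[OF Bseq_inverse_lam] d_power2)
  qed
  moreover have "D (K (D x)) = offdiag a x"
    by (intro l2_eqI) (auto simp: coord_D coord_K coord_offdiag[OF Bseq_a] a_eq algebra_simps split: nat.splits)
  ultimately show ?thesis by (simp add: C_def)
qed

lemma linear_C: "bounded_linear C"
  unfolding C_def by (intro bounded_linear_sub bounded_linear_diag_l2 Bseq_inverse_lam linear_A)

lemma self_adjoint_C: "self_adjoint C"
  using self_adjointD[OF self_adjoint_A] self_adjointD[OF self_adjoint_diag_l2[OF Bseq_inverse_lam]]
  by (simp add: self_adjoint_def C_def inner_diff_left inner_diff_right)

lemma D_basis: "D (basis_l2 n) = d n *\<^sub>R basis_l2 n"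
  by (rule l2_eqI) (simp add: coord_D coord_basis_l2)

lemma hilbert_schmidt_C: "hilbert_schmidt C"
proof -
  interpret K: bounded_linear K by (rule linear_K)
  have "bounded_linear (\<lambda>x. D (K (B x)))"
    by (intro bounded_linear_compose[OF linear_D] bounded_linear_compose[OF linear_K linear_B])
  then obtain M where M: "\<And>x. norm (D (K (B x))) \<le> norm x * M" and M0: "M \<ge> 0"
    using bounded_linear.nonneg_bounded by blast
  obtain N where N: "\<And>n. \<bar>d n\<bar> \<le> N" using Bseq_d unfolding Bseq_def by auto
  let ?f = "\<lambda>n. 2 * ((norm (offdiag a (basis_l2 n)))\<^sup>2 + (N * M)\<^sup>2 * (norm (K (basis_l2 n)))\<^sup>2)"
  have le: "(norm (C (basis_l2 n)))\<^sup>2 \<le> ?f n" for n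
  proof -
    have "norm (D (K (B (K (D (basis_l2 n)))))) \<le> norm (d n *\<^sub>R K (basis_l2 n)) * M"
      using M[of "K (D (basis_l2 n))"] by (simp add: D_basis K.scaleR)
    also have "\<dots> \<le> (N * M) * norm (K (basis_l2 n))"
      using N[of n] M0 by (auto simp: mult_ac intro!: mult_left_mono mult_right_mono)
    finally have 1: "norm (D (K (B (K (D (basis_l2 n)))))) \<le> (N * M) * norm (K (basis_l2 n))" .
    have "norm (C (basis_l2 n)) \<le> norm (offdiag a (basis_l2 n)) + (N * M) * norm (K (basis_l2 n))"
      unfolding C_eq using 1 norm_triangle_ineq4 order_trans add_left_mono by blast
    hence "(norm (C (basis_l2 n)))\<^sup>2 \<le> (norm (offdiag a (basis_l2 n)) + (N * M) * norm (K (basis_l2 n)))\<^sup>2"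
      by (rule power_mono) simp
    also have "\<dots> \<le> 2 * ((norm (offdiag a (basis_l2 n)))\<^sup>2 + ((N * M) * norm (K (basis_l2 n)))\<^sup>2)"
      by (rule power2_add_le)
    finally show ?thesis by (simp only: power_mult_distrib)
  qed
  have "summable ?f"
    using hilbert_schmidt_offdiag[OF Bseq_a summable_imp_summable_power2[OF summable_a]]
      hilbert_schmidt_offdiag[OF Bseq_k k_summable]
    unfolding hilbert_schmidt_def by (intro summable_mult summable_add)
  thus ?thesis
    unfolding hilbert_schmidt_def by (rule summable_comparison_test'[where N = 0]) (use le in simp)
qed

lemma hilbert_schmidt_A: "hilbert_schmidt A"
  unfolding hilbert_schmidt_def
proof (rule summable_comparison_test'[where N = 0])
  show "summable (\<lambda>n. 2 * ((1 / lam n)\<^sup>2 + (norm (C (basis_l2 n)))\<^sup>2))"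
    using hilbert_schmidt_C lam_summable
    by (intro summable_mult summable_add) (auto simp: hilbert_schmidt_def power_divide)
  fix n
  have "A (basis_l2 n) = (1 / lam n) *\<^sub>R basis_l2 n - C (basis_l2 n)"
    by (rule l2_eqI) (simp add: C_def coord_diag_l2[OF Bseq_inverse_lam] coord_basis_l2)
  hence "norm (A (basis_l2 n)) \<le> 1 / lam n + norm (C (basis_l2 n))"
    using norm_triangle_ineq4[of "(1 / lam n) *\<^sub>R basis_l2 n" "C (basis_l2 n)"] lam_pos[of n] by simp
  from power_mono[OF this, of 2]
  show "norm ((norm (A (basis_l2 n)))\<^sup>2) \<le> 2 * ((1 / lam n)\<^sup>2 + (norm (C (basis_l2 n)))\<^sup>2)"
    using power2_add_le[of "1 / lam n" "norm (C (basis_l2 n))"] by simp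
qed

text \<open>
  In \<open>C = D K D - (K D)\<^sup>* B (K D)\<close> (lemma \<open>C_eq\<close>) the first operator has summable entries, because
  \<open>k\<close> and \<open>1 / lam\<close> are square-summable, and \<open>K D\<close> is Hilbert--Schmidt.
\<close>

lemma C_orthonormal_sum_bounded:
  "\<exists>M. \<forall>F. orthonormal F \<and> finite F \<longrightarrow> (\<Sum>v\<in>F. \<bar>inner v (C v)\<bar>) \<le> M"
proof -
  obtain M where M: "\<And>x. norm (B x) \<le> norm x * M" and M0: "M \<ge> 0"
    using bounded_linear.nonneg_bounded[OF linear_B] by blast
  obtain N where N: "\<And>n. \<bar>d n\<bar> \<le> N" using Bseq_d unfolding Bseq_def by auto
  let ?S = "\<lambda>a v. \<Sum>n. a n * ((coord v n)\<^sup>2 + (coord v (Suc n))\<^sup>2)"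
  let ?a = "\<lambda>n. \<bar>a n\<bar>" and ?b = "\<lambda>n. (k n)\<^sup>2 * N\<^sup>2"
  note Sa = orthonormal_shift_sum[OF _ _ abs_ge_zero summable_a]
  have b: "\<And>n. ?b n \<ge> 0" "summable ?b"
    using k_summable by (auto intro!: summable_mult2)
  note Sb = orthonormal_shift_sum[OF _ _ b]
  have emp: "orthonormal {}" by (simp add: orthonormal_def)
  have le: "\<bar>inner v (C v)\<bar> \<le> ?S ?a v + (2 * M) * ?S ?b v" for v
  proof -
    have "inner v (C v) = inner v (offdiag a v) - inner (K (D v)) (B (K (D v)))"
      using self_adjointD[OF self_adjoint_offdiag[OF Bseq_k]] self_adjointD[OF self_adjoint_diag_l2[OF Bseq_d]]
      by (simp add: C_eq inner_diff_right)
    moreover have "\<bar>inner v (offdiag a v)\<bar> \<le> ?S ?a v"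
    proof -
      have s: "(\<lambda>n. a n * (coord v n * coord v (Suc n) + coord v (Suc n) * coord v n)) sums inner v (offdiag a v)"
        by (rule inner_offdiag_sums[OF Bseq_a])
      have "norm (\<Sum>n. a n * (coord v n * coord v (Suc n) + coord v (Suc n) * coord v n)) \<le> ?S ?a v"
      proof (rule norm_suminf_le)
        show "norm (a n * (coord v n * coord v (Suc n) + coord v (Suc n) * coord v n))
          \<le> \<bar>a n\<bar> * ((coord v n)\<^sup>2 + (coord v (Suc n))\<^sup>2)" for n
        proof -
          have "\<bar>coord v n * coord v (Suc n) + coord v (Suc n) * coord v n\<bar> \<le> (coord v n)\<^sup>2 + (coord v (Suc n))\<^sup>2"
            using sum_squares_bound[of "\<bar>coord v n\<bar>" "\<bar>coord v (Suc n)\<bar>"] by (simp add: abs_mult mult_ac)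
          thus ?thesis unfolding real_norm_def abs_mult[of "a n"] by (rule mult_left_mono) simp
        qed
      qed (rule Sa(2)[OF emp finite.emptyI])
      thus ?thesis using sums_unique[OF s] by simp
    qed
    moreover have "\<bar>inner (K (D v)) (B (K (D v)))\<bar> \<le> (2 * M) * ?S ?b v"
    proof -
      have le2: "(\<Sum>n. (k n)\<^sup>2 * ((coord (D v) n)\<^sup>2 + (coord (D v) (Suc n))\<^sup>2)) \<le> ?S ?b v"
      proof (rule suminf_le)
        have "(coord (D v) n)\<^sup>2 \<le> N\<^sup>2 * (coord v n)\<^sup>2" for n
          using power_mono[OF N[of n], of 2] by (simp add: coord_D power_mult_distrib mult_right_mono)
        thus "(k n)\<^sup>2 * ((coord (D v) n)\<^sup>2 + (coord (D v) (Suc n))\<^sup>2) \<le> ?b n * ((coord v n)\<^sup>2 + (coord v (Suc n))\<^sup>2)" for n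
          unfolding mult.assoc distrib_left[of "N\<^sup>2"] by (intro mult_left_mono add_mono) auto
      qed (rule norm_offdiag_le(2)[OF Bseq_k], rule Sb(2)[OF emp finite.emptyI])
      have "\<bar>inner (K (D v)) (B (K (D v)))\<bar> \<le> norm (K (D v)) * norm (B (K (D v)))"
        by (rule Cauchy_Schwarz_ineq2)
      also have "\<dots> \<le> norm (K (D v)) * (norm (K (D v)) * M)"
        by (intro mult_left_mono M) simp
      also have "\<dots> = M * (norm (K (D v)))\<^sup>2" by (simp add: power2_eq_square)
      also have "\<dots> \<le> M * (2 * (\<Sum>n. (k n)\<^sup>2 * ((coord (D v) n)\<^sup>2 + (coord (D v) (Suc n))\<^sup>2)))"
        by (intro mult_left_mono norm_offdiag_le(1) Bseq_k M0)
      also have "\<dots> \<le> M * (2 * ?S ?b v)"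
        using le2 M0 by (intro mult_left_mono) auto
      also have "\<dots> = (2 * M) * ?S ?b v" by (simp only: mult.assoc mult.left_commute[of M 2])
      finally show ?thesis .
    qed
    ultimately show ?thesis by linarith
  qed
  have "(\<Sum>v\<in>F. \<bar>inner v (C v)\<bar>) \<le> 2 * suminf ?a + (2 * M) * (2 * suminf ?b)"
    if F: "orthonormal F" "finite F" for F
  proof -
    have "(\<Sum>v\<in>F. \<bar>inner v (C v)\<bar>) \<le> (\<Sum>v\<in>F. ?S ?a v + (2 * M) * ?S ?b v)"
      by (rule sum_mono) (rule le)
    also have "\<dots> = (\<Sum>v\<in>F. ?S ?a v) + (2 * M) * (\<Sum>v\<in>F. ?S ?b v)"
      by (simp add: sum.distrib sum_distrib_left)
    also have "\<dots> \<le> 2 * suminf ?a + (2 * M) * (2 * suminf ?b)"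
      using M0 by (intro add_mono mult_left_mono Sa(1) Sb(1) F) auto
    finally show ?thesis .
  qed
  thus ?thesis by blast
qed

text \<open>The modulus of C has the eigenvalues |c v|. The uniform bound on sums over orthonormal
  families, applied to the eigenvectors themselves, shows that these are summable, and since
  eigenvectors are unit vectors this bounds the trace in the standard basis.\<close>

lemma C_abs_trace_class:
  obtains P where "bounded_linear P" "self_adjoint P" "\<And>x. inner x (P x) \<ge> 0"
    "\<And>x. P (P x) = C (C x)" "summable (\<lambda>n. coord (P (basis_l2 n)) n)"
proof -
  obtain E c where E: "orthonormal E" "(\<lambda>v. (c v)\<^sup>2) summable_on E"
    "\<And>v. v \<in> E \<Longrightarrow> C v = c v *\<^sub>R v" "\<And>x. C x = diag_sum E c x"
    using hilbert_schmidt_spectral[OF linear_C self_adjoint_C hilbert_schmidt_C] by metis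
  have E': "(\<lambda>v. (\<bar>c v\<bar>)\<^sup>2) summable_on E" using E(2) by simp
  obtain M where M: "\<And>F. orthonormal F \<Longrightarrow> finite F \<Longrightarrow> (\<Sum>v\<in>F. \<bar>inner v (C v)\<bar>) \<le> M"
    using C_orthonormal_sum_bounded by blast
  have c_sum: "(\<Sum>v\<in>F. \<bar>c v\<bar>) \<le> M" if "finite F" "F \<subseteq> E" for F
  proof -
    have "inner v (C v) = c v" if "v \<in> E" for v
      using E(1,3) that orthonormal_inner[OF E(1) that that] by simp
    hence "(\<Sum>v\<in>F. \<bar>c v\<bar>) = (\<Sum>v\<in>F. \<bar>inner v (C v)\<bar>)"
      using that by (intro sum.cong) auto
    thus ?thesis using M[OF orthonormal_subset[OF E(1) that(2)] that(1)] by simp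
  qed
  let ?P = "diag_sum E (\<lambda>v. \<bar>c v\<bar>)"
  interpret C: bounded_linear C by (rule linear_C)
  interpret P: bounded_linear ?P by (rule diag_sum_bounded_linear[OF E(1) E'])
  note hs = diag_sum_inner_has_sum[OF E(1) E']
  show thesis
  proof (rule that)
    show "bounded_linear ?P" by (rule diag_sum_bounded_linear[OF E(1) E'])
    show "self_adjoint ?P" by (rule diag_sum_self_adjoint[OF E(1) E'])
    show "inner x (?P x) \<ge> 0" for x
      using has_sum_nonneg[OF hs[of x x]] by (simp add: inner_commute mult.assoc)
    show "?P (?P x) = C (C x)" for x
    proof -
      have 1: "((\<lambda>v. ?P ((\<bar>c v\<bar> * inner x v) *\<^sub>R v)) has_sum ?P (?P x)) E"
        by (rule has_sum_bounded_linear[OF _ diag_sum_has_sum[OF E(1) E']]) (rule P.bounded_linear_axioms)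
      have 2: "((\<lambda>v. C ((c v * inner x v) *\<^sub>R v)) has_sum C (C x)) E"
        unfolding E(4)[of x]
        by (rule has_sum_bounded_linear[OF _ diag_sum_has_sum[OF E(1,2)]]) (rule linear_C)
      have "?P ((\<bar>c v\<bar> * inner x v) *\<^sub>R v) = C ((c v * inner x v) *\<^sub>R v)" if "v \<in> E" for v
      proof -
        have "\<bar>c v\<bar> * inner x v * \<bar>c v\<bar> = c v * inner x v * c v"
          using abs_mult_self_eq[of "c v"] by (simp add: mult_ac)
        thus ?thesis
          by (simp add: P.scaleR C.scaleR E(3)[OF that] diag_sum_in[OF E(1) E' that])
      qed
      hence "((\<lambda>v. ?P ((\<bar>c v\<bar> * inner x v) *\<^sub>R v)) has_sum C (C x)) E"
        using 2 by (subst has_sum_cong) auto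
      thus ?thesis using 1 has_sum_unique by blast
    qed
    show "summable (\<lambda>n. coord (?P (basis_l2 n)) n)"
    proof (rule summableI_nonneg_bounded)
      have hsn: "((\<lambda>v. \<bar>c v\<bar> * (coord v n)\<^sup>2) has_sum coord (?P (basis_l2 n)) n) E" for n
        using hs[of "basis_l2 n" "basis_l2 n"] by (simp add: power2_eq_square mult.assoc)
      show "0 \<le> coord (?P (basis_l2 n)) n" for n
        by (rule has_sum_nonneg[OF hsn]) simp
      show "(\<Sum>n<N. coord (?P (basis_l2 n)) n) \<le> M" for N
      proof (rule has_sum_le_finite_sums)
        show "((\<lambda>v. \<Sum>n<N. \<bar>c v\<bar> * (coord v n)\<^sup>2) has_sum (\<Sum>n<N. coord (?P (basis_l2 n)) n)) E"
          by (intro has_sum_sum_lessThan hsn)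
        fix F assume F: "finite F" "F \<subseteq> E"
        have "(\<Sum>v\<in>F. \<Sum>n<N. \<bar>c v\<bar> * (coord v n)\<^sup>2) \<le> (\<Sum>v\<in>F. \<bar>c v\<bar>)"
        proof (rule sum_mono)
          fix v assume "v \<in> F"
          hence "norm v = 1" using F E(1) by (auto simp: orthonormal_def)
          hence "(\<Sum>n<N. (coord v n)\<^sup>2) \<le> 1" using sum_coord_le[of "{..<N}" v] by simp
          thus "(\<Sum>n<N. \<bar>c v\<bar> * (coord v n)\<^sup>2) \<le> \<bar>c v\<bar>"
            unfolding sum_distrib_left[symmetric] by (simp add: mult_left_le)
        qed
        also have "\<dots> \<le> M" by (rule c_sum[OF F])
        finally show "(\<Sum>v\<in>F. \<Sum>n<N. \<bar>c v\<bar> * (coord v n)\<^sup>2) \<le> M" .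
      qed
    qed
  qed
qed

end

section \<open>Complexification\<close>

definition re_l2 :: "(nat \<Rightarrow> complex) \<Rightarrow> l2" where "re_l2 x = seq_l2 (\<lambda>n. Re (x n))"
definition im_l2 :: "(nat \<Rightarrow> complex) \<Rightarrow> l2" where "im_l2 x = seq_l2 (\<lambda>n. Im (x n))"

definition complex_seq :: "l2 \<Rightarrow> l2 \<Rightarrow> nat \<Rightarrow> complex"
  where "complex_seq u v = (\<lambda>n. Complex (coord u n) (coord v n))"

lemma coord_re_im_l2:
  assumes "x \<in> ell2"
  shows "coord (re_l2 x) n = Re (x n)" "coord (im_l2 x) n = Im (x n)"
proof -
  have s: "summable (\<lambda>n. (cmod (x n))\<^sup>2)" using assms by (simp add: ell2_def)
  have "summable (\<lambda>n. (Re (x n))\<^sup>2)" "summable (\<lambda>n. (Im (x n))\<^sup>2)"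
    by (rule summable_comparison_test'[OF s, of 0]; simp add: cmod_power2)+
  thus "coord (re_l2 x) n = Re (x n)" "coord (im_l2 x) n = Im (x n)"
    by (simp_all add: re_l2_def im_l2_def coord_seq_l2)
qed

lemma complex_seq_sums: "(\<lambda>n. (cmod (complex_seq u v n))\<^sup>2) sums ((norm u)\<^sup>2 + (norm v)\<^sup>2)"
  using sums_add[OF norm_l2_sums[of u] norm_l2_sums[of v]] by (simp add: complex_seq_def cmod_power2)

lemma complex_seq_in_ell2 [simp]: "complex_seq u v \<in> ell2"
  using complex_seq_sums[of u v] by (auto simp: ell2_def dest: sums_summable)

lemma complex_seq_re_im: "x \<in> ell2 \<Longrightarrow> complex_seq (re_l2 x) (im_l2 x) = x"
  by (simp add: complex_seq_def coord_re_im_l2 fun_eq_iff)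

lemma ell2_cases: assumes "x \<in> ell2" obtains u v where "x = complex_seq u v"
  using complex_seq_re_im[OF assms] by metis

lemma re_im_complex_seq [simp]: "re_l2 (complex_seq u v) = u" "im_l2 (complex_seq u v) = v"
  by (auto intro!: l2_eqI simp: coord_re_im_l2) (simp_all add: complex_seq_def)

lemma complex_seq_eq_iff: "complex_seq u v = complex_seq u' v' \<longleftrightarrow> u = u' \<and> v = v'"
  by (metis re_im_complex_seq)

lemma zero_complex_seq: "(\<lambda>_. 0) = complex_seq 0 0"
  by (simp add: complex_seq_def fun_eq_iff complex_eq_iff)

lemma complex_seq_linear:
  "(\<lambda>n. a * complex_seq u v n + b * complex_seq u' v' n) =
   complex_seq (Re a *\<^sub>R u - Im a *\<^sub>R v + (Re b *\<^sub>R u' - Im b *\<^sub>R v'))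
     (Re a *\<^sub>R v + Im a *\<^sub>R u + (Re b *\<^sub>R v' + Im b *\<^sub>R u'))"
  by (simp add: complex_seq_def fun_eq_iff complex_eq_iff)

lemma complex_seq_mult:
  "(\<lambda>n. a * complex_seq u v n) = complex_seq (Re a *\<^sub>R u - Im a *\<^sub>R v) (Re a *\<^sub>R v + Im a *\<^sub>R u)"
  by (simp add: complex_seq_def fun_eq_iff complex_eq_iff)

lemma complex_seq_diff: "(\<lambda>n. complex_seq u v n - complex_seq u' v' n) = complex_seq (u - u') (v - v')"
  by (simp add: complex_seq_def fun_eq_iff complex_eq_iff)

lemma unit_seq_eq: "unit_seq n = complex_seq (basis_l2 n) 0"
  by (auto simp: unit_seq_def complex_seq_def coord_basis_l2 fun_eq_iff complex_eq_iff)

lemma ell2_norm_complex_seq: "(ell2_norm (complex_seq u v))\<^sup>2 = (norm u)\<^sup>2 + (norm v)\<^sup>2"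
  using complex_seq_sums[of u v] by (simp add: ell2_norm_def sums_iff)

lemma ell2_norm_nonneg: "ell2_norm (complex_seq u v) \<ge> 0"
  using complex_seq_sums[of u v] by (simp add: ell2_norm_def sums_iff)

lemma ell2_inner_complex_seq:
  "ell2_inner (complex_seq u v) (complex_seq u' v') =
     Complex (inner u u' + inner v v') (inner u v' - inner v u')"
proof -
  have "(\<lambda>n. cnj (complex_seq u v n) * complex_seq u' v' n) sums
      Complex (inner u u' + inner v v') (inner u v' - inner v u')"
    unfolding sums_complex_iff
    using sums_add[OF inner_l2_sums[of u u'] inner_l2_sums[of v v']]
      sums_diff[OF inner_l2_sums[of u v'] inner_l2_sums[of v u']]
    by (simp add: complex_seq_def)
  thus ?thesis by (simp add: ell2_inner_def sums_iff)
qed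

definition complex_op :: "(l2 \<Rightarrow> l2) \<Rightarrow> (nat \<Rightarrow> complex) \<Rightarrow> nat \<Rightarrow> complex"
  where "complex_op T x = complex_seq (T (re_l2 x)) (T (im_l2 x))"

lemma complex_op_complex_seq [simp]: "complex_op T (complex_seq u v) = complex_seq (T u) (T v)"
  by (simp add: complex_op_def)

text \<open>Operators are only determined by their values on \<^const>\<open>ell2\<close>, hence the hypothesis \<open>A\<close>.\<close>

lemma bounded_op_complex_op:
  assumes T: "bounded_linear T" and A: "\<And>x. x \<in> ell2 \<Longrightarrow> A x = complex_op T x"
  shows "bounded_op A"
proof -
  interpret T: bounded_linear T by fact
  obtain M where M: "\<And>x. norm (T x) \<le> norm x * M" and M0: "M \<ge> 0"
    using T.nonneg_bounded by blast
  have 1: "A x \<in> ell2" if "x \<in> ell2" for x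
    using that by (simp add: A complex_op_def)
  have 2: "A (\<lambda>n. a * x n + b * y n) = (\<lambda>n. a * A x n + b * A y n)"
    if x: "x \<in> ell2" and y: "y \<in> ell2" for x y a b
  proof -
    obtain u v where "x = complex_seq u v" using x by (rule ell2_cases)
    moreover obtain u' v' where "y = complex_seq u' v'" using y by (rule ell2_cases)
    ultimately show ?thesis
      by (simp add: A complex_seq_linear T.add T.diff T.scaleR)
  qed
  have 3: "ell2_norm (A x) \<le> M * ell2_norm x" if x: "x \<in> ell2" for x
  proof -
    from x obtain u v where x: "x = complex_seq u v" by (rule ell2_cases)
    have "(norm (T u))\<^sup>2 + (norm (T v))\<^sup>2 \<le> (norm u * M)\<^sup>2 + (norm v * M)\<^sup>2"
      by (intro add_mono power_mono M) auto
    hence "(ell2_norm (A x))\<^sup>2 \<le> (M * ell2_norm x)\<^sup>2"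
      by (simp add: x A ell2_norm_complex_seq power_mult_distrib algebra_simps)
    thus ?thesis
      by (rule power2_le_imp_le) (simp add: x M0 ell2_norm_nonneg)
  qed
  show ?thesis unfolding bounded_op_def using 1 2 3 by blast
qed

lemma trace_class_complex_op:
  assumes T: "bounded_linear T" "self_adjoint T" and A: "\<And>x. x \<in> ell2 \<Longrightarrow> A x = complex_op T x"
    and P: "bounded_linear P" "self_adjoint P" "\<And>x. inner x (P x) \<ge> 0" "\<And>x. P (P x) = T (T x)"
      "summable (\<lambda>n. coord (P (basis_l2 n)) n)"
  shows "trace_class A"
proof -
  interpret P: bounded_linear P by fact
  have PT: "inner (P x) (P y) = inner (T x) (T y)" for x y
    using self_adjointD[OF T(2)] self_adjointD[OF P(2)] P(4) by simp
  have "is_abs_op A (complex_op P)"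
    unfolding is_abs_op_def
  proof (intro conjI ballI)
    show "bounded_op (complex_op P)" by (rule bounded_op_complex_op[OF P(1)]) simp
    fix x assume "x \<in> ell2"
    then obtain u v where x: "x = complex_seq u v" by (rule ell2_cases)
    \<comment> \<open>The difference of these two numbers is the imaginary part of the inner product
      of x with P x.\<close>
    have "inner u (P v) = inner v (P u)"
      using self_adjointD[OF P(2), of u v] by (simp add: inner_commute)
    hence "ell2_inner x (complex_op P x) = of_real (inner u (P u) + inner v (P v))"
      by (simp add: x ell2_inner_complex_seq complex_eq_iff)
    thus "ell2_inner x (complex_op P x) \<in> \<real>\<^sub>\<ge>\<^sub>0"
      using P(3)[of u] P(3)[of v] by (simp del: of_real_add)
    fix y assume "y \<in> ell2"
    then obtain u' v' where y: "y = complex_seq u' v'" by (rule ell2_cases)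
    show "ell2_inner (complex_op P x) (complex_op P y) = ell2_inner (A x) (A y)"
      by (simp add: x y A ell2_inner_complex_seq PT)
  qed
  moreover have "summable (\<lambda>n. Re (ell2_inner (unit_seq n) (complex_op P (unit_seq n))))"
    using P(5) by (simp add: unit_seq_eq ell2_inner_complex_seq P.zero)
  ultimately show ?thesis
    unfolding trace_class_def using bounded_op_complex_op[OF T(1) A] by blast
qed

lemma op_trace_complex_op:
  assumes "bounded_linear T" "\<And>x. x \<in> ell2 \<Longrightarrow> A x = complex_op T x"
  shows "op_trace A = (\<Sum>n. of_real (coord (T (basis_l2 n)) n))"
  using bounded_linear.linear[OF assms(1), THEN linear_0]
  by (simp add: op_trace_def assms(2) unit_seq_eq ell2_inner_complex_seq complex_of_real_def)

section \<open>The eigenvalues of a Jacobi operator\<close>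

lemma matrix_apply_jacobi: "matrix_apply (jacobi_matrix lam w) x = japp lam w x"
proof
  fix i
  show "matrix_apply (jacobi_matrix lam w) x i = japp lam w x i"
  proof (cases i)
    case 0
    have "(\<Sum>j. jacobi_matrix lam w 0 j * x j) = (\<Sum>j\<in>{0, Suc 0}. jacobi_matrix lam w 0 j * x j)"
      by (rule suminf_finite) (auto simp: jacobi_matrix_def)
    thus ?thesis by (simp add: 0 matrix_apply_def japp_def jacobi_matrix_def scaleR_conv_of_real)
  next
    case (Suc m)
    have "(\<Sum>j. jacobi_matrix lam w i j * x j) = (\<Sum>j\<in>{m, i, Suc i}. jacobi_matrix lam w i j * x j)"
      by (rule suminf_finite) (auto simp: jacobi_matrix_def Suc)
    thus ?thesis by (simp add: Suc matrix_apply_def japp_def jacobi_matrix_def scaleR_conv_of_real add_ac)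
  qed
qed

lemma matrix_operator_iff:
  "(x, y) \<in> matrix_operator M \<longleftrightarrow> x \<in> ell2 \<and> y \<in> ell2 \<and> matrix_apply M x = y"
  by (auto simp: matrix_operator_def)

lemma jacobi_operator_iff:
  "(x, y) \<in> jacobi_operator lam w \<longleftrightarrow> x \<in> ell2 \<and> y \<in> ell2 \<and> (\<forall>n. japp lam w x n = y n)"
  by (simp add: jacobi_operator_def matrix_operator_iff matrix_apply_jacobi fun_eq_iff)

lemma diag_operator_iff:
  "(x, y) \<in> diag_operator lam \<longleftrightarrow> x \<in> ell2 \<and> y \<in> ell2 \<and> (\<forall>n. of_real (lam n) * x n = y n)"
proof -
  have "matrix_apply (\<lambda>i j. if i = j then of_real (lam i) else 0) x = (\<lambda>n. of_real (lam n) * x n)"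
    unfolding matrix_apply_def
  proof
    fix i
    have "(\<Sum>j. (if i = j then of_real (lam i) else 0) * x j) = (\<Sum>j\<in>{i}. (if i = j then of_real (lam i) else 0) * x j)"
      by (rule suminf_finite) auto
    thus "(\<Sum>j. (if i = j then of_real (lam i) else 0) * x j) = of_real (lam i) * x i" by simp
  qed
  thus ?thesis
    by (simp add: diag_operator_def matrix_operator_iff fun_eq_iff)
qed

lemma japp_complex_seq:
  "japp lam w (complex_seq u v) n = Complex (japp lam w (coord u) n) (japp lam w (coord v) n)"
  by (simp add: japp_def complex_seq_def complex_eq_iff split: nat.split)

text \<open>The inverse of the graph is single-valued at the zero sequence, and both x and 0 lie
  over it.\<close>

lemma op_invertible_kernel:
  fixes x :: l2
  assumes "op_invertible (jacobi_operator lam w)" "\<And>n. japp lam w (coord x) n = 0"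
  shows "x = 0"
proof -
  let ?T = "jacobi_operator lam w"
  obtain R where R: "(op_shift ?T 0)\<inverse> = {(y, R y) |y. y \<in> ell2}"
    using assms(1) by (auto simp: op_invertible_def op_spectrum_def)
  have *: "complex_seq u 0 = R (\<lambda>_. 0)" if "\<And>n. japp lam w (coord u) n = 0" for u
  proof -
    have "(complex_seq u 0, \<lambda>_. 0) \<in> ?T"
      unfolding jacobi_operator_iff japp_complex_seq
      by (auto simp: that zero_complex_seq complex_eq_iff) (simp add: japp_def split: nat.split)
    hence "(complex_seq u 0, \<lambda>_. 0) \<in> op_shift ?T 0"
      unfolding op_shift_def by force
    hence "((\<lambda>_. 0), complex_seq u 0) \<in> {(y, R y) |y. y \<in> ell2}"
      unfolding R[symmetric] by simp
    thus ?thesis by blast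
  qed
  have "complex_seq x 0 = complex_seq 0 0"
    using *[OF assms(2)] *[of 0] by (simp add: japp_def split: nat.split)
  thus ?thesis by (simp add: complex_seq_eq_iff)
qed

text \<open>Since no w_n vanishes, the recurrence determines a solution from its first entry. This
  is the source of simplicity of the eigenvalues.\<close>

lemma japp_solution_unique:
  fixes x :: "nat \<Rightarrow> 'a::real_normed_field"
  assumes "\<And>n. w n \<noteq> 0" "\<And>n. japp lam w x n = z * x n" "x 0 = 0"
  shows "x n = 0"
proof -
  have "x n = 0 \<and> x (Suc n) = 0"
  proof (induction n)
    case 0
    show ?case using assms(2)[of 0] assms(1)[of 0] assms(3) by (simp add: japp_def)
  next
    case (Suc n)
    show ?case using assms(2)[of "Suc n"] assms(1)[of "Suc n"] Suc by (simp add: japp_def)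
  qed
  thus ?thesis ..
qed

context jacobi_invertible
begin

lemma op_inverse_jacobi:
  assumes "y \<in> ell2"
  shows "op_inverse (jacobi_operator lam w) y = complex_op A y"
proof -
  obtain u v where y: "y = complex_seq u v" using assms by (rule ell2_cases)
  show ?thesis
    unfolding op_inverse_def
  proof (rule the_equality)
    show "(complex_op A y, y) \<in> jacobi_operator lam w"
      by (simp add: y jacobi_operator_iff japp_complex_seq japp_A) (simp add: complex_seq_def)
    fix x assume x: "(x, y) \<in> jacobi_operator lam w"
    hence "x \<in> ell2" by (simp add: jacobi_operator_iff)
    then obtain u' v' where x': "x = complex_seq u' v'" by (rule ell2_cases)
    have "Complex (japp lam w (coord u') n) (japp lam w (coord v') n) = Complex (coord u n) (coord v n)" for n
      using x by (simp add: jacobi_operator_iff x' y japp_complex_seq) (simp add: complex_seq_def)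
    hence "u' = A u" "v' = A v" by (auto intro!: A_unique)
    thus "x = complex_op A y" by (simp add: x' y)
  qed
qed

lemma op_inverse_diag:
  assumes "y \<in> ell2"
  shows "op_inverse (diag_operator lam) y = complex_op (diag_l2 (\<lambda>n. 1 / lam n)) y"
proof -
  obtain u v where y: "y = complex_seq u v" using assms by (rule ell2_cases)
  have nz: "lam n \<noteq> 0" for n using lam_pos[of n] by simp
  have c: "of_real (lam n) * complex_op (diag_l2 (\<lambda>n. 1 / lam n)) y n = y n" for n
    using nz by (simp add: y, simp add: complex_seq_def coord_diag_l2[OF Bseq_inverse_lam] complex_eq_iff)
  show ?thesis
    unfolding op_inverse_def
  proof (rule the_equality)
    show "(complex_op (diag_l2 (\<lambda>n. 1 / lam n)) y, y) \<in> diag_operator lam"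
      unfolding diag_operator_iff using c assms by (simp add: complex_op_def)
    fix x assume x: "(x, y) \<in> diag_operator lam"
    show "x = complex_op (diag_l2 (\<lambda>n. 1 / lam n)) y"
    proof
      fix n
      have "of_real (lam n) * x n = of_real (lam n) * complex_op (diag_l2 (\<lambda>n. 1 / lam n)) y n"
        using x c[of n] by (simp add: diag_operator_iff)
      thus "x n = complex_op (diag_l2 (\<lambda>n. 1 / lam n)) y n" using nz[of n] by simp
    qed
  qed
qed

lemma inverse_difference_eq: "y \<in> ell2 \<Longrightarrow> inverse_difference lam w y = complex_op C y"
  unfolding inverse_difference_def
  by (simp add: op_inverse_jacobi op_inverse_diag) (simp add: complex_op_def complex_seq_diff C_def)

lemma trace_class_inverse_difference: "trace_class (inverse_difference lam w)"
proof (rule C_abs_trace_class)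
  fix P assume P: "bounded_linear P" "self_adjoint P" "\<And>x. inner x (P x) \<ge> 0"
    "\<And>x. P (P x) = C (C x)" "summable (\<lambda>n. coord (P (basis_l2 n)) n)"
  show ?thesis
    by (rule trace_class_complex_op[OF linear_C self_adjoint_C inverse_difference_eq P])
qed

lemma coord_C_basis: "coord (C (basis_l2 n)) n = 1 / lam n - coord (A (basis_l2 n)) n"
  by (simp add: C_def coord_diag_l2[OF Bseq_inverse_lam] coord_basis_l2)

lemma op_trace_inverse_difference:
  "op_trace (inverse_difference lam w) = (\<Sum>n. of_real (1 / lam n - coord (A (basis_l2 n)) n))"
  using op_trace_complex_op[OF linear_C inverse_difference_eq] by (simp only: coord_C_basis)

definition eig :: "real set"
  where "eig = {t. \<exists>v :: l2. v \<noteq> 0 \<and> (\<forall>n. japp lam w (coord v) n = t * coord v n)}"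

lemma eig_A: "(\<And>n. japp lam w (coord v) n = t * coord v n) \<Longrightarrow> v = t *\<^sub>R A v"
  using A_unique[of v "t *\<^sub>R v"] by (simp add: linear_scale[OF bounded_linear.linear[OF linear_A]])

lemma eigenspace_iff:
  "x \<in> eigenspace (jacobi_operator lam w) z \<longleftrightarrow> x \<in> ell2 \<and> (\<forall>n. japp lam w x n = z * x n)"
proof -
  have "(\<lambda>n. z * x n) \<in> ell2" if "x \<in> ell2"
  proof -
    from that obtain u v where "x = complex_seq u v" by (rule ell2_cases)
    thus ?thesis by (simp add: complex_seq_mult)
  qed
  thus ?thesis by (auto simp: eigenspace_def jacobi_operator_iff)
qed

text \<open>For an eigenvector with real part u and imaginary part v, symmetry of A gives Im z
  (|u|^2 + |v|^2) = 0. Once z is real, whichever of u and v is nonzero is a real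
  eigenvector.\<close>

lemma eigenvalues_eq: "eigenvalues (jacobi_operator lam w) = of_real ` eig"
proof (intro equalityI subsetI)
  fix z assume "z \<in> eigenvalues (jacobi_operator lam w)"
  then obtain x where x: "x \<in> ell2" "\<And>n. japp lam w x n = z * x n" "x \<noteq> (\<lambda>_. 0)"
    by (auto simp: eigenvalues_def eigenspace_iff)
  from x(1) obtain u v where x': "x = complex_seq u v" by (rule ell2_cases)
  let ?p = "Re z" and ?q = "Im z"
  have *: "Complex (japp lam w (coord u) n) (japp lam w (coord v) n) =
      complex_seq (?p *\<^sub>R u - ?q *\<^sub>R v) (?p *\<^sub>R v + ?q *\<^sub>R u) n" for n
    using x(2)[of n] fun_cong[OF complex_seq_mult[of z u v], of n] by (simp add: x' japp_complex_seq)
  have u: "u = A (?p *\<^sub>R u - ?q *\<^sub>R v)" and v: "v = A (?p *\<^sub>R v + ?q *\<^sub>R u)"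
    using * by (auto intro!: A_unique simp: complex_seq_def)
  have "inner u (?p *\<^sub>R v + ?q *\<^sub>R u) = inner (?p *\<^sub>R u - ?q *\<^sub>R v) v"
    using self_adjointD[OF self_adjoint_A, of "?p *\<^sub>R u - ?q *\<^sub>R v" "?p *\<^sub>R v + ?q *\<^sub>R u"]
    by (simp only: u[symmetric] v[symmetric])
  hence "?q * (inner u u + inner v v) = 0"
    by (simp add: inner_add_right inner_diff_left algebra_simps)
  moreover have nz: "u \<noteq> 0 \<or> v \<noteq> 0"
    using x(3) by (auto simp: x' zero_complex_seq)
  hence "inner u u + inner v v \<noteq> 0"
    by (simp add: add_nonneg_eq_0_iff)
  ultimately have q: "?q = 0" by simp
  have "japp lam w (coord u) n = ?p * coord u n" "japp lam w (coord v) n = ?p * coord v n" for n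
    using *[of n] q by (simp_all add: complex_seq_def)
  hence "?p \<in> eig" using nz unfolding eig_def by blast
  thus "z \<in> of_real ` eig" using q by (auto simp: complex_eq_iff image_iff)
next
  fix z :: complex assume "z \<in> of_real ` eig"
  then obtain t v where t: "z = of_real t" "v \<noteq> 0" "\<And>n. japp lam w (coord v) n = t * coord v n"
    by (auto simp: eig_def)
  have "complex_seq v 0 \<in> eigenspace (jacobi_operator lam w) z"
    unfolding eigenspace_iff
    by (auto simp: japp_complex_seq t) (simp add: complex_seq_def complex_eq_iff japp_def split: nat.split)
  moreover have "complex_seq v 0 \<noteq> (\<lambda>_. 0)"
    using t(2) by (simp add: zero_complex_seq complex_seq_eq_iff)
  ultimately show "z \<in> eigenvalues (jacobi_operator lam w)"
    by (auto simp: eigenvalues_def)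
qed

lemma simple_eigenvalues:
  assumes "z \<in> eigenvalues (jacobi_operator lam w)"
  shows "simple_eigenvalue (jacobi_operator lam w) z"
proof -
  obtain x where x: "x \<in> ell2" "\<And>n. japp lam w x n = z * x n" "x \<noteq> (\<lambda>_. 0)"
    using assms by (auto simp: eigenvalues_def eigenspace_iff)
  have x0: "x 0 \<noteq> 0"
    using japp_solution_unique[OF w_nonzero x(2)] x(3) by auto
  have "y \<in> {\<lambda>n. c * x n |c. True}" if "y \<in> eigenspace (jacobi_operator lam w) z" for y
  proof -
    have y: "\<And>n. japp lam w y n = z * y n" using that by (simp add: eigenspace_iff)
    let ?y = "\<lambda>n. y n - (y 0 / x 0) * x n"
    have "japp lam w ?y n = japp lam w y n - (y 0 / x 0) * japp lam w x n" for n
      by (simp add: japp_def scaleR_conv_of_real algebra_simps split: nat.split)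
    hence e: "japp lam w ?y n = z * ?y n" for n
      by (simp add: x(2) y algebra_simps)
    have "?y n = 0" for n
      by (rule japp_solution_unique[where x = ?y, OF w_nonzero e]) (simp add: x0)
    hence "y = (\<lambda>n. (y 0 / x 0) * x n)" unfolding fun_eq_iff right_minus_eq by blast
    thus ?thesis by blast
  qed
  moreover have "(\<lambda>n. c * x n) \<in> eigenspace (jacobi_operator lam w) z" for c
  proof -
    have "japp lam w (\<lambda>n. c * x n) n = c * japp lam w x n" for n
      by (simp add: japp_def scaleR_conv_of_real algebra_simps split: nat.split)
    moreover obtain u v where "x = complex_seq u v" using x(1) by (rule ell2_cases)
    hence "(\<lambda>n. c * x n) \<in> ell2" by (simp add: complex_seq_mult)
    ultimately show ?thesis by (simp add: eigenspace_iff x(2))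
  qed
  ultimately have "eigenspace (jacobi_operator lam w) z = {\<lambda>n. c * x n |c. True}" by blast
  thus ?thesis unfolding simple_eigenvalue_def using x(3) by blast
qed

end

section \<open>The eigenbasis\<close>

context jacobi_invertible
begin

lemma eig_nonzero: "s \<in> eig \<Longrightarrow> s \<noteq> 0"
  using japp_kernel unfolding eig_def by force

lemma eigenvector_scale:
  assumes "\<And>n. japp lam w (coord u) n = t * coord u n" "\<And>n. japp lam w (coord v) n = t * coord v n" "u \<noteq> 0"
  shows "\<exists>r. v = r *\<^sub>R u"
proof -
  have u0: "coord u 0 \<noteq> 0"
    using japp_solution_unique[OF w_nonzero assms(1)] assms(3) by (auto intro: l2_eqI)
  define y where "y = v - (coord v 0 / coord u 0) *\<^sub>R u"
  have "coord y n = 0" for n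
  proof (rule japp_solution_unique[OF w_nonzero])
    show "japp lam w (coord y) n = t * coord y n" for n
    proof -
      have "japp lam w (coord y) n =
        japp lam w (coord v) n - (coord v 0 / coord u 0) * japp lam w (coord u) n"
        by (simp add: y_def japp_def algebra_simps split: nat.split)
      thus ?thesis by (simp add: assms y_def algebra_simps)
    qed
  qed (simp add: y_def u0)
  hence "y = 0" by (intro l2_eqI) simp
  hence "v = (coord v 0 / coord u 0) *\<^sub>R u" by (simp add: y_def)
  thus ?thesis by (rule exI[of _ "coord v 0 / coord u 0"])
qed

text \<open>Simplicity allows the eigenvectors to be indexed by their eigenvalues. Completeness is
  expressed through A x, where the weights 1/s make the expansion absolutely convergent.\<close>

definition is_eigenbasis :: "(real \<Rightarrow> l2) \<Rightarrow> bool"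
  where "is_eigenbasis v \<longleftrightarrow>
    (\<forall>s\<in>eig. A (v s) = (1 / s) *\<^sub>R v s) \<and>
    (\<forall>s\<in>eig. \<forall>t\<in>eig. inner (v s) (v t) = (if s = t then 1 else 0)) \<and>
    (\<lambda>s. (1 / s)\<^sup>2) summable_on eig \<and>
    (\<forall>x. ((\<lambda>s. (1 / s * inner x (v s)) *\<^sub>R v s) has_sum A x) eig)"

lemma ex_eigenbasis: "\<exists>v. is_eigenbasis v"
proof -
  obtain E c where E: "orthonormal E" "(\<lambda>v. (c v)\<^sup>2) summable_on E" "\<And>v. v \<in> E \<Longrightarrow> c v \<noteq> 0"
    "\<And>v. v \<in> E \<Longrightarrow> A v = c v *\<^sub>R v" "\<And>x. A x = diag_sum E c x"
    "\<And>x. (\<And>v. v \<in> E \<Longrightarrow> inner x v = 0) \<Longrightarrow> A x = 0"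
    using hilbert_schmidt_spectral[OF linear_A self_adjoint_A hilbert_schmidt_A] by blast
  have norm1: "norm v = 1" if "v \<in> E" for v using E(1) that by (simp add: orthonormal_def)
  have J: "japp lam w (coord v) n = (1 / c v) * coord v n" if "v \<in> E" for v n
    using japp_A[of v n] E(3)[OF that] unfolding E(4)[OF that]
    by (simp add: japp_def field_simps split: nat.splits)
  have bij: "bij_betw (\<lambda>v. 1 / c v) E eig"
    unfolding bij_betw_def
  proof (intro conjI inj_onI equalityI subsetI)
    fix u v assume uv: "u \<in> E" "v \<in> E" "1 / c u = 1 / c v"
    have "u \<noteq> 0" using norm1[OF uv(1)] by auto
    then obtain r where r: "v = r *\<^sub>R u"
      using eigenvector_scale[OF J[OF uv(1)], of v] J[OF uv(2)] uv(3) by auto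
    show "u = v"
    proof (rule ccontr)
      assume "u \<noteq> v"
      hence "inner v u = 0" using orthonormal_inner[OF E(1) uv(2,1)] by simp
      hence "r = 0" using norm1[OF uv(1)] by (simp add: r dot_square_norm)
      thus False using r norm1[OF uv(2)] by simp
    qed
  next
    fix t assume "t \<in> (\<lambda>v. 1 / c v) ` E"
    then obtain v where v: "v \<in> E" "t = 1 / c v" by blast
    have "v \<noteq> 0" using norm1[OF v(1)] by auto
    thus "t \<in> eig"
      unfolding eig_def by (intro CollectI exI[of _ v] conjI allI) (auto simp: J[OF v(1)] v(2) \<open>v \<noteq> 0\<close>)
  next
    \<comment> \<open>An eigenvalue missing from the list would have an eigenvector orthogonal to
      all of E, hence in the kernel of A, which is trivial.\<close>
    fix t assume t: "t \<in> eig"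
    then obtain x where x: "x \<noteq> 0" "\<And>n. japp lam w (coord x) n = t * coord x n"
      by (auto simp: eig_def)
    show "t \<in> (\<lambda>v. 1 / c v) ` E"
    proof (rule ccontr)
      assume *: "t \<notin> (\<lambda>v. 1 / c v) ` E"
      have "inner x v = 0" if v: "v \<in> E" for v
      proof -
        have "inner x v = inner (t *\<^sub>R A x) v" using eig_A[OF x(2)] by simp
        also have "\<dots> = t * c v * inner x v"
          using self_adjointD[OF self_adjoint_A, of x v] E(4)[OF v] by simp
        finally have "(1 - t * c v) * inner x v = 0" by (simp add: algebra_simps)
        moreover have "t \<noteq> 1 / c v" using * v by blast
        hence "t * c v \<noteq> 1" using E(3)[OF v] by (simp add: nonzero_eq_divide_eq)
        ultimately show ?thesis by simp
      qed
      hence "A x = 0" by (rule E(6))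
      thus False using x(1) by (simp add: A_eq_0_iff)
    qed
  qed
  define v where "v = inv_into E (\<lambda>v. 1 / c v)"
  have v: "v s \<in> E" "c (v s) = 1 / s" if "s \<in> eig" for s
  proof -
    show vs: "v s \<in> E" using bij that by (auto simp: v_def bij_betw_def intro: inv_into_into)
    have "1 / c (v s) = s"
      unfolding v_def using f_inv_into_f[of s "\<lambda>v. 1 / c v" E] bij that by (simp add: bij_betw_def)
    thus "c (v s) = 1 / s"
      using E(3)[OF vs] eig_nonzero[OF that] by (simp add: field_simps)
  qed
  have bv: "bij_betw v eig E" unfolding v_def by (rule bij_betw_inv_into[OF bij])
  have inj: "v s = v t \<longleftrightarrow> s = t" if "s \<in> eig" "t \<in> eig" for s t
    using bij_betw_imp_inj_on[OF bv] that by (auto simp: inj_on_def)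
  have "is_eigenbasis v"
    unfolding is_eigenbasis_def
  proof (intro conjI ballI allI)
    show "A (v s) = (1 / s) *\<^sub>R v s" if "s \<in> eig" for s
      using E(4)[OF v(1)[OF that]] v(2)[OF that] by simp
    show "inner (v s) (v t) = (if s = t then 1 else 0)" if "s \<in> eig" "t \<in> eig" for s t
      using orthonormal_inner[OF E(1) v(1) v(1)] that inj by simp
    have "(\<lambda>s. (c (v s))\<^sup>2) summable_on eig"
      using summable_on_reindex_bij_betw[OF bv, of "\<lambda>v. (c v)\<^sup>2"] E(2) by simp
    thus "(\<lambda>s. (1 / s)\<^sup>2) summable_on eig"
      by (rule summable_on_cong[THEN iffD1, rotated]) (simp add: v(2))
    fix x
    have "((\<lambda>s. (c (v s) * inner x (v s)) *\<^sub>R v s) has_sum A x) eig"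
      using diag_sum_has_sum[OF E(1,2), of x]
      by (simp add: has_sum_reindex_bij_betw[OF bv, of "\<lambda>v. (c v * inner x v) *\<^sub>R v"] E(5))
    thus "((\<lambda>s. (1 / s * inner x (v s)) *\<^sub>R v s) has_sum A x) eig"
      by (rule has_sum_cong[THEN iffD1, rotated]) (simp add: v(2))
  qed
  thus ?thesis by (rule exI[of is_eigenbasis v])
qed

definition ev :: "real \<Rightarrow> l2" where "ev = (SOME v. is_eigenbasis v)"

lemma is_eigenbasis_ev: "is_eigenbasis ev"
  unfolding ev_def by (rule someI_ex[OF ex_eigenbasis])

lemma A_ev: "s \<in> eig \<Longrightarrow> A (ev s) = (1 / s) *\<^sub>R ev s"
  and inner_ev: "s \<in> eig \<Longrightarrow> t \<in> eig \<Longrightarrow> inner (ev s) (ev t) = (if s = t then 1 else 0)"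
  and summable_eig: "(\<lambda>s. (1 / s)\<^sup>2) summable_on eig"
  and A_has_sum: "((\<lambda>s. (1 / s * inner x (ev s)) *\<^sub>R ev s) has_sum A x) eig"
  using is_eigenbasis_ev unfolding is_eigenbasis_def by blast+

lemma inner_A_ev: "s \<in> eig \<Longrightarrow> inner (A x) (ev s) = 1 / s * inner x (ev s)"
  using self_adjointD[OF self_adjoint_A, of x "ev s"] by (simp add: A_ev)

lemma norm_ev: "s \<in> eig \<Longrightarrow> norm (ev s) = 1"
  by (simp add: norm_eq_sqrt_inner inner_ev)

lemma japp_ev: "s \<in> eig \<Longrightarrow> japp lam w (coord (ev s)) n = s * coord (ev s) n"
  using japp_A[of "ev s" n] eig_nonzero[of s]
  by (simp add: A_ev japp_def field_simps split: nat.splits)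

text \<open>Parseval's identity for x in the range of A; it follows by pairing the expansion of A u
  with y.\<close>

lemma inner_has_sum:
  assumes "x = A u"
  shows "((\<lambda>s. inner x (ev s) * inner y (ev s)) has_sum inner x y) eig"
proof -
  have "((\<lambda>s. inner ((1 / s * inner u (ev s)) *\<^sub>R ev s) y) has_sum inner (A u) y) eig"
    by (rule has_sum_bounded_linear[OF bounded_linear_inner_left A_has_sum])
  thus ?thesis
    unfolding assms by (rule has_sum_cong[THEN iffD1, rotated]) (simp add: inner_A_ev inner_commute)
qed

text \<open>The matrix is banded, so J maps finitely supported vectors to finitely supported ones.
  This puts them in the range of A, where \<open>inner_has_sum\<close> applies.\<close>

lemma finite_support_in_range:
  assumes "finite {n. coord y n \<noteq> 0}"
  obtains u where "y = A u" "\<And>n. coord u n = japp lam w (coord y) n"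
proof -
  obtain N where N: "\<And>n. n > N \<Longrightarrow> coord y n = 0"
    using assms by (auto simp: finite_nat_set_iff_bounded_le) (metis not_le)
  have "japp lam w (coord y) n = 0" if "n \<notin> {..Suc N}" for n
    using that N[of n] N[of "n - 1"] N[of "Suc n"] by (cases n) (simp_all add: japp_def)
  hence "summable (\<lambda>n. (japp lam w (coord y) n)\<^sup>2)"
    by (intro summable_finite[of "{..Suc N}"]) auto
  hence *: "coord (seq_l2 (japp lam w (coord y))) n = japp lam w (coord y) n" for n
    by (rule coord_seq_l2)
  have "y = A (seq_l2 (japp lam w (coord y)))"
    by (rule A_unique) (simp add: *)
  thus thesis using * by (rule that)
qed

lemma basis_in_range: obtains u where "basis_l2 n = A u"
proof -
  have "finite {k. coord (basis_l2 n) k \<noteq> 0}" by (simp add: coord_basis_l2)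
  thus thesis by (rule finite_support_in_range) (rule that)
qed

lemma coord_ev_has_sum: "((\<lambda>s. (coord (ev s) n)\<^sup>2) has_sum 1) eig"
proof -
  obtain u where u: "basis_l2 n = A u" by (rule basis_in_range)
  show ?thesis
    using inner_has_sum[OF u, of "basis_l2 n"] by (simp add: power2_eq_square coord_basis_l2)
qed

text \<open>Double counting of squared coordinates: each coordinate has total mass 1 over the
  eigenvectors, and each eigenvector has mass at most 1 over any finite set of coordinates.\<close>

lemma infinite_eig: "infinite eig"
proof
  assume fin: "finite eig"
  let ?N = "Suc (card eig)"
  have "real ?N = (\<Sum>n<?N. \<Sum>s\<in>eig. (coord (ev s) n)\<^sup>2)"
    using has_sum_unique[OF has_sum_finite[OF fin] coord_ev_has_sum] by simp
  also have "\<dots> = (\<Sum>s\<in>eig. \<Sum>n<?N. (coord (ev s) n)\<^sup>2)"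
    by (rule sum.swap)
  also have "\<dots> \<le> (\<Sum>s\<in>eig. 1)"
    using sum_coord_le[of "{..<?N}"] by (intro sum_mono) (metis norm_ev one_power2 finite_lessThan)
  finally show False by simp
qed

lemma finite_eig_bounded: "finite {s\<in>eig. \<bar>s\<bar> \<le> R}"
proof -
  have "finite {s\<in>eig. (1 / s)\<^sup>2 \<ge> 1 / (\<bar>R\<bar> + 1)\<^sup>2}"
    by (rule summable_on_finite_ge[OF summable_eig]) auto
  moreover have "{s\<in>eig. \<bar>s\<bar> \<le> R} \<subseteq> {s\<in>eig. (1 / s)\<^sup>2 \<ge> 1 / (\<bar>R\<bar> + 1)\<^sup>2}"
  proof safe
    fix s assume s: "s \<in> eig" "\<bar>s\<bar> \<le> R"
    have "s\<^sup>2 \<le> (\<bar>R\<bar> + 1)\<^sup>2" using s by (intro power2_le_iff_abs_le[THEN iffD2]) auto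
    thus "1 / (\<bar>R\<bar> + 1)\<^sup>2 \<le> (1 / s)\<^sup>2"
      using eig_nonzero[OF s(1)] by (simp add: power_divide frac_le)
  qed
  ultimately show ?thesis by (rule finite_subset[rotated])
qed

text \<open>The equation says (J - t) g = r e_n; pairing it with an eigenvector shows that g has the
  coefficient r v_s(n) / (s - t).\<close>

lemma green_has_sum:
  assumes "t \<notin> eig" "\<And>m. japp lam w (coord g) m = t * coord g m + (if m = n then r else 0)"
  shows "((\<lambda>s. r * ((coord (ev s) n)\<^sup>2 / (s - t))) has_sum coord g n) eig"
proof -
  have g: "g = A (t *\<^sub>R g + r *\<^sub>R basis_l2 n)"
    by (rule A_unique) (simp add: assms coord_basis_l2)
  have "((\<lambda>s. inner g (ev s) * coord (ev s) n) has_sum coord g n) eig"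
    using inner_has_sum[OF g, of "basis_l2 n"] by simp
  moreover have "inner g (ev s) * coord (ev s) n = r * ((coord (ev s) n)\<^sup>2 / (s - t))" if s: "s \<in> eig" for s
  proof -
    have "inner g (ev s) = 1 / s * inner (t *\<^sub>R g + r *\<^sub>R basis_l2 n) (ev s)"
      by (subst g) (rule inner_A_ev[OF s])
    hence "s * inner g (ev s) = t * inner g (ev s) + r * coord (ev s) n"
      using eig_nonzero[OF s] by (simp add: inner_add_left field_simps)
    hence "inner g (ev s) * (s - t) = r * coord (ev s) n"
      by (simp add: algebra_simps)
    moreover have "s - t \<noteq> 0" using s assms(1) by auto
    ultimately have "inner g (ev s) = r * coord (ev s) n / (s - t)"
      by (simp add: nonzero_eq_divide_eq)
    thus ?thesis by (simp add: power2_eq_square)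
  qed
  ultimately show ?thesis by (rule has_sum_cong[THEN iffD1, rotated]) simp
qed

lemma zero_notin_eig: "0 \<notin> eig"
  using eig_nonzero by blast

lemma coord_A_has_sum: "((\<lambda>s. (coord (ev s) n)\<^sup>2 / s) has_sum coord (A (basis_l2 n)) n) eig"
  using green_has_sum[OF zero_notin_eig, of "A (basis_l2 n)" n 1] by (simp add: japp_A coord_basis_l2)

text \<open>The trace of h(J) in two bases: absolute summability of h permits Fubini, and the
  eigenvectors have unit norm.\<close>

lemma trace_sums:
  assumes h: "(\<lambda>s. \<bar>h s\<bar>) summable_on eig"
    and f: "\<And>n. ((\<lambda>s. (coord (ev s) n)\<^sup>2 * h s) has_sum f n) eig"
  shows "f sums infsum h eig"
proof -
  let ?F = "\<lambda>(s, n). (coord (ev s) n)\<^sup>2 * h s"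
  have one: "((\<lambda>n. (coord (ev s) n)\<^sup>2) has_sum 1) UNIV" if "s \<in> eig" for s
    using sums_nonneg_imp_has_sum[OF norm_l2_sums[of "ev s"]] norm_ev[OF that] by simp
  have "(\<lambda>p. \<bar>?F p\<bar>) summable_on (eig \<times> UNIV)"
  proof (rule summable_on_SigmaI[OF _ h])
    show "((\<lambda>n. \<bar>?F (s, n)\<bar>) has_sum \<bar>h s\<bar>) UNIV" if "s \<in> eig" for s
      using has_sum_cmult_left[OF one[OF that], of "\<bar>h s\<bar>"] by (simp add: abs_mult)
  qed auto
  hence "?F summable_on (eig \<times> UNIV)"
    unfolding real_norm_def[symmetric] by (rule abs_summable_summable)
  then obtain S where S: "(?F has_sum S) (eig \<times> UNIV)"
    by (auto simp: summable_on_def)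
  have "(h has_sum S) eig"
  proof (rule has_sum_SigmaD[OF S])
    show "((\<lambda>n. ?F (s, n)) has_sum h s) UNIV" if "s \<in> eig" for s
      using has_sum_cmult_left[OF one[OF that], of "h s"] by simp
  qed
  hence SS: "S = infsum h eig" by (simp add: infsumI)
  have "(f has_sum S) UNIV"
  proof (rule has_sum_SigmaD)
    show "((\<lambda>(n, s). ?F (s, n)) has_sum S) (UNIV \<times> eig)"
      using S by (subst (asm) has_sum_swap)
    show "((\<lambda>s. (\<lambda>(n, s). ?F (s, n)) (n, s)) has_sum f n) eig" for n
      using f[of n] by simp
  qed
  thus ?thesis unfolding SS by (rule has_sum_imp_sums)
qed

text \<open>The difference equals -t / s^2 divided by 1 - t/s, and the divisor stays away from 0.
  Neither term alone need be summable.\<close>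

lemma summable_resolvent_diff:
  assumes "t \<notin> eig"
  shows "(\<lambda>s. \<bar>1 / s - 1 / (s - t)\<bar>) summable_on eig"
proof -
  have c: "(\<lambda>s. (- t / s)\<^sup>2) summable_on eig"
    using summable_on_cmult_right[OF summable_eig, of "t\<^sup>2"] by (simp add: power_divide)
  have nz: "1 + - t / s \<noteq> 0" if "s \<in> eig" for s
    using that assms eig_nonzero[OF that] by (auto simp: field_simps)
  obtain m where m: "m > 0" "\<And>s. s \<in> eig \<Longrightarrow> \<bar>1 + - t / s\<bar> \<ge> m"
    using summable_on_bounded_away[OF c nz] by metis
  show ?thesis
  proof (rule summable_on_comparison_test)
    show "(\<lambda>s. (\<bar>t\<bar> / m) * (1 / s)\<^sup>2) summable_on eig"
      by (rule summable_on_cmult_right[OF summable_eig])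
    fix s assume s: "s \<in> eig"
    have "1 / s - 1 / (s - t) = - t * (1 / s)\<^sup>2 / (1 + - t / s)"
    proof -
      have "s - t \<noteq> 0" using s assms by auto
      thus ?thesis using eig_nonzero[OF s] by (simp add: field_simps power2_eq_square)
    qed
    hence "\<bar>1 / s - 1 / (s - t)\<bar> = \<bar>t\<bar> * (1 / s)\<^sup>2 / \<bar>1 + - t / s\<bar>"
      by (simp add: abs_mult)
    also have "\<dots> \<le> \<bar>t\<bar> * (1 / s)\<^sup>2 / m"
    proof (rule divide_left_mono[OF m(2)[OF s]])
      have "\<bar>1 + - t / s\<bar> > 0" using m(1) m(2)[OF s] by linarith
      thus "0 < \<bar>1 + - t / s\<bar> * m" using m(1) by (rule mult_pos_pos)
    qed simp
    finally show "\<bar>1 / s - 1 / (s - t)\<bar> \<le> (\<bar>t\<bar> / m) * (1 / s)\<^sup>2" by (simp add: mult_ac)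
  qed auto
qed

end

section \<open>The characteristic function and its derivative\<close>

lemma tendsto_1_bounded_away:
  fixes f :: "nat \<Rightarrow> real"
  assumes "f \<longlonglongrightarrow> 1" "\<And>n. f n > 0"
  obtains c where "c > 0" "\<And>n. f n \<ge> c"
proof -
  have "eventually (\<lambda>n. f n > 1/2) sequentially"
    by (rule order_tendstoD(1)[OF assms(1)]) simp
  then obtain N where N: "\<And>n. n \<ge> N \<Longrightarrow> f n > 1/2"
    by (auto simp: eventually_sequentially)
  define c where "c = Min (insert (1/2) (f ` {..<N}))"
  have "c > 0" unfolding c_def by (subst Min_gr_iff) (auto simp: assms(2))
  moreover have "f n \<ge> c" for n
  proof (cases "n < N")
    case True
    thus ?thesis unfolding c_def by (intro Min_le) auto
  next
    case False
    have "c \<le> 1/2" unfolding c_def by (intro Min_le) auto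
    also have "\<dots> \<le> f n" using N[of n] False by simp
    finally show ?thesis .
  qed
  ultimately show thesis by (rule that)
qed

lemma inverse_mult_diff:
  fixes a b h c :: complex
  assumes "a \<noteq> 0" "b \<noteq> 0" "a - h \<noteq> 0" "b - h \<noteq> 0"
  shows "c / ((a - h) * (b - h)) - c / (a * b) = h * (c * (a + (b - h)) / (a * b * (a - h) * (b - h)))"
  using assms by (simp add: divide_simps) (simp add: algebra_simps)

context jacobi
begin

definition dom :: "complex set" where "dom = {z. \<forall>n. z \<noteq> of_real (lam n)}"

lemma dom_nonzero: "z \<in> dom \<Longrightarrow> of_real (lam n) - z \<noteq> 0"
  by (auto simp: dom_def)

definition xs :: "complex \<Rightarrow> nat \<Rightarrow> complex"
  where "xs z n = of_real ((jacobi_gamma w n)\<^sup>2) / (of_real (lam n) - z)"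

definition q :: "complex \<Rightarrow> nat \<Rightarrow> complex"
  where "q z n = of_real ((w n)\<^sup>2) / ((of_real (lam n) - z) * (of_real (lam (Suc n)) - z))"

text \<open>\<FF> sees only products of neighbours, so the weights \<open>jacobi_gamma\<close> leave
  nothing behind but the squares of w.\<close>

lemma xs_mult: "xs z n * xs z (Suc n) = q z n"
  using jacobi_gamma_mult_Suc[of w n, OF w_nonzero]
  by (simp add: xs_def q_def power_mult_distrib[symmetric] of_real_mult[symmetric] of_real_power[symmetric]
      del: of_real_mult of_real_power)

lemma char_fun_eq: "char_fun lam w z = frakF (xs z)"
  by (simp add: char_fun_def xs_def[abs_def])

lemma lam_inverse_lim: "(\<lambda>n. 1 / lam n) \<longlonglongrightarrow> 0"
  using tendsto_inverse_0_at_top[OF lam_lim] by (simp add: inverse_eq_divide)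

text \<open>The ratio of |lam_n - z| to lam_n is positive and tends to 1. Estimates at z are thereby
  reduced to the hypotheses, which concern z = 0.\<close>

lemma lam_away:
  assumes "z \<in> dom"
  obtains c where "c > 0" "\<And>n. cmod (of_real (lam n) - z) \<ge> c * lam n"
proof -
  have "(\<lambda>n. cmod (1 - z * of_real (1 / lam n))) \<longlonglongrightarrow> cmod (1 - z * of_real 0)"
    by (intro tendsto_intros lam_inverse_lim)
  hence l: "(\<lambda>n. cmod (1 - z * of_real (1 / lam n))) \<longlonglongrightarrow> 1" by simp
  have e: "cmod (1 - z * of_real (1 / lam n)) = cmod (of_real (lam n) - z) / lam n" for n
  proof -
    have "1 - z * of_real (1 / lam n) = (of_real (lam n) - z) / of_real (lam n)"
      using lam_pos[of n] by (simp add: field_simps)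
    thus ?thesis using lam_pos[of n] by (simp add: norm_divide)
  qed
  have "cmod (1 - z * of_real (1 / lam n)) > 0" for n
    unfolding e using dom_nonzero[OF assms, of n] lam_pos[of n] by (intro divide_pos_pos) auto
  then obtain c where c: "c > 0" "\<And>n. cmod (1 - z * of_real (1 / lam n)) \<ge> c"
    using tendsto_1_bounded_away[OF l] by metis
  have "cmod (of_real (lam n) - z) \<ge> c * lam n" for n
    using c(2)[of n] lam_pos[of n] unfolding e by (simp add: pos_le_divide_eq)
  thus thesis by (rule that[OF c(1)])
qed

definition W where "W n = (w n)\<^sup>2 / (lam n * lam (Suc n))"

lemma W_nonneg: "W n \<ge> 0"
  using lam_pos by (simp add: W_def less_imp_le)

lemma summable_W: "summable W"
  using w_summable by (simp add: W_def[abs_def])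

lemma norm_q_le:
  assumes "c > 0" "\<And>n. cmod (of_real (lam n) - z) \<ge> c * lam n"
  shows "cmod (q z n) \<le> W n / c\<^sup>2"
proof -
  have "(c * lam n) * (c * lam (Suc n)) \<le> cmod (of_real (lam n) - z) * cmod (of_real (lam (Suc n)) - z)"
    using assms lam_pos by (intro mult_mono) (auto simp: less_imp_le)
  moreover have "(c * lam n) * (c * lam (Suc n)) > 0" using assms(1) lam_pos by simp
  ultimately have "(w n)\<^sup>2 / (cmod (of_real (lam n) - z) * cmod (of_real (lam (Suc n)) - z))
      \<le> (w n)\<^sup>2 / ((c * lam n) * (c * lam (Suc n)))"
    by (intro divide_left_mono) (auto intro: mult_pos_pos)
  thus ?thesis by (simp add: q_def W_def norm_divide norm_mult norm_power power2_eq_square mult_ac)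
qed

lemma summable_q:
  assumes "z \<in> dom"
  shows "summable (\<lambda>n. cmod (xs z n * xs z (Suc n)))"
proof -
  obtain c where c: "c > 0" "\<And>n. cmod (of_real (lam n) - z) \<ge> c * lam n"
    using lam_away[OF assms] by metis
  show ?thesis
    unfolding xs_mult
    by (rule summable_comparison_test'[OF summable_divide[OF summable_W, of "c\<^sup>2"], of 0])
      (use norm_q_le[OF c] in simp)
qed

lemma tsum_le:
  assumes "z \<in> dom" "c > 0" "\<And>n. cmod (of_real (lam n) - z) \<ge> c * lam n"
  shows "tsum (xs z) 0 \<le> suminf W / c\<^sup>2"
proof -
  have "tsum (xs z) 0 = (\<Sum>n. cmod (q z n))"
    using tsum_def[OF summable_q[OF assms(1)], of 0] by (simp add: xs_mult)
  also have "\<dots> \<le> (\<Sum>n. W n / c\<^sup>2)"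
    by (intro suminf_le norm_q_le assms summable_divide summable_W)
      (use summable_q[OF assms(1)] in \<open>simp add: xs_mult\<close>)
  also have "\<dots> = suminf W / c\<^sup>2"
    by (rule suminf_divide[OF summable_W])
  finally show ?thesis .
qed

abbreviation "Pn z \<equiv> frakF_init (xs z)"
abbreviation "Tn z \<equiv> frakF_tail (xs z)"
abbreviation "F z \<equiv> frakF (xs z)"

lemma Pn_continuous: "z0 \<in> dom \<Longrightarrow> ((\<lambda>z. Pn z n) \<longlongrightarrow> Pn z0 n) (at z0)"
proof (induction "xs z0" n rule: frakF_init.induct)
  case (3 n)
  have "((\<lambda>z. xs z n) \<longlongrightarrow> xs z0 n) (at z0)" for n
    unfolding xs_def using 3(3) by (intro tendsto_intros) (auto simp: dom_def)
  thus ?case unfolding frakF_init.simps using 3 by (intro tendsto_intros) auto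
qed auto

text \<open>The product of P_n and T_(n+1) collects the tuples that do not touch the entry n; the
  remaining ones use the pair (n, n + 1) or the pair (n - 1, n). This is the bridge between the
  derivative of F and the diagonal of the Green function.\<close>

lemma frakF_split_diag:
  assumes "z \<in> dom"
  shows "F z - Pn z n * Tn z (Suc n) =
    - q z n * Pn z n * Tn z (Suc (Suc n)) +
    (case n of 0 \<Rightarrow> 0 | Suc m \<Rightarrow> - q z m * Pn z m * Tn z (Suc (Suc m)))"
proof (cases n)
  case 0
  show ?thesis
    unfolding frakF_split[OF summable_q[OF assms], of 0, symmetric] by (simp add: 0 xs_mult)
next
  case (Suc m)
  show ?thesis
    using frakF_split[OF summable_q[OF assms], of m] frakF_tail_rec[OF summable_q[OF assms], of "Suc m"]
    unfolding Suc xs_mult by (simp add: xs_mult algebra_simps)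
qed

text \<open>The left-hand side bounds the difference quotient of q. Splitting the numerator cancels
  one of the four factors in each part; two of the remaining three give the summable W, and the
  third is at least c \<delta>.\<close>

lemma norm_q_diff_le:
  assumes c: "c > 0" and \<delta>: "\<delta> > 0" "\<And>n. lam n \<ge> \<delta>"
    and z: "\<And>n. cmod (of_real (lam n) - z) \<ge> c * lam n" and z0: "\<And>n. cmod (of_real (lam n) - z0) \<ge> c * lam n"
  shows "cmod ((of_real (w n))\<^sup>2 * ((of_real (lam n) - z0) + (of_real (lam (Suc n)) - z)) /
      ((of_real (lam n) - z0) * (of_real (lam (Suc n)) - z0) * (of_real (lam n) - z) * (of_real (lam (Suc n)) - z)))
    \<le> W n * (2 / (c ^ 3 * \<delta>))"
proof -
  let ?a = "complex_of_real (lam n) - z0" and ?b = "complex_of_real (lam (Suc n)) - z0"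
    and ?a' = "complex_of_real (lam n) - z" and ?b' = "complex_of_real (lam (Suc n)) - z"
  have cl: "c * lam m > 0" for m using c lam_pos by simp
  have nz: "?a \<noteq> 0" "?b \<noteq> 0" "?a' \<noteq> 0" "?b' \<noteq> 0"
    using cl[of n] cl[of "Suc n"] z[of n] z[of "Suc n"] z0[of n] z0[of "Suc n"] by force+
  have b1: "1 / (cmod u * cmod v * cmod u') \<le> 1 / (c ^ 3 * \<delta>) / (lam n * lam (Suc n))"
    if "cmod u \<ge> c * lam n" "cmod v \<ge> c * lam (Suc n)" "cmod u' \<ge> c * \<delta>" for u v u' :: complex
  proof -
    have "(c * lam n) * (c * lam (Suc n)) * (c * \<delta>) \<le> cmod u * cmod v * cmod u'"
      using that cl[of n] cl[of "Suc n"] c \<delta>(1) by (intro mult_mono) (auto simp: less_imp_le)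
    moreover have "(c * lam n) * (c * lam (Suc n)) * (c * \<delta>) > 0"
      using cl c \<delta>(1) by simp
    ultimately have "1 / (cmod u * cmod v * cmod u') \<le> 1 / ((c * lam n) * (c * lam (Suc n)) * (c * \<delta>))"
      by (intro frac_le) auto
    thus ?thesis by (simp add: power3_eq_cube mult_ac)
  qed
  have cd: "c * \<delta> \<le> c * lam m" for m using c \<delta>(2)[of m] by simp
  have "(of_real (w n))\<^sup>2 * (?a + ?b') / (?a * ?b * ?a' * ?b') =
      (of_real (w n))\<^sup>2 * (1 / (?a' * ?b * ?b') + 1 / (?a * ?b * ?a'))"
    using nz by (simp add: divide_simps)
  also have "cmod \<dots> \<le> (w n)\<^sup>2 * (1 / (cmod ?a' * cmod ?b * cmod ?b') + 1 / (cmod ?a * cmod ?b * cmod ?a'))"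
    unfolding norm_mult[of "(of_real (w n))\<^sup>2"]
    using norm_triangle_ineq[of "1 / (?a' * ?b * ?b')" "1 / (?a * ?b * ?a')"]
    by (simp add: norm_power norm_divide norm_mult mult_left_mono)
  also have "\<dots> \<le> (w n)\<^sup>2 * (1 / (c ^ 3 * \<delta>) / (lam n * lam (Suc n)) + 1 / (c ^ 3 * \<delta>) / (lam n * lam (Suc n)))"
    by (intro mult_left_mono add_mono b1 z z0 order_trans[OF cd z]) auto
  also have "\<dots> = W n * (2 / (c ^ 3 * \<delta>))"
    by (simp add: W_def field_simps)
  finally show ?thesis .
qed

text \<open>\<open>frakF_diff_sums\<close> writes the difference quotient as a series to which
  Tannery's theorem applies. The derivative of q_n is q_n times the sum of 1/(lam_n - z) and
  1/(lam_(n+1) - z); regrouping by the diagonal entry gives the second conclusion through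
  \<open>frakF_split_diag\<close>.\<close>

lemma char_fun_derivative:
  assumes z0: "z0 \<in> dom"
  obtains D where "((\<lambda>z. F z) has_field_derivative D) (at z0)"
    "(\<lambda>n. (F z0 - Pn z0 n * Tn z0 (Suc n)) / (of_real (lam n) - z0)) sums D"
proof -
  obtain c0 where c0: "c0 > 0" "\<And>n. cmod (of_real (lam n) - z0) \<ge> c0 * lam n"
    using lam_away[OF z0] by metis
  obtain \<delta> where \<delta>: "\<delta> > 0" "\<And>n. lam n \<ge> \<delta>" using lam_lower by metis
  \<comment> \<open>With this radius |z - z0| is at most half of c0 lam_n for every n, so half of c0
    works uniformly on the ball.\<close>
  define c r where "c = c0 / 2" and "r = c0 * \<delta> / 2"
  have c: "c > 0" and r: "r > 0" using c0 \<delta> by (simp_all add: c_def r_def)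
  have near: "cmod (of_real (lam n) - z) \<ge> c * lam n" if "z \<in> ball z0 r" for z n
  proof -
    have "c0 * lam n \<le> cmod (of_real (lam n) - z0)" by (rule c0)
    also have "\<dots> \<le> cmod (of_real (lam n) - z) + cmod (z - z0)"
      using norm_triangle_ineq[of "of_real (lam n) - z" "z - z0"] by simp
    also have "cmod (z - z0) \<le> c0 * lam n / 2"
    proof -
      have "cmod (z - z0) \<le> r" using that by (simp add: dist_norm norm_minus_commute)
      also have "r \<le> c0 * lam n / 2" unfolding r_def using c0 \<delta>(2)[of n] by simp
      finally show ?thesis .
    qed
    finally show ?thesis by (simp add: c_def)
  qed
  have dom: "z \<in> dom" if "z \<in> ball z0 r" for z
  proof -
    have "cmod (of_real (lam n) - z) > 0" for n
      using near[OF that, of n] c lam_pos[of n] mult_pos_pos[OF c lam_pos[of n]] by linarith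
    thus ?thesis by (force simp: dom_def)
  qed
  define M where "M = exp (suminf W / c\<^sup>2)"
  have PM: "cmod (Pn z n) \<le> M" and TM: "cmod (Tn z n) \<le> M" if "z \<in> ball z0 r" for z n
  proof -
    have "exp (tsum (xs z) 0) \<le> M"
      unfolding M_def using tsum_le[OF dom[OF that] c near[OF that]] by simp
    thus "cmod (Pn z n) \<le> M" "cmod (Tn z n) \<le> M"
      using norm_frakF_init_le[OF summable_q[OF dom[OF that]], of n]
        norm_frakF_tail_le[OF summable_q[OF dom[OF that]], of n] by linarith+
  qed
  have z0b: "z0 \<in> ball z0 r" using r by simp
  define dq where "dq z n = (of_real (w n))\<^sup>2 * ((of_real (lam n) - z0) + (of_real (lam (Suc n)) - z)) /
      ((of_real (lam n) - z0) * (of_real (lam (Suc n)) - z0) * (of_real (lam n) - z) * (of_real (lam (Suc n)) - z))"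
    for z n
  have dq: "q z n - q z0 n = (z - z0) * dq z n" if "z \<in> ball z0 r" for z n
    using inverse_mult_diff[of "of_real (lam n) - z0" "of_real (lam (Suc n)) - z0" "z - z0" "(of_real (w n))\<^sup>2"]
      dom_nonzero[OF dom[OF that]] dom_nonzero[OF z0] unfolding q_def dq_def by simp
  have dqM: "cmod (dq z n) \<le> W n * (2 / (c ^ 3 * \<delta>))" if "z \<in> ball z0 r" for z n
    unfolding dq_def by (rule norm_q_diff_le[OF c \<delta> near[OF that] near[OF z0b]])
  have dq0: "dq z0 n = q z0 n / (of_real (lam n) - z0) + q z0 n / (of_real (lam (Suc n)) - z0)" for n
    using dom_nonzero[OF z0, of n] dom_nonzero[OF z0, of "Suc n"] unfolding q_def dq_def
    by (simp add: divide_simps) (simp add: algebra_simps)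
  let ?a = "\<lambda>n z. - Pn z n * dq z n * Tn z0 (Suc (Suc n))"
  have ab: "cmod (?a n z) \<le> M * (W n * (2 / (c ^ 3 * \<delta>))) * M" if "z \<in> ball z0 r" for n z
    unfolding norm_mult norm_minus_cancel
    using W_nonneg[of n] c \<delta>
    by (intro mult_mono PM TM dqM that z0b mult_nonneg_nonneg) (auto simp: M_def)
  have sumM: "summable (\<lambda>n. M * (W n * (2 / (c ^ 3 * \<delta>))) * M)"
    by (intro summable_mult summable_mult2 summable_W)
  have lim: "((\<lambda>z. \<Sum>n. ?a n z) \<longlongrightarrow> (\<Sum>n. ?a n z0)) (at z0)"
  proof (rule tannerys_theorem[THEN conjunct2, THEN conjunct2])
    show "((\<lambda>z. ?a n z) \<longlongrightarrow> ?a n z0) (at z0)" for n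
      unfolding dq_def using z0
      by (intro tendsto_intros Pn_continuous) (auto simp: dom_def)
    have "\<forall>\<^sub>F z in at z0. z \<in> ball z0 r"
      using eventually_at_ball[OF r, of z0 UNIV] by simp
    hence "\<forall>\<^sub>F (n::nat, z) in at_top \<times>\<^sub>F at z0. z \<in> ball z0 r"
      by (subst eventually_prod2) auto
    thus "\<forall>\<^sub>F (n, z) in at_top \<times>\<^sub>F at z0. norm (?a n z) \<le> M * (W n * (2 / (c ^ 3 * \<delta>))) * M"
      by (rule eventually_mono) (use ab in auto)
  qed (use sumM in auto)
  have diff: "(\<Sum>n. ?a n z) = (F z - F z0) / (z - z0)" if "z \<in> ball z0 r" "z \<noteq> z0" for z
  proof -
    have "(\<lambda>n. - Pn z n * (xs z n * xs z (Suc n) - xs z0 n * xs z0 (Suc n)) * Tn z0 (Suc (Suc n)))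
        sums (F z - F z0)"
      by (rule frakF_diff_sums[OF summable_q[OF dom[OF that(1)]] summable_q[OF z0]])
    hence "(\<lambda>n. (z - z0) * ?a n z) sums (F z - F z0)"
      by (simp add: xs_mult dq[OF that(1)] mult_ac)
    from sums_divide[OF this, of "z - z0"] show ?thesis
      using that(2) by (simp add: sums_iff)
  qed
  have "((\<lambda>z. (F z - F z0) / (z - z0)) \<longlongrightarrow> (\<Sum>n. ?a n z0)) (at z0)"
  proof (rule Lim_transform_eventually[OF lim])
    have "\<forall>\<^sub>F z in at z0. z \<in> ball z0 r \<and> z \<noteq> z0"
      using eventually_at_ball[OF r, of z0 UNIV] eventually_neq_at_within[of z0 z0 UNIV]
      by eventually_elim auto
    thus "\<forall>\<^sub>F z in at z0. (\<Sum>n. ?a n z) = (F z - F z0) / (z - z0)"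
      by eventually_elim (use diff in auto)
  qed
  hence der: "((\<lambda>z. F z) has_field_derivative (\<Sum>n. ?a n z0)) (at z0)"
    by (simp add: has_field_derivative_iff)
  define u where "u n = - q z0 n * Pn z0 n * Tn z0 (Suc (Suc n))" for n
  have un: "cmod (u n) \<le> W n / c\<^sup>2 * M * M" for n
    unfolding u_def norm_mult norm_minus_cancel using W_nonneg[of n] c
    by (intro mult_mono norm_q_le[OF c near[OF z0b]] PM TM z0b mult_nonneg_nonneg) (auto simp: M_def)
  have su: "summable (\<lambda>n. u n / (of_real (lam (f n)) - z0))" for f :: "nat \<Rightarrow> nat"
  proof (rule summable_comparison_test'[where N = 0])
    show "summable (\<lambda>n. W n / c\<^sup>2 * M * M / (c * \<delta>))"
      by (intro summable_divide summable_mult2 summable_W)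
    fix n
    have "c * \<delta> \<le> c * lam (f n)" using c \<delta>(2) by simp
    also have "\<dots> \<le> cmod (of_real (lam (f n)) - z0)" by (rule near[OF z0b])
    finally show "norm (u n / (of_real (lam (f n)) - z0)) \<le> W n / c\<^sup>2 * M * M / (c * \<delta>)"
      unfolding norm_divide using un[of n] c \<delta>(1) W_nonneg[of n] by (intro frac_le) (auto simp: M_def)
  qed
  let ?s1 = "\<Sum>n. u n / (of_real (lam n) - z0)" and ?s2 = "\<Sum>n. u n / (of_real (lam (Suc n)) - z0)"
  have s1: "(\<lambda>n. u n / (of_real (lam n) - z0)) sums ?s1"
    using su[of "\<lambda>n. n"] by (rule summable_sums)
  have s2: "(\<lambda>n. u n / (of_real (lam (Suc n)) - z0)) sums ?s2"
    using su[of Suc] by (rule summable_sums)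
  \<comment> \<open>The second series is shifted by one, so that both contributions with denominator
    lam_n - z0 meet; entry 0 has no left neighbour and receives one only.\<close>
  let ?v = "\<lambda>n. case n of 0 \<Rightarrow> 0 | Suc m \<Rightarrow> u m / (of_real (lam (Suc m)) - z0)"
  have "(\<lambda>n. ?v (Suc n)) sums ?s2" using s2 by simp
  hence s2': "?v sums ?s2" by (subst (asm) sums_Suc_iff) simp
  have "(\<lambda>n. u n / (of_real (lam n) - z0) + ?v n) sums (?s1 + ?s2)"
    by (rule sums_add[OF s1 s2'])
  moreover have "u n / (of_real (lam n) - z0) + ?v n =
      (F z0 - Pn z0 n * Tn z0 (Suc n)) / (of_real (lam n) - z0)" for n
    unfolding frakF_split_diag[OF z0] u_def by (cases n) (simp_all add: add_divide_distrib diff_divide_distrib)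
  moreover have "?s1 + ?s2 = (\<Sum>n. ?a n z0)"
  proof -
    have "?a n z0 = u n / (of_real (lam n) - z0) + u n / (of_real (lam (Suc n)) - z0)" for n
      unfolding dq0 u_def by (simp add: algebra_simps)
    thus ?thesis using sums_add[OF s1 s2] by (simp add: sums_iff)
  qed
  ultimately show thesis using that[OF der] by simp
qed

section \<open>The Green function\<close>

lemma zero_in_dom: "0 \<in> dom"
  using lam_pos by (auto simp: dom_def less_le)

text \<open>
  \<open>psi\<close> is the solution regular at the left end and \<open>phi\<close> the one that is square-summable at
  infinity.
\<close>

definition cp :: "nat \<Rightarrow> real" where "cp m = (\<Prod>j<m. - w j / lam j)"
definition phi :: "nat \<Rightarrow> complex" where "phi m = of_real (cp m / lam m) * Tn 0 (Suc m)"
definition psi :: "nat \<Rightarrow> complex" where "psi m = Pn 0 m / of_real (cp m)"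

lemma cp_nonzero: "cp m \<noteq> 0"
proof -
  have "- w j / lam j \<noteq> 0" for j using w_nonzero[of j] lam_pos[of j] by simp
  thus ?thesis unfolding cp_def by (subst prod_zero_iff) auto
qed

lemma cp_Suc: "w m * cp m = - lam m * cp (Suc m)"
  using lam_pos[of m] by (simp add: cp_def)

lemma q_0: "q 0 m = of_real (W m)"
  by (simp add: q_def W_def)

lemma lam_phi: "of_real (lam m) * phi m = of_real (cp m) * Tn 0 (Suc m)"
  using lam_pos[of m] by (simp add: phi_def)

lemma w_phi: "of_real (w m) * phi m = - of_real (cp (Suc m)) * Tn 0 (Suc m)"
proof -
  have "w m * (cp m / lam m) = - cp (Suc m)" using cp_Suc[of m] lam_pos[of m] by (simp add: field_simps)
  hence "of_real (w m) * of_real (cp m / lam m) = - complex_of_real (cp (Suc m))"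
    by (metis of_real_minus of_real_mult)
  thus ?thesis by (simp only: phi_def mult.assoc[symmetric])
qed

lemma w_phi_Suc: "of_real (w m) * phi (Suc m) = - of_real (cp m) * q 0 m * Tn 0 (Suc (Suc m))"
proof -
  have "w m * (cp (Suc m) / lam (Suc m)) = - cp m * W m"
    using lam_pos[of m] lam_pos[of "Suc m"] by (simp add: cp_def W_def field_simps power2_eq_square)
  hence "of_real (w m) * of_real (cp (Suc m) / lam (Suc m)) = - complex_of_real (cp m) * of_real (W m)"
    by (metis of_real_minus of_real_mult)
  thus ?thesis by (simp only: phi_def mult.assoc[symmetric] q_0)
qed

lemma w_psi_Suc: "of_real (w m) * psi (Suc m) = - of_real (lam m) * Pn 0 (Suc m) / of_real (cp m)"
proof -
  have "w m / cp (Suc m) = - lam m / cp m"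
    using cp_Suc[of m] cp_nonzero[of m] cp_nonzero[of "Suc m"] by (simp add: field_simps)
  hence "of_real (w m) / of_real (cp (Suc m)) = - complex_of_real (lam m) / of_real (cp m)"
    by (metis of_real_minus of_real_divide)
  thus ?thesis unfolding psi_def by (metis (no_types, lifting) times_divide_eq_left times_divide_eq_right mult.commute)
qed

lemma w_psi: "of_real (w m) * psi m = - of_real (lam (Suc m)) * q 0 m * Pn 0 m / of_real (cp (Suc m))"
proof -
  have "w m / cp m = - lam (Suc m) * W m / cp (Suc m)"
    using cp_Suc[of m] cp_nonzero[of m] cp_nonzero[of "Suc m"] lam_pos[of m] lam_pos[of "Suc m"] w_nonzero[of m]
    by (simp add: W_def cp_def field_simps power2_eq_square)
  hence "of_real (w m) / of_real (cp m) = - complex_of_real (lam (Suc m)) * of_real (W m) / of_real (cp (Suc m))"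
    by (metis of_real_minus of_real_divide of_real_mult)
  thus ?thesis unfolding psi_def q_0
    by (metis (no_types, lifting) times_divide_eq_left times_divide_eq_right mult.commute)
qed

text \<open>The prefactor \<open>cp m / lam m\<close> turns the tail recurrence of \<FF> into the
  Jacobi equation. Row 0 is excluded: there the left-hand side equals \<open>F 0\<close>.\<close>

lemma japp_phi: "japp lam w phi (Suc m) = 0"
proof -
  have "Tn 0 (Suc m) = Tn 0 (Suc (Suc m)) - q 0 (Suc m) * Tn 0 (Suc (Suc (Suc m)))"
    using frakF_tail_rec[OF summable_q[OF zero_in_dom], of "Suc m"] by (simp only: xs_mult)
  thus ?thesis
    by (simp add: japp_def scaleR_conv_of_real lam_phi w_phi w_phi_Suc right_diff_distrib)
qed

lemma japp_psi: "japp lam w psi m = 0"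
proof (cases m)
  case 0
  show ?thesis
    by (simp add: 0 japp_def scaleR_conv_of_real w_psi_Suc) (simp add: psi_def)
next
  case (Suc k)
  show ?thesis
    by (simp add: Suc japp_def scaleR_conv_of_real w_psi_Suc w_psi xs_mult)
      (simp add: psi_def xs_mult algebra_simps diff_divide_distrib add_divide_distrib)
qed

text \<open>Not divided by the Wronskian of \<open>psi\<close> and \<open>phi\<close>, which is
  \<open>F 0\<close>. Thus it still makes sense when \<open>F 0\<close> vanishes, and can be used to
  refute that case.\<close>

definition green :: "nat \<Rightarrow> nat \<Rightarrow> complex"
  where "green n m = (if m \<le> n then psi m * phi n else psi n * phi m)"

lemma green_diag: "green n n = Pn 0 n * Tn 0 (Suc n) / of_real (lam n)"
  using cp_nonzero[of n] by (simp add: green_def psi_def phi_def)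

lemma japp_green: "japp lam w (green n) m = (if m = n then F 0 else 0)"
proof -
  consider "m < n" | "m = n" | "m > n" by linarith
  thus ?thesis
  proof cases
    case 1
    hence "japp lam w (green n) m = phi n * japp lam w psi m"
      by (cases m) (auto simp: japp_def green_def scaleR_conv_of_real algebra_simps)
    thus ?thesis using 1 by (simp add: japp_psi)
  next
    case 3
    then obtain k where k: "m = Suc k" "k \<ge> n" by (cases m) auto
    have "japp lam w (green n) m = psi n * japp lam w phi m"
      using k by (auto simp: japp_def green_def scaleR_conv_of_real algebra_simps)
    thus ?thesis using 3 k by (simp add: japp_phi)
  next
    case 2
    have "of_real (lam n) * (psi n * phi n) = Pn 0 n * Tn 0 (Suc n)"
      using cp_nonzero[of n] lam_pos[of n] by (simp add: psi_def phi_def)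
    moreover have "of_real (w n) * (psi n * phi (Suc n)) = - q 0 n * Pn 0 n * Tn 0 (Suc (Suc n))"
    proof -
      have "of_real (w n) * (psi n * phi (Suc n)) = psi n * (of_real (w n) * phi (Suc n))" by simp
      thus ?thesis unfolding w_phi_Suc using cp_nonzero[of n] by (simp add: psi_def)
    qed
    moreover have "of_real (w k) * (psi k * phi (Suc k)) = - q 0 k * Pn 0 k * Tn 0 (Suc (Suc k))" for k
    proof -
      have "of_real (w k) * (psi k * phi (Suc k)) = (of_real (w k) * phi (Suc k)) * psi k" by simp
      thus ?thesis unfolding w_phi_Suc using cp_nonzero[of k] by (simp add: psi_def)
    qed
    ultimately show ?thesis
      using 2 frakF_split_diag[OF zero_in_dom, of n]
      by (cases n) (simp_all add: japp_def green_def scaleR_conv_of_real algebra_simps)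
  qed
qed

text \<open>Expresses \<open>cp\<close> through products of W. As W tends to 0, these decay fast
  enough to make \<open>phi\<close> square-summable.\<close>

lemma cp_power2: "(cp m)\<^sup>2 * lam 0 = (\<Prod>j<m. W j) * lam m"
proof (induction m)
  case (Suc m)
  have "(cp (Suc m))\<^sup>2 * lam 0 = (w m)\<^sup>2 / (lam m)\<^sup>2 * ((cp m)\<^sup>2 * lam 0)"
    by (simp add: cp_def power_mult_distrib power_divide)
  also have "\<dots> = (\<Prod>j<Suc m. W j) * lam (Suc m)"
    unfolding Suc using lam_pos[of m] lam_pos[of "Suc m"] by (simp add: W_def power2_eq_square)
  finally show ?case .
qed (simp add: cp_def)

lemma summable_prod_W: "summable (\<lambda>m. \<Prod>j<m. W j)"
proof -
  have "eventually (\<lambda>n. W n < 1/2) sequentially"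
    by (rule order_tendstoD(2)[OF summable_LIMSEQ_zero[OF summable_W]]) simp
  then obtain N where N: "\<And>n. n \<ge> N \<Longrightarrow> W n < 1/2" by (auto simp: eventually_sequentially)
  show ?thesis
  proof (rule summable_ratio_test[where c = "1/2" and N = N])
    fix n assume "n \<ge> N"
    have "0 \<le> (\<Prod>j<n. W j)" by (intro prod_nonneg) (auto simp: W_nonneg)
    thus "norm (\<Prod>j<Suc n. W j) \<le> 1/2 * norm (\<Prod>j<n. W j)"
      using mult_right_mono[of "W n" "1/2" "\<Prod>j<n. W j"] N[OF \<open>n \<ge> N\<close>] W_nonneg[of n]
      by (simp add: abs_mult mult.commute)
  qed simp
qed

lemma summable_phi: "summable (\<lambda>m. (cmod (phi m))\<^sup>2)"
proof -
  obtain \<delta> where \<delta>: "\<delta> > 0" "\<And>n. lam n \<ge> \<delta>" using lam_lower by metis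
  let ?E = "exp (tsum (xs 0) 0)"
  show ?thesis
  proof (rule summable_comparison_test'[where N = 0])
    show "summable (\<lambda>m. (\<Prod>j<m. W j) * (?E\<^sup>2 / (\<delta> * lam 0)))"
      by (intro summable_mult2 summable_prod_W)
    fix m
    have p: "0 \<le> (\<Prod>j<m. W j)" by (intro prod_nonneg) (auto simp: W_nonneg)
    have "(cp m / lam m)\<^sup>2 = (cp m)\<^sup>2 * lam 0 / ((lam m)\<^sup>2 * lam 0)"
      using lam_pos[of 0] by (simp add: power_divide)
    also have "\<dots> = (\<Prod>j<m. W j) * (1 / (lam m * lam 0))"
      unfolding cp_power2 using lam_pos[of m] by (simp add: power2_eq_square)
    also have "\<dots> \<le> (\<Prod>j<m. W j) * (1 / (\<delta> * lam 0))"
      using \<delta> lam_pos[of 0] lam_pos[of m] by (intro mult_left_mono p frac_le) auto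
    finally have 1: "(cp m / lam m)\<^sup>2 \<le> (\<Prod>j<m. W j) * (1 / (\<delta> * lam 0))" .
    have "(cmod (phi m))\<^sup>2 = (cp m / lam m)\<^sup>2 * (cmod (Tn 0 (Suc m)))\<^sup>2"
      by (simp only: phi_def norm_mult norm_of_real power_mult_distrib power2_abs)
    also have "\<dots> \<le> ((\<Prod>j<m. W j) * (1 / (\<delta> * lam 0))) * ?E\<^sup>2"
      using p \<delta>(1) lam_pos[of 0]
      by (intro mult_mono 1 power_mono norm_frakF_tail_le[OF summable_q[OF zero_in_dom]]) auto
    finally show "norm ((cmod (phi m))\<^sup>2) \<le> (\<Prod>j<m. W j) * (?E\<^sup>2 / (\<delta> * lam 0))"
      by (simp add: mult_ac)
  qed
qed

lemma green_in_ell2: "green n \<in> ell2"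
proof -
  have "summable (\<lambda>m. (cmod (psi n * phi m))\<^sup>2)"
    using summable_phi by (simp add: norm_mult power_mult_distrib summable_mult)
  moreover have "eventually (\<lambda>m. (cmod (green n m))\<^sup>2 = (cmod (psi n * phi m))\<^sup>2) sequentially"
    using eventually_gt_at_top[of n] by eventually_elim (simp add: green_def)
  ultimately show ?thesis
    unfolding ell2_def using summable_cong by fast
qed

lemma green_0_nonzero: "green 0 \<noteq> (\<lambda>_. 0)"
proof
  assume *: "green 0 = (\<lambda>_. 0)"
  have phi0: "phi m = 0" for m
    using fun_cong[OF *, of m] by (simp add: green_def psi_def cp_def split: if_splits)
  have "Tn 0 (Suc m) = 0" for m
    using phi0[of m] cp_nonzero[of m] lam_pos[of m] by (auto simp: phi_def)
  hence "(\<lambda>m. Tn 0 (Suc m)) \<longlonglongrightarrow> 0" by simp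
  moreover have "(\<lambda>m. Tn 0 (Suc m)) \<longlonglongrightarrow> 1"
    by (rule LIMSEQ_Suc[OF frakF_tail_tendsto_1[OF summable_q[OF zero_in_dom]]])
  ultimately show False using LIMSEQ_unique by fastforce
qed

text \<open>Allows everything proved at the point 0 to be applied at t by passing to the matrix J -
  t.\<close>

lemma jacobi_shift:
  assumes "\<And>n. t < lam n"
  shows "jacobi (\<lambda>n. lam n - t) w"
proof -
  have tdom: "of_real t \<in> dom" using assms by (auto simp: dom_def)
  obtain c where c: "c > 0" "\<And>n. cmod (of_real (lam n) - of_real t) \<ge> c * lam n"
    using lam_away[OF tdom] by metis
  have ge: "lam n - t \<ge> c * lam n" for n
    using c(2)[of n] assms[of n] by (simp flip: of_real_diff)
  show ?thesis
  proof
    show "0 < lam n - t" for n using assms by simp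
    show "w n \<noteq> 0" for n by (rule w_nonzero)
    show "filterlim (\<lambda>n. lam n - t) at_top sequentially"
      using filterlim_tendsto_add_at_top[OF tendsto_const lam_lim, of "-t"] by simp
    show "summable (\<lambda>n. (w n)\<^sup>2 / ((lam n - t) * (lam (Suc n) - t)))"
    proof (rule summable_comparison_test'[OF summable_divide[OF summable_W, of "c\<^sup>2"], of 0])
      fix n
      have e: "cmod (q (of_real t) n) = (w n)\<^sup>2 / ((lam n - t) * (lam (Suc n) - t))"
        using assms[of n] assms[of "Suc n"]
        by (simp add: q_def norm_divide norm_mult norm_power flip: of_real_diff)
      show "norm ((w n)\<^sup>2 / ((lam n - t) * (lam (Suc n) - t))) \<le> W n / c\<^sup>2"
        unfolding e[symmetric] using norm_q_le[OF c, of n] by simp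
    qed
    show "summable (\<lambda>n. 1 / (lam n - t)\<^sup>2)"
    proof (rule summable_comparison_test'[OF summable_divide[OF lam_summable, of "c\<^sup>2"], of 0])
      fix n
      have "c * lam n > 0" using c lam_pos by simp
      hence "(c * lam n)\<^sup>2 \<le> (lam n - t)\<^sup>2" "(c * lam n)\<^sup>2 > 0"
        using ge[of n] by (auto intro: power_mono simp del: power_mult_distrib)
      hence "1 / (lam n - t)\<^sup>2 \<le> 1 / (c * lam n)\<^sup>2" by (intro frac_le) auto
      thus "norm (1 / (lam n - t)\<^sup>2) \<le> 1 / (lam n)\<^sup>2 / c\<^sup>2"
        by (simp add: power_mult_distrib mult.commute)
    qed
  qed
qed

end

section \<open>Canonical products of genus one\<close>

locale genus_one =
  fixes \<mu> :: "nat \<Rightarrow> real"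
  assumes nonzero: "\<And>n. \<mu> n \<noteq> 0" and summable: "summable (\<lambda>n. 1 / (\<mu> n)\<^sup>2)"
begin

lemma inverse_lim: "(\<lambda>n. 1 / \<mu> n) \<longlonglongrightarrow> 0"
  by (rule summable_power2_imp_LIMSEQ) (use summable in \<open>simp add: power_divide\<close>)

text \<open>The constant exponent 1 is admissible because the inverse squares are summable;
  holomorphy, zeros and locally uniform convergence of \<open>Phi\<close> follow.\<close>

sublocale weierstrass_product "\<lambda>n. complex_of_real (\<mu> n)" "\<lambda>_. 1"
proof
  show "complex_of_real (\<mu> n) \<noteq> 0" for n using nonzero by simp
  have "(\<lambda>n. complex_of_real (1 / \<mu> n)) \<longlonglongrightarrow> of_real 0"
    by (rule tendsto_of_real[OF inverse_lim])
  hence "filterlim (\<lambda>n. inverse (complex_of_real (\<mu> n))) (at 0) sequentially"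
    using nonzero by (simp add: filterlim_at inverse_eq_divide)
  thus "filterlim (\<lambda>n. complex_of_real (\<mu> n)) at_infinity sequentially"
    by (simp only: filterlim_inverse_at_iff)
  show "summable (\<lambda>n. (r / cmod (complex_of_real (\<mu> n))) ^ Suc 1)" for r :: real
    using summable_mult[OF summable, of "r\<^sup>2"] by (simp add: power2_eq_square)
qed

lemma weierstrass_factor_1_eq: "weierstrass_factor 1 x = (1 - x) * exp x"
  by (simp add: weierstrass_factor_def)

lemma Phi_eq: "Phi \<mu> = f"
  unfolding fun_eq_iff Phi_def f_def weierstrass_factor_1_eq by simp

lemma convergent_Phi:
  "convergent_prod (\<lambda>n. (1 - z / complex_of_real (\<mu> n)) * exp (z / complex_of_real (\<mu> n)))"
  using convergent[of z] unfolding weierstrass_factor_1_eq .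

lemma Phi_holomorphic: "Phi \<mu> holomorphic_on A"
  unfolding Phi_eq by (rule holomorphic)

lemma Phi_0: "Phi \<mu> 0 = 1"
  by (simp add: Phi_def)

lemma Phi_eq_0_iff: "Phi \<mu> z = 0 \<longleftrightarrow> z \<in> range (\<lambda>n. of_real (\<mu> n))"
  unfolding Phi_eq by (rule zero)

lemma Phi_logderiv:
  assumes "Phi \<mu> z \<noteq> 0"
  shows "(\<lambda>n. 1 / of_real (\<mu> n) - 1 / (of_real (\<mu> n) - z)) sums (deriv (Phi \<mu>) z / Phi \<mu> z)"
proof -
  let ?g = "\<lambda>n z. weierstrass_factor 1 (z / of_real (\<mu> n))"
  have "(\<lambda>n. deriv (?g n) z / ?g n z) sums (deriv f z / f z)"
  proof (rule logderiv_prodinf_complex_uniform_limit)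
    show "uniform_limit (ball 0 (norm z + 1)) (\<lambda>N z. \<Prod>n<N. ?g n z) f sequentially"
      by (rule uniform_limit_on_subset[OF uniform_limit[of "norm z + 1"]])
        (auto intro: add_nonneg_pos)
    show "?g n holomorphic_on ball 0 (norm z + 1)" for n
      by (intro holomorphic_intros) (use nonzero in auto)
  qed (use assms in \<open>auto simp: Phi_eq\<close>)
  moreover have "deriv (?g n) z / ?g n z = 1 / of_real (\<mu> n) - 1 / (of_real (\<mu> n) - z)" for n
  proof -
    let ?m = "complex_of_real (\<mu> n)"
    have m: "?m \<noteq> 0" "?m - z \<noteq> 0"
      using nonzero[of n] assms by (auto simp: Phi_eq_0_iff)
    have "((\<lambda>z. (1 - z / ?m) * exp (z / ?m)) has_field_derivative
        - (1 / ?m) * exp (z / ?m) + (1 - z / ?m) * (exp (z / ?m) * (1 / ?m))) (at z)"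
      using nonzero[of n] by (auto intro!: derivative_eq_intros)
    hence "deriv (?g n) z = - (1 / ?m) * exp (z / ?m) + (1 - z / ?m) * (exp (z / ?m) * (1 / ?m))"
      unfolding weierstrass_factor_1_eq by (rule DERIV_imp_deriv)
    also have "\<dots> = exp (z / ?m) * (- 1 / ?m + (1 - z / ?m) / ?m)"
      by (simp add: field_simps)
    finally have "deriv (?g n) z / ?g n z = (- 1 / ?m + (1 - z / ?m) / ?m) / (1 - z / ?m)"
      by (simp add: weierstrass_factor_1_eq[unfolded One_nat_def])
    also have "\<dots> = 1 / ?m - 1 / (?m - z)"
      using m by (simp add: divide_simps)
    finally show ?thesis .
  qed
  ultimately show ?thesis by (simp only: Phi_eq)
qed

end

section \<open>The logarithmic derivative as a trace\<close>

lemma (in jacobi) genus_one_lam: "genus_one lam"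
  by standard (use lam_summable lam_pos in \<open>auto simp: less_le\<close>)

context jacobi_invertible
begin

lemma not_eig_imp_zero:
  assumes "t \<notin> eig" "\<And>n. japp lam w (coord v) n = t * coord v n"
  shows "v = 0"
  using assms unfolding eig_def by blast

definition resolvent_diag :: "real \<Rightarrow> nat \<Rightarrow> real"
  where "resolvent_diag t n = infsum (\<lambda>s. (coord (ev s) n)\<^sup>2 / (s - t)) eig"

text \<open>
  The Green function of \<open>J - t\<close>, the values of \<open>\<FF>\<close> at the shifted diagonal, and the expansion in
  eigenvectors describe the same resolvent.
\<close>

lemma resolvent_diag:
  assumes t: "\<And>n. t < lam n" "t \<notin> eig"
  shows "F (of_real t) \<noteq> 0"
    and "((\<lambda>s. (coord (ev s) n)\<^sup>2 / (s - t)) has_sum resolvent_diag t n) eig"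
    and "Pn (of_real t) n * Tn (of_real t) (Suc n) / ((of_real (lam n) - of_real t) * F (of_real t)) =
      of_real (resolvent_diag t n)"
proof -
  interpret S: jacobi "\<lambda>n. lam n - t" w by (rule jacobi_shift[OF t(1)])
  have xs: "S.xs 0 = xs (of_real t)"
    by (simp add: fun_eq_iff xs_def S.xs_def)
  have shift: "japp lam w g m = t *\<^sub>R g m + japp (\<lambda>n. lam n - t) w g m" for g :: "nat \<Rightarrow> 'b::real_vector" and m
    by (simp add: japp_def algebra_simps)
  have re_im: "japp lam w (coord u) m = t * coord u m + (if m = n then Re r else 0)"
      "japp lam w (coord v) m = t * coord v m + (if m = n then Im r else 0)"
    if "\<And>m. japp (\<lambda>n. lam n - t) w (complex_seq u v) m = (if m = n then r else 0)" for u v n r m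
    using that[of m] unfolding japp_complex_seq by (auto simp: shift complex_eq_iff)
  show F: "F (of_real t) \<noteq> 0"
  proof
    \<comment> \<open>Then the unnormalised Green function is a nonzero square-summable solution of
      the homogeneous equation, so t would be an eigenvalue.\<close>
    assume F0: "F (of_real t) = 0"
    obtain u v where uv: "S.green 0 = complex_seq u v"
      using S.green_in_ell2 by (rule ell2_cases)
    have "japp (\<lambda>n. lam n - t) w (complex_seq u v) m = (if m = 0 then 0 else 0)" for m
      using S.japp_green[of 0 m] F0 by (simp add: xs uv)
    note re_im[OF this]
    hence "u = 0" "v = 0"
      by (auto intro!: not_eig_imp_zero[OF t(2)])
    thus False using S.green_0_nonzero by (simp add: uv zero_complex_seq)
  qed
  obtain u v where uv: "S.green n = complex_seq u v"
    using S.green_in_ell2 by (rule ell2_cases)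
  let ?c = "1 / F (of_real t)"
  define u' v' where "u' = Re ?c *\<^sub>R u - Im ?c *\<^sub>R v" and "v' = Re ?c *\<^sub>R v + Im ?c *\<^sub>R u"
  have uv': "complex_seq u' v' = (\<lambda>m. ?c * S.green n m)"
    unfolding uv complex_seq_mult u'_def v'_def ..
  have j: "japp (\<lambda>n. lam n - t) w (complex_seq u' v') m = (if m = n then 1 else 0)" for m
  proof -
    have "japp (\<lambda>n. lam n - t) w (complex_seq u' v') m = ?c * japp (\<lambda>n. lam n - t) w (S.green n) m"
      unfolding uv'
      by (cases m) (simp_all add: japp_def scaleR_conv_of_real distrib_left mult.left_commute)
    thus ?thesis using F by (simp add: S.japp_green xs)
  qed
  have "((\<lambda>s. Re 1 * ((coord (ev s) n)\<^sup>2 / (s - t))) has_sum coord u' n) eig"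
    using re_im(1)[OF j] by (rule green_has_sum[OF t(2)])
  hence hs: "((\<lambda>s. (coord (ev s) n)\<^sup>2 / (s - t)) has_sum coord u' n) eig" by simp
  thus "((\<lambda>s. (coord (ev s) n)\<^sup>2 / (s - t)) has_sum resolvent_diag t n) eig"
    unfolding resolvent_diag_def by (intro has_sum_infsum has_sum_imp_summable)
  have r: "resolvent_diag t n = coord u' n"
    unfolding resolvent_diag_def using hs by (rule infsumI)
  \<comment> \<open>The source term is real, so the imaginary part of the normalised Green function
    solves the homogeneous equation.\<close>
  have "v' = 0"
    by (rule not_eig_imp_zero[OF t(2)]) (use re_im(2)[OF j] in simp)
  hence "of_real (resolvent_diag t n) = ?c * S.green n n"
    using fun_cong[OF uv', of n] by (simp add: r complex_seq_def complex_of_real_def)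
  thus "Pn (of_real t) n * Tn (of_real t) (Suc n) / ((of_real (lam n) - of_real t) * F (of_real t)) =
      of_real (resolvent_diag t n)"
    by (simp add: S.green_diag xs)
qed

lemma resolvent_diag_0: "resolvent_diag 0 n = coord (A (basis_l2 n)) n"
  unfolding resolvent_diag_def using coord_A_has_sum[of n] by (simp add: infsumI)

lemma of_real_in_dom: "(\<And>n. t < lam n) \<Longrightarrow> of_real t \<in> dom"
  by (auto simp: dom_def)

lemma char_fun_logderiv:
  assumes t: "\<And>n. t < lam n" "t \<notin> eig"
  obtains \<tau> where "(\<lambda>n. 1 / (lam n - t) - resolvent_diag t n) sums \<tau>"
    "((\<lambda>z. F z) has_field_derivative of_real \<tau> * F (of_real t)) (at (of_real t))"
proof (rule char_fun_derivative[OF of_real_in_dom[OF t(1)]])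
  fix D assume D: "((\<lambda>z. F z) has_field_derivative D) (at (of_real t))"
    "(\<lambda>n. (F (of_real t) - Pn (of_real t) n * Tn (of_real t) (Suc n)) / (of_real (lam n) - of_real t)) sums D"
  let ?F = "F (of_real t)"
  have F: "?F \<noteq> 0" by (rule resolvent_diag[OF t])
  have "(F (of_real t) - Pn (of_real t) n * Tn (of_real t) (Suc n)) / (of_real (lam n) - of_real t) / ?F =
      of_real (1 / (lam n - t) - resolvent_diag t n)" for n
  proof -
    have "of_real (lam n) - complex_of_real t \<noteq> 0" using t(1)[of n] by (simp flip: of_real_diff)
    thus ?thesis using F resolvent_diag(3)[OF t, of n, symmetric] by (simp add: field_simps)
  qed
  hence s: "(\<lambda>n. complex_of_real (1 / (lam n - t) - resolvent_diag t n)) sums (D / ?F)"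
    using sums_divide[OF D(2), of ?F] by (simp only:)
  hence "(\<lambda>n. 1 / (lam n - t) - resolvent_diag t n) sums Re (D / ?F)"
    using sums_Re by fastforce
  moreover have "of_real (Re (D / ?F)) = D / ?F"
    using sums_unique2[OF s sums_of_real[OF calculation]] by simp
  ultimately show thesis
    using that[of "Re (D / ?F)"] D(1) F by simp
qed

text \<open>The trace of (L - t)^-1 - (J - t)^-1, read off the diagonal in the standard
  basis.\<close>

definition tr :: "real \<Rightarrow> real"
  where "tr t = (\<Sum>n. 1 / (lam n - t) - resolvent_diag t n)"

lemma tr_sums:
  assumes t: "\<And>n. t < lam n" "t \<notin> eig"
  shows "(\<lambda>n. 1 / (lam n - t) - resolvent_diag t n) sums tr t"
    and "((\<lambda>z. F z) has_field_derivative of_real (tr t) * F (of_real t)) (at (of_real t))"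
  using char_fun_logderiv[OF t] by (metis sums_unique tr_def)+

lemma op_trace_eq: "op_trace (inverse_difference lam w) = of_real (tr 0)"
proof -
  have "(\<lambda>n. 1 / lam n - coord (A (basis_l2 n)) n) sums tr 0"
    using tr_sums(1)[OF lam_pos zero_notin_eig] by (simp add: resolvent_diag_0)
  from sums_of_real[OF this, where 'a = complex] show ?thesis
    unfolding op_trace_inverse_difference by (rule sums_unique[symmetric])
qed

lemma resolvent_diag_diff_sums:
  assumes t: "\<And>n. t < lam n" "t \<notin> eig"
  shows "(\<lambda>n. resolvent_diag 0 n - resolvent_diag t n) sums (\<Sum>\<^sub>\<infinity>s\<in>eig. 1 / s - 1 / (s - t))"
proof (rule trace_sums[OF summable_resolvent_diff[OF t(2)]])
  show "((\<lambda>s. (coord (ev s) n)\<^sup>2 * (1 / s - 1 / (s - t))) has_sum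
      (resolvent_diag 0 n - resolvent_diag t n)) eig" for n
    using has_sum_add[OF resolvent_diag(2)[OF lam_pos zero_notin_eig]
        has_sum_uminusI[OF resolvent_diag(2)[OF t]], of n n]
    by (simp add: right_diff_distrib)
qed

section \<open>The product formula\<close>

context
  fixes \<mu> :: "nat \<Rightarrow> real"
  assumes \<mu>: "bij_betw \<mu> UNIV eig"
begin

lemma \<mu>_in_eig: "\<mu> n \<in> eig"
  using \<mu> by (auto simp: bij_betw_def)

lemma range_\<mu>: "range \<mu> = eig"
  using \<mu> by (simp add: bij_betw_def)

lemma genus_one_\<mu>: "genus_one \<mu>"
proof
  show "\<mu> n \<noteq> 0" for n using eig_nonzero[OF \<mu>_in_eig] .
  have "(\<lambda>n. (1 / \<mu> n)\<^sup>2) summable_on UNIV"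
    using summable_on_reindex_bij_betw[OF \<mu>, of "\<lambda>s. (1 / s)\<^sup>2"] summable_eig by simp
  thus "summable (\<lambda>n. 1 / (\<mu> n)\<^sup>2)"
    using summable_on_imp_summable by (simp add: power_divide)
qed

interpretation L: genus_one lam by (rule genus_one_lam)
interpretation M: genus_one \<mu> by (rule genus_one_\<mu>)

lemma sums_\<mu>:
  fixes h :: "real \<Rightarrow> real"
  assumes "(\<lambda>s. \<bar>h s\<bar>) summable_on eig"
  shows "(\<lambda>n. h (\<mu> n)) sums infsum h eig"
proof -
  have "h summable_on eig"
    using assms summable_on_iff_abs_summable_on_real[of h eig] by simp
  hence "((\<lambda>n. h (\<mu> n)) has_sum infsum h eig) UNIV"
    by (simp add: has_sum_reindex_bij_betw[OF \<mu>])
  thus ?thesis by (rule has_sum_imp_sums)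
qed

text \<open>Valid for every enumeration of the eigenvalues, because the eigenvalue part is
  absolutely summable.\<close>

lemma tr_diff_sums:
  assumes t: "\<And>n. t < lam n" "t \<notin> eig"
  shows "(\<lambda>n. 1 / lam n - 1 / (lam n - t) - (1 / \<mu> n - 1 / (\<mu> n - t))) sums (tr 0 - tr t)"
proof -
  have "(\<lambda>n. 1 / (lam n - 0) - resolvent_diag 0 n - (1 / (lam n - t) - resolvent_diag t n)
      + (resolvent_diag 0 n - resolvent_diag t n) - (1 / \<mu> n - 1 / (\<mu> n - t)))
    sums (tr 0 - tr t + (\<Sum>\<^sub>\<infinity>s\<in>eig. 1 / s - 1 / (s - t)) - (\<Sum>\<^sub>\<infinity>s\<in>eig. 1 / s - 1 / (s - t)))"
    by (intro sums_diff sums_add tr_sums(1)[OF t] tr_sums(1)[OF lam_pos zero_notin_eig]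
        resolvent_diag_diff_sums[OF t] sums_\<mu>[OF summable_resolvent_diff[OF t(2)]])
  thus ?thesis by (simp add: algebra_simps)
qed

lemma dom_eq: "dom = - range (\<lambda>n. of_real (lam n))"
  by (auto simp: dom_def)

lemma open_dom: "open dom"
  unfolding dom_eq using L.not_islimpt_range_a by (simp add: open_Compl closed_limpt)

lemma connected_dom: "connected dom"
  unfolding dom_eq by (intro path_connected_imp_connected path_connected_complement_countable) auto

lemma F_holomorphic: "(\<lambda>z. F z) holomorphic_on dom"
  unfolding holomorphic_on_def field_differentiable_def
  using char_fun_derivative has_field_derivative_at_within by metis

definition rhs :: "complex \<Rightarrow> complex"
  where "rhs z = F 0 * exp (of_real (tr 0) * z) * Phi \<mu> z"

lemma rhs_holomorphic: "rhs holomorphic_on S"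
  unfolding rhs_def[abs_def] by (intro holomorphic_intros M.Phi_holomorphic)

text \<open>The quotient of both sides has derivative 0 on a real interval around 0 and equals 1 at
  0. The linear exponent in \<open>rhs\<close> compensates exactly the constant \<open>tr 0\<close>
  by which the two logarithmic derivatives would otherwise differ.\<close>

lemma product_formula_real:
  obtains \<epsilon> where "\<epsilon> > 0" "\<And>t. \<bar>t\<bar> < \<epsilon> \<Longrightarrow> of_real t \<in> dom \<and> Phi lam (of_real t) * F (of_real t) = rhs (of_real t)"
proof -
  obtain \<delta> where \<delta>: "\<delta> > 0" "\<And>n. lam n \<ge> \<delta>" using lam_lower by metis
  \<comment> \<open>Below \<epsilon> in modulus there is neither a diagonal entry nor an eigenvalue;
    only finitely many eigenvalues have to be avoided.\<close>
  define \<epsilon> where "\<epsilon> = Min (insert \<delta> (abs ` {s\<in>eig. \<bar>s\<bar> \<le> \<delta>}))"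
  have fin: "finite {s\<in>eig. \<bar>s\<bar> \<le> \<delta>}" by (rule finite_eig_bounded)
  have \<epsilon>: "\<epsilon> > 0" unfolding \<epsilon>_def using fin \<delta> eig_nonzero by (subst Min_gr_iff) auto
  have \<epsilon>\<delta>: "\<epsilon> \<le> \<delta>" unfolding \<epsilon>_def using fin by (intro Min_le) auto
  have \<epsilon>s: "\<epsilon> \<le> \<bar>s\<bar>" if "s \<in> eig" for s
  proof (cases "\<bar>s\<bar> \<le> \<delta>")
    case True
    thus ?thesis unfolding \<epsilon>_def using fin that by (intro Min_le) auto
  qed (use \<epsilon>\<delta> in linarith)
  have t: "t < lam n" "t \<notin> eig" if "\<bar>t\<bar> < \<epsilon>" for t n
    using that \<epsilon>\<delta> \<delta>(2)[of n] \<epsilon>s[of t] by (linarith, force)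
  define Q where "Q z = Phi lam z * F z / rhs z" for z
  have nz: "rhs (of_real t) \<noteq> 0" if "\<bar>t\<bar> < \<epsilon>" for t
  proof -
    have "Phi \<mu> (of_real t) \<noteq> 0"
      unfolding M.Phi_eq_0_iff using t(2)[OF that] \<mu>_in_eig by auto
    moreover have "F 0 \<noteq> 0" using resolvent_diag(1)[OF lam_pos zero_notin_eig] by simp
    ultimately show ?thesis by (simp add: rhs_def)
  qed
  have der: "(Q has_field_derivative 0) (at (of_real t))" if t': "\<bar>t\<bar> < \<epsilon>" for t
  proof -
    let ?t = "complex_of_real t"
    note tt = t[OF t']
    have nl: "Phi lam ?t \<noteq> 0" unfolding L.Phi_eq_0_iff using tt(1) by (auto simp: less_le)
    have nm: "Phi \<mu> ?t \<noteq> 0" using nz[OF t'] by (simp add: rhs_def)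
    define \<alpha> \<beta> where "\<alpha> = deriv (Phi lam) ?t / Phi lam ?t" and "\<beta> = deriv (Phi \<mu>) ?t / Phi \<mu> ?t"
    have d1: "(Phi lam has_field_derivative \<alpha> * Phi lam ?t) (at ?t)"
      using holomorphic_derivI[OF L.Phi_holomorphic[of UNIV]] nl by (simp add: \<alpha>_def)
    have d2: "(Phi \<mu> has_field_derivative \<beta> * Phi \<mu> ?t) (at ?t)"
      using holomorphic_derivI[OF M.Phi_holomorphic[of UNIV]] nm by (simp add: \<beta>_def)
    have d3: "((\<lambda>z. F z) has_field_derivative of_real (tr t) * F ?t) (at ?t)"
      by (rule tr_sums(2)[OF tt])
    have "\<alpha> + of_real (tr t) = of_real (tr 0) + \<beta>"
    proof -
      have "(\<lambda>n. (1 / of_real (lam n) - 1 / (of_real (lam n) - ?t)) - (1 / of_real (\<mu> n) - 1 / (of_real (\<mu> n) - ?t)))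
          sums (\<alpha> - \<beta>)"
        unfolding \<alpha>_def \<beta>_def by (rule sums_diff[OF L.Phi_logderiv[OF nl] M.Phi_logderiv[OF nm]])
      moreover have "(\<lambda>n. complex_of_real (1 / lam n - 1 / (lam n - t) - (1 / \<mu> n - 1 / (\<mu> n - t)))) sums
          of_real (tr 0 - tr t)"
        by (rule sums_of_real[OF tr_diff_sums[OF tt]])
      ultimately have "\<alpha> - \<beta> = of_real (tr 0 - tr t)"
        using sums_unique2 by fastforce
      thus ?thesis by (simp add: algebra_simps)
    qed
    hence tt0: "of_real (tr 0) = \<alpha> + of_real (tr t) - \<beta>" by (simp add: algebra_simps)
    have n0: "F 0 \<noteq> 0" using nz[OF t'] by (simp add: rhs_def)
    have num: "((\<lambda>z. Phi lam z * F z) has_field_derivative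
        (\<alpha> + of_real (tr t)) * (Phi lam ?t * F ?t)) (at ?t)"
      by (rule DERIV_cong[OF DERIV_mult[OF d1 d3]]) (simp add: algebra_simps)
    have den: "(rhs has_field_derivative (of_real (tr 0) + \<beta>) * rhs ?t) (at ?t)"
      unfolding rhs_def[abs_def]
      by (rule derivative_eq_intros refl d2)+ (simp add: algebra_simps)
    have "(Q has_field_derivative
        ((\<alpha> + of_real (tr t)) * (Phi lam ?t * F ?t) * rhs ?t
          - (Phi lam ?t * F ?t) * ((of_real (tr 0) + \<beta>) * rhs ?t)) / (rhs ?t * rhs ?t)) (at ?t)"
      unfolding Q_def[abs_def] by (rule DERIV_divide[OF num den nz[OF t']])
    thus ?thesis by (simp add: tt0)
  qed
  have "((\<lambda>t. Q (of_real t)) has_vector_derivative 0) (at t within {-\<epsilon><..<\<epsilon>})"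
    if "t \<in> {-\<epsilon><..<\<epsilon>}" for t
    using has_vector_derivative_real_field[OF der] that by auto
  then obtain c where c: "\<And>t. t \<in> {-\<epsilon><..<\<epsilon>} \<Longrightarrow> Q (of_real t) = c"
    using has_vector_derivative_zero_constant[of "{-\<epsilon><..<\<epsilon>}" "\<lambda>t. Q (of_real t)"] by auto
  have "Q (of_real 0) = 1"
    using nz[of 0] \<epsilon> by (simp add: Q_def rhs_def L.Phi_0 M.Phi_0)
  hence "c = 1" using c[of 0] \<epsilon> by simp
  hence "Phi lam (of_real t) * F (of_real t) = rhs (of_real t)" if "\<bar>t\<bar> < \<epsilon>" for t
    using c[of t] that nz[OF that] by (simp add: Q_def abs_less_iff)
  thus thesis using that[OF \<epsilon>] of_real_in_dom[OF t(1)] by blast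
qed

lemma product_formula_dom:
  assumes "z \<in> dom"
  shows "Phi lam z * F z = rhs z"
proof -
  obtain \<epsilon> where \<epsilon>: "\<epsilon> > 0"
    "\<And>t. \<bar>t\<bar> < \<epsilon> \<Longrightarrow> of_real t \<in> dom \<and> Phi lam (of_real t) * F (of_real t) = rhs (of_real t)"
    by (rule product_formula_real) blast
  let ?U = "complex_of_real ` {-\<epsilon><..<\<epsilon>}"
  have "Phi lam z * F z - rhs z = 0"
  proof (rule analytic_continuation[where S = dom and U = ?U and \<xi> = 0 and f = "\<lambda>z. Phi lam z * F z - rhs z",
        OF _ open_dom connected_dom])
    show "(\<lambda>z. Phi lam z * F z - rhs z) holomorphic_on dom"
      by (intro holomorphic_intros L.Phi_holomorphic F_holomorphic rhs_holomorphic)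
    show "?U \<subseteq> dom" using \<epsilon> by auto
    show "0 \<in> dom" by (rule zero_in_dom)
    show "0 islimpt ?U"
      unfolding islimpt_approachable
    proof (intro allI impI)
      fix e :: real assume "e > 0"
      define r where "r = min (e / 2) (\<epsilon> / 2)"
      have "r > 0" "r < \<epsilon>" "r < e" using \<epsilon> \<open>e > 0\<close> by (auto simp: r_def)
      thus "\<exists>x'\<in>?U. x' \<noteq> 0 \<and> dist x' 0 < e"
        by (intro bexI[of _ "of_real r"]) auto
    qed
    show "Phi lam z * F z - rhs z = 0" if "z \<in> ?U" for z using that \<epsilon>(2) by auto
  qed (rule assms)
  thus ?thesis by simp
qed

text \<open>The diagonal entries do not accumulate, so every point has a punctured neighbourhood
  inside \<open>dom\<close>; there the formula holds, and \<open>rhs\<close> is continuous across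
  the point.\<close>

lemma reg_char_fun_eq: "reg_char_fun lam w z = rhs z"
  unfolding reg_char_fun_def
proof (rule remove_sings_eqI)
  have "eventually (\<lambda>z. z \<in> dom) (at z)"
    using L.not_islimpt_range_a[of z] by (simp add: islimpt_iff_eventually dom_eq)
  hence ev: "eventually (\<lambda>z. rhs z = Phi lam z * char_fun lam w z) (at z)"
    by eventually_elim (simp add: product_formula_dom char_fun_eq)
  have "rhs \<midarrow>z\<rightarrow> rhs z"
    using holomorphic_on_imp_continuous_on[OF rhs_holomorphic[of UNIV]]
    by (simp add: continuous_on_def)
  thus "(\<lambda>z. Phi lam z * char_fun lam w z) \<midarrow>z\<rightarrow> rhs z"
    using ev by (rule Lim_transform_eventually)
qed

end

end

section \<open>Rank enumerations\<close>

text \<open>Ranks are injective by totality. They exhaust the naturals because they are unbounded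
  and downward closed.\<close>

lemma bij_betw_rank:
  fixes r :: "'a \<Rightarrow> 'a \<Rightarrow> bool"
  assumes inf: "infinite S" and fin: "\<And>x. x \<in> S \<Longrightarrow> finite {y\<in>S. r y x}"
    and irrefl: "\<And>x. \<not> r x x" and trans: "\<And>x y z. r x y \<Longrightarrow> r y z \<Longrightarrow> r x z"
    and total: "\<And>x y. x \<in> S \<Longrightarrow> y \<in> S \<Longrightarrow> x \<noteq> y \<Longrightarrow> r x y \<or> r y x"
  defines "rk \<equiv> \<lambda>x. card {y\<in>S. r y x}"
  shows "bij_betw rk S UNIV"
    and "\<And>x y. x \<in> S \<Longrightarrow> y \<in> S \<Longrightarrow> r x y \<longleftrightarrow> rk x < rk y"
proof -
  have mono: "rk x < rk y" if "x \<in> S" "y \<in> S" "r x y" for x y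
    unfolding rk_def using that irrefl trans by (intro psubset_card_mono fin) blast+
  show iff: "r x y \<longleftrightarrow> rk x < rk y" if "x \<in> S" "y \<in> S" for x y
    using mono[OF that] mono[OF that(2,1)] total[OF that] irrefl by (metis less_asym less_irrefl)
  have inj: "inj_on rk S"
    using iff total by (intro inj_onI) (metis less_irrefl)
  have down: "x \<in> S \<Longrightarrow> k < rk x \<Longrightarrow> k \<in> rk ` S" for x k
  proof (induction "rk x" arbitrary: x rule: less_induct)
    case less
    let ?P = "{y\<in>S. r y x}"
    have "card ?P > 0" using less.prems(2) by (simp add: rk_def)
    hence P: "finite ?P" "?P \<noteq> {}" unfolding card_gt_0_iff by blast+
    define M where "M = Max (rk ` ?P)"
    have "M \<in> rk ` ?P" unfolding M_def using P by (intro Max_in) auto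
    then obtain y where y: "y \<in> S" "r y x" "rk y = M" by auto
    \<comment> \<open>The predecessor y of largest rank lies above all other predecessors of x, so
      its rank is just one less than that of x.\<close>
    have "?P - {y} \<subseteq> {z\<in>S. r z y}"
    proof safe
      fix z assume z: "z \<in> S" "r z x" "z \<noteq> y"
      have "rk z \<le> M" unfolding M_def using P z by (intro Max_ge) auto
      thus "r z y" using iff total z y by (metis not_less)
    qed
    hence "card (?P - {y}) \<le> rk y" unfolding rk_def using fin[OF y(1)] by (intro card_mono)
    moreover have "card (?P - {y}) = rk x - 1" using y P by (simp add: rk_def)
    ultimately have "k < rk y \<or> k = rk y"
      using less.prems(2) mono[OF y(1) less.prems(1) y(2)] by linarith
    thus ?case using less.hyps[OF mono[OF y(1) less.prems(1) y(2)] y(1)] y(1) by blast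
  qed
  have "k \<in> rk ` S" for k
  proof -
    have "infinite (rk ` S)" using inf inj finite_image_iff by blast
    then obtain n where "n \<in> rk ` S" "k < n" by (metis infinite_nat_iff_unbounded)
    thus ?thesis using down by blast
  qed
  thus "bij_betw rk S UNIV" using inj by (auto simp: bij_betw_def)
qed

section \<open>Comparison of counting functions\<close>

text \<open>
  Layer-cake: the hypothesis \<open>count\<close> compares the numbers of terms above a level \<open>y\<close>; by
  comonotonicity the intervals \<open>(\<beta> k, \<alpha> k]\<close> containing \<open>y\<close> number at most
  \<open>#{\<alpha> \<ge> y} - #{\<beta> \<ge> y}\<close>.
\<close>

lemma summable_positive_part_diff:
  fixes \<alpha> \<beta> m :: "nat \<Rightarrow> real"
  assumes pos: "\<And>n. \<beta> n > 0" and le: "\<And>n. m n \<le> \<alpha> n"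
    and fin: "\<And>y. y > 0 \<Longrightarrow> finite {n. \<alpha> n \<ge> y}" "\<And>y. y > 0 \<Longrightarrow> finite {n. \<beta> n \<ge> y}"
    and comono: "\<And>i j. \<alpha> i < \<alpha> j \<Longrightarrow> \<beta> i < \<beta> j"
    and count: "\<And>y. y > 0 \<Longrightarrow> card {n. m n \<ge> y} \<le> card {n. \<beta> n \<ge> y}"
    and sm: "summable (\<lambda>n. \<alpha> n - m n)"
  shows "summable (\<lambda>n. max 0 (\<alpha> n - \<beta> n))"
proof (rule summable_suminf_not_top)
  have em: "(\<integral>\<^sup>+y. indicator {b<..a} y \<partial>lborel) = ennreal (max 0 (a - b))" for a b :: real
    by (cases "b \<le> a") (simp_all add: max_def)
  have pt: "(\<Sum>n. indicator {\<beta> n<..\<alpha> n} y :: ennreal) \<le> (\<Sum>n. indicator {m n<..\<alpha> n} y)" for y :: real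
  proof (cases "y > 0")
    case False
    hence "indicator {\<beta> n<..\<alpha> n} y = (0 :: ennreal)" for n
      using pos[of n] by (auto simp: indicator_def)
    thus ?thesis by simp
  next
    case y: True
    let ?N = "{n. \<alpha> n \<ge> y}"
    have s: "(\<Sum>n. indicator {b n<..\<alpha> n} y :: ennreal) = of_nat (card {n\<in>?N. b n < y})" for b
    proof -
      have "(\<Sum>n. indicator {b n<..\<alpha> n} y :: ennreal) = (\<Sum>n\<in>?N. indicator {b n<..\<alpha> n} y)"
        by (rule suminf_finite[OF fin(1)[OF y]]) auto
      also have "\<dots> = (\<Sum>n\<in>?N. if b n < y then 1 else 0)"
        by (intro sum.cong) (auto simp: indicator_def)
      also have "\<dots> = of_nat (card {n\<in>?N. b n < y})"
        using fin(1)[OF y] by (simp add: sum.If_cases Int_def)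
      finally show ?thesis .
    qed
    have "card {n\<in>?N. \<beta> n < y} \<le> card {n\<in>?N. m n < y}"
    proof (cases "\<exists>k\<in>?N. \<beta> k < y")
      case False
      hence e: "{n\<in>?N. \<beta> n < y} = {}" by blast
      show ?thesis unfolding e by simp
    next
      case True
      then obtain k where k: "\<alpha> k \<ge> y" "\<beta> k < y" by auto
      have split: "card {n\<in>?N. b n < y} = card ?N - card {n. b n \<ge> y}" if "{n. b n \<ge> y} \<subseteq> ?N" for b :: "nat \<Rightarrow> real"
      proof -
        have "{n\<in>?N. b n < y} = ?N - {n. b n \<ge> y}" using that by auto
        thus ?thesis using card_Diff_subset[OF finite_subset[OF that fin(1)[OF y]] that] by simp
      qed
      \<comment> \<open>An index n outside \<open>?N\<close> satisfies \<alpha> n < \<alpha> k;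
        comonotonicity then gives \<beta> n < \<beta> k < y. The presence of such a k makes the two
        level sets nested.\<close>
      have 1: "{n. \<beta> n \<ge> y} \<subseteq> ?N"
      proof safe
        fix n assume n: "\<beta> n \<ge> y"
        show "\<alpha> n \<ge> y"
        proof (rule ccontr)
          assume "\<not> \<alpha> n \<ge> y"
          hence "\<beta> n < \<beta> k" using comono[of n k] k by simp
          thus False using n k by simp
        qed
      qed
      have 2: "{n. m n \<ge> y} \<subseteq> ?N" using le order_trans by blast
      show ?thesis unfolding split[OF 1] split[OF 2] by (rule diff_le_mono2[OF count[OF y]])
    qed
    thus ?thesis by (simp only: s of_nat_le_iff)
  qed
  have "(\<Sum>n. ennreal (max 0 (\<alpha> n - \<beta> n))) = (\<integral>\<^sup>+y. (\<Sum>n. indicator {\<beta> n<..\<alpha> n} y) \<partial>lborel)"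
    by (subst nn_integral_suminf) (simp_all only: em, simp)
  also have "\<dots> \<le> (\<integral>\<^sup>+y. (\<Sum>n. indicator {m n<..\<alpha> n} y) \<partial>lborel)"
    by (intro nn_integral_mono pt)
  also have "\<dots> = (\<Sum>n. ennreal (max 0 (\<alpha> n - m n)))"
    by (subst nn_integral_suminf) (simp_all only: em, simp)
  also have "\<dots> = (\<Sum>n. ennreal (\<alpha> n - m n))"
    using le by (simp add: max_def)
  also have "\<dots> = ennreal (\<Sum>n. \<alpha> n - m n)"
    using le by (intro suminf_ennreal2 sm) simp
  also have "\<dots> < top" by simp
  finally show "(\<Sum>n. ennreal (max 0 (\<alpha> n - \<beta> n))) \<noteq> top" by simp
qed simp

text \<open>Gaussian elimination: an equation with a nonzero coefficient at p is used to remove the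
  unknown p from the others.\<close>

lemma ex_homogeneous_solution:
  fixes f :: "'b \<Rightarrow> 'a \<Rightarrow> real"
  assumes "finite E" "finite I" "card E < card I"
  shows "\<exists>y. (\<exists>n\<in>I. y n \<noteq> 0) \<and> (\<forall>s\<in>E. (\<Sum>n\<in>I. y n * f s n) = 0)"
  using assms
proof (induction E arbitrary: I f rule: finite_induct)
  case empty
  hence "I \<noteq> {}" by auto
  thus ?case by (intro exI[of _ "\<lambda>_. 1"]) auto
next
  case (insert s E)
  show ?case
  proof (cases "\<forall>n\<in>I. f s n = 0")
    case True
    have "card E < card I" using insert by simp
    then obtain y where "\<exists>n\<in>I. y n \<noteq> 0" "\<forall>s\<in>E. (\<Sum>n\<in>I. y n * f s n) = 0"
      using insert.IH[OF insert.prems(1)] by blast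
    thus ?thesis using True by (intro exI[of _ y]) auto
  next
    case False
    then obtain p where p: "p \<in> I" "f s p \<noteq> 0" by blast
    have "card E < card (I - {p})" using insert p by simp
    then obtain y where y: "\<exists>n\<in>I - {p}. y n \<noteq> 0"
      "\<forall>r\<in>E. (\<Sum>n\<in>I - {p}. y n * (f r n - f r p * f s n / f s p)) = 0"
      using insert.IH[of "I - {p}" "\<lambda>r n. f r n - f r p * f s n / f s p"] insert.prems(1) by auto
    let ?c = "\<Sum>n\<in>I - {p}. y n * f s n"
    \<comment> \<open>The value at the pivot is the one forced by equation s.\<close>
    define z where "z = y(p := - ?c / f s p)"
    have z: "(\<Sum>n\<in>I. z n * f r n) = (\<Sum>n\<in>I - {p}. y n * f r n) - ?c / f s p * f r p" for r
    proof -
      have "(\<Sum>n\<in>I. z n * f r n) = z p * f r p + (\<Sum>n\<in>I - {p}. z n * f r n)"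
        using insert.prems(1) p(1) by (simp add: sum.remove)
      also have "(\<Sum>n\<in>I - {p}. z n * f r n) = (\<Sum>n\<in>I - {p}. y n * f r n)"
        by (intro sum.cong) (auto simp: z_def)
      finally show ?thesis by (simp add: z_def)
    qed
    have "(\<Sum>n\<in>I. z n * f r n) = 0" if "r \<in> E" for r
    proof -
      have "(\<Sum>n\<in>I - {p}. y n * (f r n - f r p * f s n / f s p)) =
          (\<Sum>n\<in>I - {p}. y n * f r n - (f r p / f s p) * (y n * f s n))"
        by (intro sum.cong refl) (simp add: right_diff_distrib)
      also have "\<dots> = (\<Sum>n\<in>I - {p}. y n * f r n) - (f r p / f s p) * ?c"
        by (simp only: sum_subtractf sum_distrib_left)
      finally have "(\<Sum>n\<in>I - {p}. y n * (f r n - f r p * f s n / f s p)) =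
          (\<Sum>n\<in>I - {p}. y n * f r n) - ?c / f s p * f r p" by simp
      thus ?thesis using y(2) that z by simp
    qed
    moreover have "(\<Sum>n\<in>I. z n * f s n) = 0" using p by (simp add: z)
    moreover have "\<exists>n\<in>I. z n \<noteq> 0" using y(1) by (auto simp: z_def)
    ultimately show ?thesis by blast
  qed
qed

text \<open>The absolute row sums of the off-diagonal matrix. By 2 |z_n z_(n+1)| \<le> z_n^2 +
  z_(n+1)^2 the diagonal operator with these entries dominates its quadratic form.\<close>

definition row_weight :: "(nat \<Rightarrow> real) \<Rightarrow> nat \<Rightarrow> real"
  where "row_weight a n = \<bar>a n\<bar> + (case n of 0 \<Rightarrow> 0 | Suc m \<Rightarrow> \<bar>a m\<bar>)"

lemma offdiag_form_bound:
  assumes "Bseq a"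
  shows "\<bar>inner z (offdiag a z)\<bar> \<le> (\<Sum>n. row_weight a n * (coord z n)\<^sup>2)"
    and "summable (\<lambda>n. row_weight a n * (coord z n)\<^sup>2)"
proof -
  obtain B where B: "\<And>n. \<bar>a n\<bar> \<le> B" using assms unfolding Bseq_def by auto
  have sB: "summable (\<lambda>n. \<bar>a n\<bar> * (coord z (f n))\<^sup>2)" if "summable (\<lambda>n. (coord z (f n))\<^sup>2)" for f
    by (rule summable_comparison_test'[OF summable_mult[OF that, of B], of 0])
      (use B in \<open>auto simp: abs_mult intro: mult_right_mono\<close>)
  have s1: "summable (\<lambda>n. \<bar>a n\<bar> * (coord z n)\<^sup>2)"
    by (rule sB[of "\<lambda>n. n"]) (rule summable_coord_power2)
  have s2: "summable (\<lambda>n. \<bar>a n\<bar> * (coord z (Suc n))\<^sup>2)"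
    by (rule sB) (rule summable_Suc_iff[THEN iffD2, OF summable_coord_power2])
  let ?v = "\<lambda>n. (case n of 0 \<Rightarrow> 0 | Suc m \<Rightarrow> \<bar>a m\<bar>) * (coord z n)\<^sup>2"
  have "(\<lambda>n. ?v (Suc n)) sums (\<Sum>n. \<bar>a n\<bar> * (coord z (Suc n))\<^sup>2)"
    using summable_sums[OF s2] by simp
  hence v: "?v sums (\<Sum>n. \<bar>a n\<bar> * (coord z (Suc n))\<^sup>2)"
    by (subst (asm) sums_Suc_iff) simp
  have rw: "(\<lambda>n. row_weight a n * (coord z n)\<^sup>2) sums
      ((\<Sum>n. \<bar>a n\<bar> * (coord z n)\<^sup>2) + (\<Sum>n. \<bar>a n\<bar> * (coord z (Suc n))\<^sup>2))"
    unfolding row_weight_def distrib_right by (rule sums_add[OF summable_sums[OF s1] v])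
  show "summable (\<lambda>n. row_weight a n * (coord z n)\<^sup>2)"
    using rw by (rule sums_summable)
  have "norm (\<Sum>n. a n * (coord z n * coord z (Suc n) + coord z (Suc n) * coord z n)) \<le>
      (\<Sum>n. \<bar>a n\<bar> * (coord z n)\<^sup>2 + \<bar>a n\<bar> * (coord z (Suc n))\<^sup>2)"
  proof (rule norm_suminf_le)
    show "summable (\<lambda>n. \<bar>a n\<bar> * (coord z n)\<^sup>2 + \<bar>a n\<bar> * (coord z (Suc n))\<^sup>2)"
      by (rule summable_add[OF s1 s2])
    fix n
    have "\<bar>coord z n * coord z (Suc n) + coord z (Suc n) * coord z n\<bar> \<le> (coord z n)\<^sup>2 + (coord z (Suc n))\<^sup>2"
      using sum_squares_bound[of "\<bar>coord z n\<bar>" "\<bar>coord z (Suc n)\<bar>"] by (simp add: abs_mult mult_ac)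
    thus "norm (a n * (coord z n * coord z (Suc n) + coord z (Suc n) * coord z n))
        \<le> \<bar>a n\<bar> * (coord z n)\<^sup>2 + \<bar>a n\<bar> * (coord z (Suc n))\<^sup>2"
      unfolding real_norm_def abs_mult[of "a n"] distrib_left[symmetric] by (rule mult_left_mono) simp
  qed
  thus "\<bar>inner z (offdiag a z)\<bar> \<le> (\<Sum>n. row_weight a n * (coord z n)\<^sup>2)"
    using inner_offdiag_sums[OF assms, of z z] rw suminf_add[OF s1 s2] by (simp add: sums_iff)
qed

section \<open>The ordered trace formula\<close>

text \<open>With y = D z, the factor sqrt(lam_n) from \<open>japp_D\<close> is absorbed by the other
  argument of the inner product, so the form of J is expressed by bounded operators.\<close>

lemma (in jacobi) form_eq:
  assumes y: "\<And>n. coord z n = sqrt (lam n) * coord y n"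
    and u: "\<And>n. japp lam w (coord y) n = coord u n"
  shows "inner y u = (norm z)\<^sup>2 + inner z (K z)"
proof -
  have "y = D z"
  proof (rule l2_eqI)
    show "coord y n = coord (D z) n" for n
      using lam_pos[of n] by (simp add: coord_D y d_def)
  qed
  have "coord u n = sqrt (lam n) * coord (z + K z) n" for n
    using u[of n] japp_D[of z n] \<open>y = D z\<close> by simp
  hence "coord y n * coord u n = coord z n * coord (z + K z) n" for n
    by (simp add: y del: coord_simps)
  hence "inner y u = inner z (z + K z)" by (simp add: inner_l2_def del: coord_simps)
  thus ?thesis by (simp add: inner_add_right power2_norm_eq_inner)
qed

context jacobi_invertible
begin

section \<open>Decay of the trace towards minus infinity\<close>

lemma tsum_shift_tendsto_0: "((\<lambda>N. tsum (xs (of_real (- real N))) 0) \<longlongrightarrow> 0) sequentially"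
proof -
  have dom: "of_real (- real N) \<in> dom" for N
    using lam_pos by (intro of_real_in_dom) (meson le_less_trans neg_le_0_iff_le of_nat_0_le_iff)
  have eq: "tsum (xs (of_real (- real N))) 0 = (\<Sum>n. cmod (q (of_real (- real N)) n))" for N
    using tsum_def[OF summable_q[OF dom[of N]], of 0] by (simp only: xs_mult add_0_right)
  have "((\<lambda>N. \<Sum>n. cmod (q (of_real (- real N)) n)) \<longlongrightarrow> (\<Sum>n. 0)) sequentially"
  proof (rule tannerys_theorem[THEN conjunct2, THEN conjunct2])
    show "summable W" by (rule summable_W)
    have nrm: "cmod (of_real (lam n) - of_real (- real N)) = lam n + real N" for n N
    proof -
      have "complex_of_real (lam n) - of_real (- real N) = of_real (lam n + real N)" by simp
      thus ?thesis using lam_pos[of n] by (simp only: norm_of_real)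
    qed
    have le: "cmod (q (of_real (- real N)) n) \<le> W n" for n N
      using norm_q_le[of 1 "of_real (- real N)" n] unfolding nrm by simp
    show "\<forall>\<^sub>F (n, N) in at_top \<times>\<^sub>F sequentially. norm (cmod (q (of_real (- real N)) n)) \<le> W n"
      by (intro always_eventually) (use le in auto)
    show "(\<lambda>N. cmod (q (of_real (- real N)) n)) \<longlonglongrightarrow> 0" for n
    proof -
      have "cmod (q (of_real (- real N)) n) = (w n)\<^sup>2 / ((lam n + real N) * (lam (Suc n) + real N))" for N
        unfolding q_def norm_divide norm_mult nrm by (simp add: norm_power)
      moreover have "(\<lambda>N. (w n)\<^sup>2 / ((lam n + real N) * (lam (Suc n) + real N))) \<longlonglongrightarrow> 0"
        by real_asymp
      ultimately show ?thesis by simp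
    qed
  qed simp
  thus ?thesis unfolding eq by simp
qed

text \<open>By \<open>frakF_split_diag\<close> the numerators in the series for F' are bounded by
  the summable row weights of W, uniformly in N, while each denominator is at least N. Since F tends
  to 1, dividing by F does no harm.\<close>

lemma tr_tendsto_0:
  assumes c: "\<And>s. s \<in> eig \<Longrightarrow> s + c > 0"
  shows "(\<lambda>N. tr (- real N)) \<longlonglongrightarrow> 0"
proof (rule Lim_null_comparison)
  let ?u = "\<lambda>N. tsum (xs (of_real (- real N))) 0"
  define E X where "E = exp (suminf W)" and "X = E * E * suminf (row_weight W)"
  have srw: "summable (row_weight W)"
    unfolding row_weight_def using W_nonneg summable_W
    by (intro summable_add) (simp_all add: summable_case_nat)
  \<comment> \<open>This keeps F within 1/2 of 1, so that its modulus is at least 1/2; hence the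
    factor 2 in the final bound.\<close>
  have e1: "\<forall>\<^sub>F N in sequentially. exp (?u N) < 3/2"
    using order_tendstoD(2)[OF tendsto_exp[OF tsum_shift_tendsto_0], of "3/2"] by simp
  have e2: "\<forall>\<^sub>F N in sequentially. real N \<ge> max 1 c"
    by real_asymp
  show "\<forall>\<^sub>F N in sequentially. norm (tr (- real N)) \<le> 2 * X / real N"
    using e1 e2
  proof eventually_elim
    case (elim N)
    define t where "t = - real N"
    have N: "real N > 0" using elim(2) by simp
    have lt: "t < lam n" for n
      using lam_pos[of n] N by (simp add: t_def)
    have ne: "t \<notin> eig"
      using c[of t] elim(2) by (auto simp: t_def)
    have dom: "of_real t \<in> dom" by (rule of_real_in_dom[OF lt])
    have nrm: "cmod (of_real (lam n) - of_real t) = lam n + real N" for n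
    proof -
      have "complex_of_real (lam n) - of_real t = of_real (lam n + real N)" by (simp add: t_def)
      thus ?thesis using lam_pos[of n] by (simp only: norm_of_real)
    qed
    have away: "cmod (of_real (lam n) - of_real t) \<ge> 1 * lam n" for n
      unfolding nrm by simp
    have "exp (tsum (xs (of_real t)) 0) \<le> E"
      unfolding E_def using tsum_le[OF dom _ away] by simp
    hence PE: "cmod (Pn (of_real t) n) \<le> E" and TE: "cmod (Tn (of_real t) n) \<le> E" for n
      using norm_frakF_init_le[OF summable_q[OF dom], of n] norm_frakF_tail_le[OF summable_q[OF dom], of n]
      by linarith+
    have qW: "cmod (q (of_real t) n) \<le> W n" for n
      using norm_q_le[OF _ away, of n] by simp
    have b: "cmod (- q (of_real t) n * Pn (of_real t) n * Tn (of_real t) m) \<le> W n * E * E" for n m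
      unfolding norm_mult norm_minus_cancel using W_nonneg[of n]
      by (intro mult_mono qW PE TE) (auto simp: E_def)
    have le: "cmod ((F (of_real t) - Pn (of_real t) n * Tn (of_real t) (Suc n)) / (of_real (lam n) - of_real t))
        \<le> E * E * row_weight W n / real N" for n
    proof -
      have "cmod (F (of_real t) - Pn (of_real t) n * Tn (of_real t) (Suc n)) \<le> E * E * row_weight W n"
      proof (cases n)
        case 0
        show ?thesis
          unfolding frakF_split_diag[OF dom] using b[of 0 "Suc (Suc 0)"] W_nonneg[of 0]
          by (simp add: 0 row_weight_def mult_ac)
      next
        case (Suc m)
        show ?thesis
          unfolding frakF_split_diag[OF dom]
          using norm_triangle_mono[OF b[of n "Suc (Suc n)"] b[of m "Suc (Suc m)"]] W_nonneg[of n] W_nonneg[of m]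
          by (simp add: Suc row_weight_def algebra_simps)
      qed
      thus ?thesis
        unfolding norm_divide nrm using N lam_pos[of n]
        by (intro frac_le) (auto simp: E_def row_weight_def split: nat.split)
    qed
    obtain D where D: "((\<lambda>z. F z) has_field_derivative D) (at (of_real t))"
      "(\<lambda>n. (F (of_real t) - Pn (of_real t) n * Tn (of_real t) (Suc n)) / (of_real (lam n) - of_real t)) sums D"
      by (rule char_fun_derivative[OF dom]) blast
    have "cmod (\<Sum>n. (F (of_real t) - Pn (of_real t) n * Tn (of_real t) (Suc n)) / (of_real (lam n) - of_real t))
        \<le> (\<Sum>n. E * E * row_weight W n / real N)"
      by (rule norm_suminf_le[OF le]) (intro summable_divide summable_mult srw)
    also have "\<dots> = X / real N"
      unfolding X_def by (subst suminf_divide) (auto intro: summable_mult srw simp: suminf_mult[OF srw])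
    finally have DX: "cmod D \<le> X / real N"
      using D(2) by (simp add: sums_iff)
    have "D = of_real (tr t) * F (of_real t)"
      by (rule DERIV_unique[OF D(1) tr_sums(2)[OF lt ne]])
    hence "\<bar>tr t\<bar> * cmod (F (of_real t)) \<le> X / real N"
      using DX by (simp add: norm_mult)
    moreover have "cmod (F (of_real t)) \<ge> 1/2"
    proof -
      have "cmod (F (of_real t) - 1) \<le> exp (?u N) - 1"
        using frakF_tail_bound[OF summable_q[OF dom], of 0]
        unfolding frakF_eq_tail[OF summable_q[OF dom]] by (simp add: t_def)
      hence "cmod (F (of_real t) - 1) < 1/2" using elim(1) by simp
      moreover have "1 \<le> cmod (F (of_real t)) + cmod (F (of_real t) - 1)"
        using norm_triangle_ineq4[of "F (of_real t)" "F (of_real t) - 1"] by simp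
      ultimately show ?thesis by linarith
    qed
    hence "\<bar>tr t\<bar> * (1/2) \<le> \<bar>tr t\<bar> * cmod (F (of_real t))" by (intro mult_left_mono) auto
    ultimately show "norm (tr (- real N)) \<le> 2 * X / real N" by (simp add: t_def)
  qed
  show "(\<lambda>N. 2 * X / real N) \<longlonglongrightarrow> 0" by real_asymp
qed

section \<open>Lower bound of the spectrum and comparison of counting functions\<close>

definition kc :: "real \<Rightarrow> nat \<Rightarrow> real"
  where "kc c n = w n / sqrt ((lam n + c) * (lam (Suc n) + c))"

lemma jacobi_shift_pos:
  assumes "c \<ge> 0"
  shows "jacobi (\<lambda>n. lam n + c) w"
proof -
  have "- c < lam n" for n using lam_pos[of n] assms by simp
  from jacobi_shift[OF this] show ?thesis by simp
qed

text \<open>A large shift c makes the entries of the rescaled off-diagonal matrix at most 1/4, so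
  its row sums are at most 1/2 and its form cannot outweigh the identity.\<close>

lemma eig_lower_bound:
  obtains c where "c > 0" "\<And>s. s \<in> eig \<Longrightarrow> s + c > 0"
proof -
  have "eventually (\<lambda>n. W n < 1/16) sequentially"
    by (rule order_tendstoD(2)[OF summable_LIMSEQ_zero[OF summable_W]]) simp
  then obtain N where N: "\<And>n. n \<ge> N \<Longrightarrow> W n < 1/16" by (auto simp: eventually_sequentially)
  \<comment> \<open>For n \<ge> N the inequality 16 W_n < 1 already suffices; the finitely many
    other entries are handled by 4 |w_n| \<le> c.\<close>
  define c where "c = 1 + (\<Sum>n<N. 4 * \<bar>w n\<bar>)"
  have c: "c > 0" unfolding c_def by (intro add_pos_nonneg sum_nonneg) auto
  interpret S: jacobi "\<lambda>n. lam n + c" w by (rule jacobi_shift_pos) (use c in simp)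
  have k: "\<bar>S.k n\<bar> \<le> 1/4" for n
  proof -
    have pos: "0 < (lam n + c) * (lam (Suc n) + c)" using c lam_pos[of n] lam_pos[of "Suc n"] by simp
    have "16 * (w n)\<^sup>2 \<le> (lam n + c) * (lam (Suc n) + c)"
    proof (cases "n < N")
      case True
      have "4 * \<bar>w n\<bar> \<le> (\<Sum>n<N. 4 * \<bar>w n\<bar>)" using True by (intro member_le_sum) auto
      hence "4 * \<bar>w n\<bar> \<le> c" by (simp add: c_def)
      hence "(4 * \<bar>w n\<bar>)\<^sup>2 \<le> c * c" unfolding power2_eq_square by (intro mult_mono) (use c in auto)
      also have "c * c \<le> (lam n + c) * (lam (Suc n) + c)"
        using c lam_pos[of n] lam_pos[of "Suc n"] by (intro mult_mono) auto
      finally show ?thesis by (simp add: power_mult_distrib)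
    next
      case False
      have "16 * (w n)\<^sup>2 \<le> lam n * lam (Suc n)"
        using N[of n] False lam_pos[of n] lam_pos[of "Suc n"] by (simp add: W_def field_simps)
      also have "\<dots> \<le> (lam n + c) * (lam (Suc n) + c)"
        using c lam_pos[of n] lam_pos[of "Suc n"] by (intro mult_mono) auto
      finally show ?thesis .
    qed
    moreover have "(S.k n)\<^sup>2 = (w n)\<^sup>2 / ((lam n + c) * (lam (Suc n) + c))"
      unfolding S.k_def power_divide using pos by simp
    ultimately have "(S.k n)\<^sup>2 \<le> 1/16"
      using pos by (simp add: pos_divide_le_eq)
    hence "\<bar>S.k n\<bar>\<^sup>2 \<le> (1/4)\<^sup>2" by (simp add: power_divide)
    thus ?thesis by (rule power2_le_imp_le) simp
  qed
  have "s + c > 0" if s: "s \<in> eig" for s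
  proof -
    let ?v = "ev s"
    obtain \<delta> where \<delta>: "\<delta> > 0" "\<And>n. lam n \<ge> \<delta>" using lam_lower by metis
    \<comment> \<open>As v = s A v and A = D B D, the eigenvector is in the range of D, that is, in
      the form domain: sqrt(lam_n) v_n is square-summable.\<close>
    define x where "x = s *\<^sub>R B (D ?v)"
    have v: "?v = D x"
    proof -
      have "s *\<^sub>R A ?v = ?v" using A_ev[OF s] eig_nonzero[OF s] by simp
      thus ?thesis
        by (simp add: x_def A_def linear_scale[OF bounded_linear.linear[OF linear_D]])
    qed
    have lv: "lam n * (coord ?v n)\<^sup>2 = (coord x n)\<^sup>2" for n
      using lam_pos[of n] unfolding v coord_D power_mult_distrib d_power2 by simp
    have "summable (\<lambda>n. (sqrt (lam n + c) * coord ?v n)\<^sup>2)"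
    proof (rule summable_comparison_test'[where N = 0])
      show "summable (\<lambda>n. (1 + c / \<delta>) * (coord x n)\<^sup>2)"
        by (intro summable_mult summable_coord_power2)
      fix n
      have "lam n + c \<le> (1 + c / \<delta>) * lam n"
        using c \<delta>(1) \<delta>(2)[of n] by (simp add: field_simps)
      hence "(lam n + c) * (coord ?v n)\<^sup>2 \<le> (1 + c / \<delta>) * lam n * (coord ?v n)\<^sup>2"
        by (rule mult_right_mono) simp
      thus "norm ((sqrt (lam n + c) * coord ?v n)\<^sup>2) \<le> (1 + c / \<delta>) * (coord x n)\<^sup>2"
        using c lam_pos[of n] by (simp add: power_mult_distrib lv[symmetric] mult.assoc)
    qed
    note cy = coord_seq_l2[OF this]
    define y where "y = seq_l2 (\<lambda>n. sqrt (lam n + c) * coord ?v n)"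
    have jv: "japp (\<lambda>n. lam n + c) w (coord ?v) n = coord ((s + c) *\<^sub>R ?v) n" for n
    proof -
      have "japp (\<lambda>n. lam n + c) w (coord ?v) n = japp lam w (coord ?v) n + c * coord ?v n"
        by (simp add: japp_def algebra_simps)
      thus ?thesis by (simp add: japp_ev[OF s] algebra_simps)
    qed
    have "inner ?v ((s + c) *\<^sub>R ?v) = (norm y)\<^sup>2 + inner y (S.K y)"
      by (rule S.form_eq[OF _ jv]) (simp add: y_def cy)
    moreover have "\<bar>inner y (S.K y)\<bar> \<le> (norm y)\<^sup>2 / 2"
    proof -
      have "row_weight S.k n \<le> 1/2" for n
        unfolding row_weight_def using k[of n] k[of "n - 1"] by (cases n) auto
      hence "row_weight S.k n * (coord y n)\<^sup>2 \<le> (coord y n)\<^sup>2 / 2" for n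
        using mult_right_mono[of "row_weight S.k n" "1/2" "(coord y n)\<^sup>2"] by simp
      hence "(\<Sum>n. row_weight S.k n * (coord y n)\<^sup>2) \<le> (\<Sum>n. (coord y n)\<^sup>2 / 2)"
        by (intro suminf_le offdiag_form_bound S.Bseq_k summable_divide summable_coord_power2)
      also have "\<dots> = (norm y)\<^sup>2 / 2"
        using sums_divide[OF norm_l2_sums[of y], of 2] by (rule sums_unique[symmetric])
      finally show ?thesis using offdiag_form_bound(1)[OF S.Bseq_k, of y] by linarith
    qed
    moreover have "y \<noteq> 0"
    proof
      assume "y = 0"
      hence "sqrt (lam n + c) * coord ?v n = 0" for n using cy[of n] by (simp add: y_def)
      hence "coord ?v n = 0" for n
        using c lam_pos[of n] by (metis add_pos_pos mult_eq_0_iff real_sqrt_eq_zero_cancel_iff less_irrefl)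
      hence "?v = 0" by (intro l2_eqI) simp
      thus False using norm_ev[OF s] by simp
    qed
    hence "(norm y)\<^sup>2 > 0" by simp
    ultimately have "inner ?v ((s + c) *\<^sub>R ?v) > 0" by linarith
    hence "(s + c) * inner ?v ?v > 0" by simp
    thus ?thesis using norm_ev[OF s] by (simp add: dot_square_norm)
  qed
  thus thesis using that[OF c] by blast
qed

text \<open>
  Test vectors with finite support: in the form sense \<open>J + c\<close> is at most the diagonal operator with
  entries \<open>(lam n + c) (1 + row_weight (kc c) n)\<close>.
\<close>

lemma counting_le:
  assumes c: "c \<ge> 0" "\<And>s. s \<in> eig \<Longrightarrow> s + c > 0"
  shows "card {n. (lam n + c) * (1 + row_weight (kc c) n) \<le> x} \<le> card {s\<in>eig. s + c \<le> x}"
proof (rule ccontr)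
  assume *: "\<not> ?thesis"
  interpret S: jacobi "\<lambda>n. lam n + c" w by (rule jacobi_shift_pos[OF c(1)])
  have kc: "S.k = kc c" by (simp add: fun_eq_iff S.k_def kc_def)
  let ?I = "{n. (lam n + c) * (1 + row_weight (kc c) n) \<le> x}" and ?E = "{s\<in>eig. s + c \<le> x}"
  have fE: "finite ?E"
    by (rule finite_subset[OF _ finite_eig_bounded[of "c + \<bar>x\<bar>"]]) (use c in force)
  have card: "card ?E < card ?I" using * by simp
  \<comment> \<open>An infinite set has cardinality 0, so the strict inequality already forces
    finiteness.\<close>
  hence fI: "finite ?I" by (intro card_ge_0_finite) linarith
  \<comment> \<open>More unknowns than conditions: a nonzero vector supported in \<open>?I\<close>
    and orthogonal to all eigenvectors with s + c \<le> x.\<close>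
  obtain y0 where y0: "\<exists>n\<in>?I. y0 n \<noteq> 0" "\<forall>s\<in>?E. (\<Sum>n\<in>?I. y0 n * coord (ev s) n) = 0"
    using ex_homogeneous_solution[OF fE fI card, of "\<lambda>s. coord (ev s)"] by blast
  define y where "y = seq_l2 (\<lambda>n. if n \<in> ?I then y0 n else 0)"
  have y: "coord y n = (if n \<in> ?I then y0 n else 0)" for n
    unfolding y_def by (rule coord_seq_l2, rule summable_finite[OF fI]) auto
  define z where "z = seq_l2 (\<lambda>n. sqrt (lam n + c) * coord y n)"
  have z: "coord z n = sqrt (lam n + c) * coord y n" for n
    unfolding z_def by (rule coord_seq_l2, rule summable_finite[OF fI]) (auto simp: y)
  have "finite {n. coord y n \<noteq> 0}"
    by (rule finite_subset[OF _ fI]) (auto simp: y split: if_splits)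
  then obtain u where u: "y = A u" "\<And>n. coord u n = japp lam w (coord y) n"
    by (rule finite_support_in_range) blast
  have "inner y (u + c *\<^sub>R y) = (norm z)\<^sup>2 + inner z (S.K z)"
    by (rule S.form_eq[OF z]) (simp add: u(2) japp_def algebra_simps)
  also have "\<dots> \<le> (norm z)\<^sup>2 + (\<Sum>n. row_weight S.k n * (coord z n)\<^sup>2)"
    using offdiag_form_bound(1)[OF S.Bseq_k, of z] by linarith
  also have "\<dots> \<le> x * (norm y)\<^sup>2"
  proof (rule sums_le)
    show "(\<lambda>n. (coord z n)\<^sup>2 + row_weight S.k n * (coord z n)\<^sup>2) sums
        ((norm z)\<^sup>2 + (\<Sum>n. row_weight S.k n * (coord z n)\<^sup>2))"
      by (intro sums_add norm_l2_sums summable_sums offdiag_form_bound S.Bseq_k)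
    show "(\<lambda>n. x * (coord y n)\<^sup>2) sums (x * (norm y)\<^sup>2)"
      by (intro sums_mult norm_l2_sums)
    fix n
    have "(coord z n)\<^sup>2 = (lam n + c) * (coord y n)\<^sup>2"
      using lam_pos[of n] c(1) by (simp add: z power_mult_distrib)
    hence eq: "(coord z n)\<^sup>2 + row_weight S.k n * (coord z n)\<^sup>2 =
        (lam n + c) * (1 + row_weight (kc c) n) * (coord y n)\<^sup>2"
      unfolding kc by (simp add: algebra_simps)
    show "(coord z n)\<^sup>2 + row_weight S.k n * (coord z n)\<^sup>2 \<le> x * (coord y n)\<^sup>2"
    proof (cases "n \<in> ?I")
      case True
      thus ?thesis unfolding eq by (intro mult_right_mono) auto
    next
      case False
      hence "coord y n = 0" by (simp add: y)
      thus ?thesis unfolding eq by simp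
    qed
  qed
  finally have le: "inner y u + (c - x) * inner y y \<le> 0"
    by (simp add: inner_add_right power2_norm_eq_inner algebra_simps)
  \<comment> \<open>In eigenvectors the same nonpositive form is a sum of (s + c - x) times squared
    coefficients. The terms with s + c \<le> x vanish by the choice of y and the others are
    nonnegative, so all coefficients and hence y must be 0.\<close>
  have hs: "((\<lambda>s. inner y (ev s) * inner u (ev s) + (c - x) * (inner y (ev s) * inner y (ev s)))
      has_sum (inner y u + (c - x) * inner y y)) eig"
    by (intro has_sum_add has_sum_cmult_right inner_has_sum[OF u(1)])
  have summand: "inner y (ev s) * inner u (ev s) + (c - x) * (inner y (ev s) * inner y (ev s)) =
      (s + c - x) * (inner y (ev s))\<^sup>2" if "s \<in> eig" for s
  proof -
    have "inner u (ev s) = s * inner y (ev s)"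
      using inner_A_ev[OF that, of u] eig_nonzero[OF that] by (simp add: u(1))
    thus ?thesis by (simp add: algebra_simps power2_eq_square)
  qed
  have orth: "inner y (ev s) = 0" if "s \<in> ?E" for s
  proof -
    have "inner y (ev s) = (\<Sum>n\<in>?I. coord y n * coord (ev s) n)"
      unfolding inner_l2_def by (rule suminf_finite[OF fI]) (auto simp: y)
    also have "\<dots> = (\<Sum>n\<in>?I. y0 n * coord (ev s) n)"
      by (intro sum.cong) (auto simp: y)
    finally show ?thesis using y0(2) that by simp
  qed
  have zero: "inner y (ev s) = 0" if s: "s \<in> eig" for s
  proof (cases "s \<in> ?E")
    case False
    have "(s + c - x) * (inner y (ev s))\<^sup>2 = 0"
    proof (rule nonneg_has_sum_le_0D[OF _ le _ s])
      show "((\<lambda>s. (s + c - x) * (inner y (ev s))\<^sup>2) has_sum (inner y u + (c - x) * inner y y)) eig"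
        by (rule has_sum_cong[THEN iffD1, OF summand hs])
      show "0 \<le> (r + c - x) * (inner y (ev r))\<^sup>2" if "r \<in> eig" for r
        using orth[of r] that by (cases "r \<in> ?E") auto
    qed
    thus ?thesis using False s by auto
  qed (rule orth)
  have "((\<lambda>s. inner y (ev s) * inner y (ev s)) has_sum 0) eig"
    by (rule has_sum_0) (simp add: zero)
  hence "inner y y = 0"
    using inner_has_sum[OF u(1), of y] has_sum_unique by blast
  hence "coord y n = 0" for n by simp
  moreover obtain n where "n \<in> ?I" "y0 n \<noteq> 0" using y0(1) by blast
  ultimately show False using y[of n] by simp
qed

text \<open>Both the diagonal entries and the eigenvalues have finitely many predecessors each, so
  they can be matched by rank.\<close>

lemma ex_ordered_enumeration: "\<exists>\<mu>. bij_betw \<mu> UNIV eig \<and> ordered_like lam \<mu>"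
proof -
  \<comment> \<open>Equal diagonal entries are separated by their index, which makes the order total
    on indices.\<close>
  define r where "r m n \<longleftrightarrow> lam m < lam n \<or> lam m = lam n \<and> m < n" for m n
  have finl: "finite {m\<in>UNIV. r m n}" for n
  proof -
    obtain N where N: "\<And>m. m \<ge> N \<Longrightarrow> lam m \<ge> lam n + 1"
      using lam_lim unfolding filterlim_at_top eventually_sequentially by meson
    have "{m\<in>UNIV. r m n} \<subseteq> {..<N}"
    proof
      fix m assume "m \<in> {m\<in>UNIV. r m n}"
      hence "lam m \<le> lam n" by (auto simp: r_def)
      thus "m \<in> {..<N}" using N[of m] by (cases "m < N") auto
    qed
    thus ?thesis by (rule finite_subset) simp
  qed
  define \<rho> where "\<rho> n = card {m\<in>UNIV. r m n}" for n
  have r: "\<not> r m m" "r m n \<Longrightarrow> r n k \<Longrightarrow> r m k" "m \<noteq> n \<Longrightarrow> r m n \<or> r n m" for m n k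
    by (auto simp: r_def)
  have \<rho>1: "bij_betw \<rho> UNIV UNIV"
    unfolding \<rho>_def[abs_def]
    by (rule bij_betw_rank(1)[where r = r])
      (rule infinite_UNIV_nat finl r(1) | erule (1) r(2) | erule r(3))+
  have \<rho>2: "r m n \<longleftrightarrow> \<rho> m < \<rho> n" for m n
    unfolding \<rho>_def
    by (rule bij_betw_rank(2)[where r = r])
      (rule infinite_UNIV_nat finl r(1) UNIV_I | erule (1) r(2) | erule r(3))+
  obtain c where c: "c > 0" "\<And>s. s \<in> eig \<Longrightarrow> s + c > 0" using eig_lower_bound by metis
  have fine: "finite {s\<in>eig. s < t}" for t
    by (rule finite_subset[OF _ finite_eig_bounded[of "c + \<bar>t\<bar>"]]) (use c in force)
  define \<sigma> where "\<sigma> t = card {s\<in>eig. s < t}" for t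
  have \<sigma>1: "bij_betw \<sigma> eig UNIV"
    unfolding \<sigma>_def[abs_def]
    by (rule bij_betw_rank(1)[where r = "(<)"]) (simp_all add: infinite_eig fine linorder_neq_iff)
  have \<sigma>2: "s < t \<longleftrightarrow> \<sigma> s < \<sigma> t" if "s \<in> eig" "t \<in> eig" for s t
    unfolding \<sigma>_def
    by (rule bij_betw_rank(2)[where r = "(<)"]) (simp_all add: infinite_eig fine linorder_neq_iff that)
  define \<mu> where "\<mu> = inv_into eig \<sigma> \<circ> \<rho>"
  have b: "bij_betw \<mu> UNIV eig"
    unfolding \<mu>_def by (rule bij_betw_trans[OF \<rho>1 bij_betw_inv_into[OF \<sigma>1]])
  have in_eig: "\<mu> n \<in> eig" for n using b by (auto simp: bij_betw_def)
  have \<sigma>\<mu>: "\<sigma> (\<mu> n) = \<rho> n" for n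
    unfolding \<mu>_def o_def using \<sigma>1 by (intro f_inv_into_f) (simp add: bij_betw_def)
  have "\<mu> m < \<mu> n" if "lam m < lam n" for m n
    using \<rho>2[of m n] that \<sigma>2[OF in_eig in_eig] \<sigma>\<mu> by (simp add: r_def)
  thus ?thesis using b by (auto simp: ordered_like_def)
qed

section \<open>Summation in matching order\<close>

context
  fixes \<mu> :: "nat \<Rightarrow> real" and c :: real
  assumes \<mu>: "bij_betw \<mu> UNIV eig" and ord: "ordered_like lam \<mu>"
    and c: "c > 0" "\<And>s. s \<in> eig \<Longrightarrow> s + c > 0"
begin

lemma lam_c: "lam n + c > 0" using lam_pos[of n] c by simp

lemma \<mu>_c: "\<mu> n + c > 0" using c(2)[OF \<mu>_in_eig[OF \<mu>]] .

text \<open>\<open>counting_le\<close> is the hypothesis \<open>count\<close> in terms of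
  reciprocals. The cost of replacing lam_n + c by the comparison operator is at most \<kappa>_n /
  (lam_n + c), summable by Cauchy--Schwarz.\<close>

lemma summable_positive_part: "summable (\<lambda>n. max 0 (1 / (lam n + c) - 1 / (\<mu> n + c)))"
proof -
  interpret S: jacobi "\<lambda>n. lam n + c" w by (rule jacobi_shift_pos) (use c in simp)
  have kc: "S.k = kc c" by (simp add: fun_eq_iff S.k_def kc_def)
  let ?k = "row_weight (kc c)"
  have k0: "?k n \<ge> 0" for n by (simp add: row_weight_def split: nat.split)
  have inv: "1 / a \<ge> y \<longleftrightarrow> a \<le> 1 / y" if "a > 0" "y > 0" for a y :: real
    using that by (simp add: field_simps)
  have ak: "(lam n + c) * (1 + ?k n) > 0" for n
    using lam_c[of n] k0[of n] by (intro mult_pos_pos) auto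
  show ?thesis
  proof (rule summable_positive_part_diff[where m = "\<lambda>n. 1 / ((lam n + c) * (1 + ?k n))"])
    show "1 / (\<mu> n + c) > 0" for n using \<mu>_c by simp
    show "1 / ((lam n + c) * (1 + ?k n)) \<le> 1 / (lam n + c)" for n
      using lam_c[of n] k0[of n] by (intro frac_le) auto
    show "finite {n. 1 / (lam n + c) \<ge> y}" if y: "y > 0" for y
    proof -
      obtain N where N: "\<And>n. n \<ge> N \<Longrightarrow> lam n \<ge> 1 / y"
        using lam_lim unfolding filterlim_at_top eventually_sequentially by meson
      have "{n. 1 / (lam n + c) \<ge> y} \<subseteq> {..<N}"
      proof
        fix n assume "n \<in> {n. 1 / (lam n + c) \<ge> y}"
        hence "lam n + c \<le> 1 / y" using inv[OF lam_c y] by blast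
        thus "n \<in> {..<N}" using N[of n] c(1) by (cases "n < N") auto
      qed
      thus ?thesis by (rule finite_subset) simp
    qed
    show "finite {n. 1 / (\<mu> n + c) \<ge> y}" if y: "y > 0" for y
    proof -
      have "finite {s\<in>eig. s + c \<le> 1 / y}"
        by (rule finite_subset[OF _ finite_eig_bounded[of "c + 1 / y"]]) (use c y in force)
      hence "finite (\<mu> -` {s\<in>eig. s + c \<le> 1 / y})"
        by (rule finite_vimageI) (use \<mu> in \<open>simp add: bij_betw_def\<close>)
      moreover have "{n. 1 / (\<mu> n + c) \<ge> y} = \<mu> -` {s\<in>eig. s + c \<le> 1 / y}"
        using \<mu>_in_eig[OF \<mu>] by (auto simp: inv[OF \<mu>_c y])
      ultimately show ?thesis by simp
    qed
    show "1 / (\<mu> i + c) < 1 / (\<mu> j + c)" if "1 / (lam i + c) < 1 / (lam j + c)" for i j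
    proof -
      have "lam j < lam i" using that lam_c[of i] lam_c[of j] by (simp add: field_simps)
      hence "\<mu> j < \<mu> i" using ord by (simp add: ordered_like_def)
      thus ?thesis using \<mu>_c[of i] \<mu>_c[of j] by (simp add: field_simps)
    qed
    show "card {n. 1 / ((lam n + c) * (1 + ?k n)) \<ge> y} \<le> card {n. 1 / (\<mu> n + c) \<ge> y}" if y: "y > 0" for y
    proof -
      have "card {n. 1 / ((lam n + c) * (1 + ?k n)) \<ge> y} \<le> card {s\<in>eig. s + c \<le> 1 / y}"
        unfolding inv[OF ak y] using c by (intro counting_le) auto
      also have "{s\<in>eig. s + c \<le> 1 / y} = \<mu> ` {n. 1 / (\<mu> n + c) \<ge> y}"
        unfolding inv[OF \<mu>_c y] using range_\<mu>[OF \<mu>] by auto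
      also have "card \<dots> = card {n. 1 / (\<mu> n + c) \<ge> y}"
        by (rule card_image[OF inj_on_subset[OF bij_betw_imp_inj_on[OF \<mu>] subset_UNIV]])
      finally show ?thesis .
    qed
    show "summable (\<lambda>n. 1 / (lam n + c) - 1 / ((lam n + c) * (1 + ?k n)))"
    proof (rule summable_comparison_test'[where N = 0])
      have "summable (\<lambda>n. (?k n)\<^sup>2)"
      proof -
        have "summable (\<lambda>n. (case n of 0 \<Rightarrow> 0 | Suc m \<Rightarrow> \<bar>kc c m\<bar>)\<^sup>2)"
          using S.k_summable by (subst summable_Suc_iff[symmetric]) (simp add: kc)
        thus ?thesis unfolding row_weight_def using S.k_summable by (intro summable_power2_add) (auto simp: kc)
      qed
      thus "summable (\<lambda>n. \<bar>?k n * (1 / (lam n + c))\<bar>)"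
        by (rule summable_power2_mult) (use S.lam_summable in \<open>simp add: power_divide\<close>)
      fix n
      have "1 / a - 1 / (a * (1 + b)) = b / (a * (1 + b))" if "a > 0" "b \<ge> 0" for a b :: real
        using that by (simp add: divide_simps)
      hence eq: "1 / (lam n + c) - 1 / ((lam n + c) * (1 + ?k n)) = ?k n / ((lam n + c) * (1 + ?k n))"
        using lam_c k0 by blast
      have "\<bar>?k n / ((lam n + c) * (1 + ?k n))\<bar> = ?k n / ((lam n + c) * (1 + ?k n))"
        using k0[of n] ak[of n] by (intro abs_of_nonneg divide_nonneg_pos)
      also have "\<dots> \<le> ?k n / (lam n + c)"
        using lam_c[of n] k0[of n] by (intro frac_le) auto
      also have "\<dots> \<le> \<bar>?k n * (1 / (lam n + c))\<bar>"
        using abs_ge_self[of "?k n * (1 / (lam n + c))"] by simp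
      finally show "norm (1 / (lam n + c) - 1 / ((lam n + c) * (1 + ?k n))) \<le> \<bar>?k n * (1 / (lam n + c))\<bar>"
        unfolding real_norm_def eq .
    qed
  qed
qed

text \<open>The order of \<mu> serves only to make \<open>d\<close>, the difference of reciprocals
  at -c, absolutely summable. Returning from -c to 0 costs just \<open>tr_diff_sums\<close>.\<close>

lemma ordered_trace_sums: "(\<lambda>n. 1 / lam n - 1 / \<mu> n) sums tr 0"
proof -
  define d where "d n = 1 / (lam n + c) - 1 / (\<mu> n + c)" for n
  \<comment> \<open>Chosen so that \<theta> d is the difference of reciprocals at -N. Hence (1 -
    \<theta>) d is the summand of tr(-c) - tr(-N), and (1 - \<theta>) increases d to at most its own
    modulus.\<close>
  define \<theta> where "\<theta> N n = (lam n + c) * (\<mu> n + c) / ((lam n + real N) * (\<mu> n + real N))" for N n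
  have lt: "- r < lam n" "- r \<notin> eig" if "r \<ge> c" for r n
    using that c lam_pos[of n] c(2)[of "- r"] by auto
  have ev: "eventually (\<lambda>N. real N \<ge> c) sequentially" by real_asymp
  have \<theta>: "0 \<le> \<theta> N n" "\<theta> N n \<le> 1" if "real N \<ge> c" for N n
  proof -
    have "(lam n + c) * (\<mu> n + c) \<le> (lam n + real N) * (\<mu> n + real N)"
      using that lam_c[of n] \<mu>_c[of n] by (intro mult_mono) auto
    moreover have "0 < (lam n + c) * (\<mu> n + c)" using lam_c \<mu>_c by simp
    ultimately show "0 \<le> \<theta> N n" "\<theta> N n \<le> 1" by (auto simp: \<theta>_def divide_le_eq_1)
  qed
  have \<theta>0: "(\<lambda>N. \<theta> N n) \<longlonglongrightarrow> 0" for n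
    unfolding \<theta>_def by real_asymp
  have S: "(\<lambda>n. (1 - \<theta> N n) * d n) sums (tr (- c) - tr (- real N))" if N: "real N \<ge> c" for N
  proof -
    have "(1 - \<theta> N n) * d n =
      (1 / lam n - 1 / (lam n - - real N) - (1 / \<mu> n - 1 / (\<mu> n - - real N))) -
      (1 / lam n - 1 / (lam n - - c) - (1 / \<mu> n - 1 / (\<mu> n - - c)))" for n
    proof -
      have p: "lam n + c > 0" "\<mu> n + c > 0" "lam n + real N > 0" "\<mu> n + real N > 0"
        using lam_c[of n] \<mu>_c[of n] N by auto
      have "\<theta> N n * d n = 1 / (lam n + real N) - 1 / (\<mu> n + real N)"
        unfolding \<theta>_def d_def using p by (simp add: divide_simps)
      thus ?thesis by (simp add: left_diff_distrib d_def)
    qed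
    moreover have "(\<lambda>n. (1 / lam n - 1 / (lam n - - real N) - (1 / \<mu> n - 1 / (\<mu> n - - real N))) -
      (1 / lam n - 1 / (lam n - - c) - (1 / \<mu> n - 1 / (\<mu> n - - c)))) sums
        ((tr 0 - tr (- real N)) - (tr 0 - tr (- c)))"
      by (intro sums_diff tr_diff_sums[OF \<mu>] lt N) auto
    ultimately show ?thesis by simp
  qed
  have trN: "(\<lambda>N. tr (- real N)) \<longlonglongrightarrow> 0"
    by (rule tr_tendsto_0[OF c(2)])
  define p e where "p n = max 0 (d n)" and "e n = max 0 (- d n)" for n
  have sp: "summable p" using summable_positive_part by (simp add: p_def[abs_def] d_def)
  \<comment> \<open>The negative part is the positive part minus d; the weighted sum of d is known
    exactly and that of p is at most \<open>suminf p\<close>, uniformly in N.\<close>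
  have bound: "(\<Sum>n<M. (1 - \<theta> N n) * e n) \<le> suminf p - (tr (- c) - tr (- real N))" if N: "real N \<ge> c" for N M
  proof -
    have s1: "summable (\<lambda>n. (1 - \<theta> N n) * p n)"
      by (rule summable_comparison_test'[OF sp, of 0])
        (use \<theta>[OF N] in \<open>auto simp: abs_mult p_def intro!: mult_left_le_one_le\<close>)
    have "(1 - \<theta> N n) * e n = (1 - \<theta> N n) * p n - (1 - \<theta> N n) * d n" for n
      by (simp add: e_def p_def max_def algebra_simps)
    hence s2: "(\<lambda>n. (1 - \<theta> N n) * e n) sums (suminf (\<lambda>n. (1 - \<theta> N n) * p n) - (tr (- c) - tr (- real N)))"
      using sums_diff[OF summable_sums[OF s1] S[OF N]] by simp
    have "(\<Sum>n<M. (1 - \<theta> N n) * e n) \<le> (\<Sum>n. (1 - \<theta> N n) * e n)"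
      using \<theta>[OF N] by (intro sum_le_suminf sums_summable[OF s2]) (auto simp: e_def)
    also have "\<dots> = suminf (\<lambda>n. (1 - \<theta> N n) * p n) - (tr (- c) - tr (- real N))"
      using s2 by (rule sums_unique[symmetric])
    also have "suminf (\<lambda>n. (1 - \<theta> N n) * p n) \<le> suminf p"
      using \<theta>[OF N] by (intro suminf_le s1 sp mult_left_le_one_le) (auto simp: p_def)
    finally show ?thesis by simp
  qed
  \<comment> \<open>Fatou's argument: M is fixed while N grows and the weights tend to 1.\<close>
  have "(\<Sum>n<M. e n) \<le> suminf p - tr (- c)" for M
  proof (rule tendsto_le)
    show "(\<lambda>N. suminf p - (tr (- c) - tr (- real N))) \<longlonglongrightarrow> suminf p - tr (- c)"
      using tendsto_diff[OF tendsto_const tendsto_diff[OF tendsto_const trN]] by fastforce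
    have "(\<lambda>N. \<Sum>n<M. (1 - \<theta> N n) * e n) \<longlonglongrightarrow> (\<Sum>n<M. (1 - 0) * e n)"
      by (intro tendsto_intros \<theta>0)
    thus "(\<lambda>N. \<Sum>n<M. (1 - \<theta> N n) * e n) \<longlonglongrightarrow> (\<Sum>n<M. e n)" by simp
    show "\<forall>\<^sub>F N in sequentially. (\<Sum>n<M. (1 - \<theta> N n) * e n) \<le> suminf p - (tr (- c) - tr (- real N))"
      using ev by eventually_elim (rule bound)
  qed simp
  hence se: "summable e"
    by (intro summableI_nonneg_bounded) (auto simp: e_def)
  have sd: "summable (\<lambda>n. \<bar>d n\<bar>)"
  proof -
    have "\<bar>d n\<bar> = p n + e n" for n by (simp add: p_def e_def max_def)
    thus ?thesis using summable_add[OF sp se] by simp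
  qed
  \<comment> \<open>With |d| now available as a majorant, dominated convergence identifies the sum
    of d with tr(-c).\<close>
  have "(\<lambda>N. \<Sum>n. (1 - \<theta> N n) * d n) \<longlonglongrightarrow> (\<Sum>n. (1 - 0) * d n)"
  proof (rule tannerys_theorem[THEN conjunct2, THEN conjunct2])
    show "(\<lambda>N. (1 - \<theta> N n) * d n) \<longlonglongrightarrow> (1 - 0) * d n" for n
      by (intro tendsto_intros \<theta>0)
    have "norm ((1 - \<theta> N n) * d n) \<le> \<bar>d n\<bar>" if "real N \<ge> c" for N n
      using \<theta>[OF that, of n] by (auto simp: abs_mult intro!: mult_left_le_one_le)
    moreover have "\<forall>\<^sub>F (n::nat, N) in at_top \<times>\<^sub>F sequentially. real N \<ge> c"
      using ev by (subst eventually_prod2) auto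
    ultimately show "\<forall>\<^sub>F (n, N) in at_top \<times>\<^sub>F sequentially. norm ((1 - \<theta> N n) * d n) \<le> \<bar>d n\<bar>"
      by (elim eventually_mono) auto
  qed (use sd in auto)
  hence l1: "(\<lambda>N. \<Sum>n. (1 - \<theta> N n) * d n) \<longlonglongrightarrow> suminf d" by simp
  have "(\<lambda>N. tr (- c) - tr (- real N)) \<longlonglongrightarrow> tr (- c) - 0"
    by (intro tendsto_intros trN)
  moreover have "\<forall>\<^sub>F N in sequentially. tr (- c) - tr (- real N) = (\<Sum>n. (1 - \<theta> N n) * d n)"
    using ev by eventually_elim (rule sums_unique[OF S])
  ultimately have "(\<lambda>N. \<Sum>n. (1 - \<theta> N n) * d n) \<longlonglongrightarrow> tr (- c) - 0"
    by (rule Lim_transform_eventually)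
  hence "suminf d = tr (- c)" using LIMSEQ_unique[OF l1] by simp
  hence "d sums tr (- c)" using summable_sums[OF summable_rabs_cancel[OF sd]] by simp
  hence "(\<lambda>n. (1 / lam n - 1 / (lam n - - c) - (1 / \<mu> n - 1 / (\<mu> n - - c))) + d n) sums
      ((tr 0 - tr (- c)) + tr (- c))"
    by (intro sums_add tr_diff_sums[OF \<mu>] lt) auto
  thus ?thesis by (simp add: d_def)
qed

end

end

theorem theorem11:
  fixes lam w :: "nat \<Rightarrow> real"
  assumes "\<And>n. lam n > 0"
    and "\<And>n. w n \<noteq> 0"
    and "filterlim lam at_top sequentially"
    and "summable (\<lambda>n. (w n)\<^sup>2 / (lam n * lam (Suc n)))"
    and "summable (\<lambda>n. 1 / (lam n)\<^sup>2)"
    and "op_invertible (jacobi_operator lam w)"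
  shows
    "(\<forall>z\<in>eigenvalues (jacobi_operator lam w).
        z \<in> \<real> \<and> simple_eigenvalue (jacobi_operator lam w) z) \<and>
     (\<exists>\<mu>. enumerates_eigenvalues (jacobi_operator lam w) \<mu> \<and> ordered_like lam \<mu>) \<and>
     trace_class (inverse_difference lam w) \<and>
     (\<forall>\<mu>. enumerates_eigenvalues (jacobi_operator lam w) \<mu> \<longrightarrow>
        summable (\<lambda>n. 1 / (\<mu> n)\<^sup>2) \<and>
        (\<forall>z. convergent_prod (\<lambda>n. (1 - z / of_real (\<mu> n)) * exp (z / of_real (\<mu> n))) \<and>
             reg_char_fun lam w z =
               char_fun lam w 0 * exp (op_trace (inverse_difference lam w) * z) *
               (\<Prod>n. (1 - z / of_real (\<mu> n)) * exp (z / of_real (\<mu> n)))) \<and>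
        (ordered_like lam \<mu> \<longrightarrow>
           (\<lambda>n. complex_of_real (1 / lam n - 1 / \<mu> n)) sums
             op_trace (inverse_difference lam w)))"
proof -
  interpret jacobi lam w by standard (fact assms)+
  interpret jacobi_invertible lam w
    by standard (rule op_invertible_kernel[OF assms(6)])
  have enum: "enumerates_eigenvalues (jacobi_operator lam w) \<mu> \<longleftrightarrow> bij_betw \<mu> UNIV eig" for \<mu>
  proof -
    have "inj (\<lambda>n. complex_of_real (\<mu> n)) \<longleftrightarrow> inj \<mu>"
      by (simp add: inj_on_def)
    moreover have "range (\<lambda>n. complex_of_real (\<mu> n)) = of_real ` range \<mu>"
      by (simp add: image_image)
    moreover have "complex_of_real ` range \<mu> = of_real ` eig \<longleftrightarrow> range \<mu> = eig"
      by (rule inj_image_eq_iff) (rule inj_of_real)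
    ultimately show ?thesis
      by (simp add: enumerates_eigenvalues_def eigenvalues_eq bij_betw_def)
  qed
  obtain c where c: "c > 0" "\<And>s. s \<in> eig \<Longrightarrow> s + c > 0" using eig_lower_bound by metis
  show ?thesis
  proof (intro conjI ballI allI impI)
    show "z \<in> \<real>" if "z \<in> eigenvalues (jacobi_operator lam w)" for z
      using that by (auto simp: eigenvalues_eq)
    show "simple_eigenvalue (jacobi_operator lam w) z" if "z \<in> eigenvalues (jacobi_operator lam w)" for z
      using that by (rule simple_eigenvalues)
    show "\<exists>\<mu>. enumerates_eigenvalues (jacobi_operator lam w) \<mu> \<and> ordered_like lam \<mu>"
      unfolding enum by (rule ex_ordered_enumeration)
    show "trace_class (inverse_difference lam w)" by (rule trace_class_inverse_difference)
    fix \<mu> assume "enumerates_eigenvalues (jacobi_operator lam w) \<mu>"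
    hence \<mu>: "bij_betw \<mu> UNIV eig" by (simp only: enum)
    interpret M: genus_one \<mu> by (rule genus_one_\<mu>[OF \<mu>])
    show "summable (\<lambda>n. 1 / (\<mu> n)\<^sup>2)" by (rule M.summable)
    fix z
    show "convergent_prod (\<lambda>n. (1 - z / of_real (\<mu> n)) * exp (z / complex_of_real (\<mu> n)))"
      by (rule M.convergent_Phi)
    show "reg_char_fun lam w z = char_fun lam w 0 * exp (op_trace (inverse_difference lam w) * z) *
        (\<Prod>n. (1 - z / of_real (\<mu> n)) * exp (z / of_real (\<mu> n)))"
      by (simp add: reg_char_fun_eq[OF \<mu>] rhs_def[OF \<mu>] char_fun_eq op_trace_eq Phi_def)
  next
    fix \<mu> assume "enumerates_eigenvalues (jacobi_operator lam w) \<mu>" "ordered_like lam \<mu>"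
    thus "(\<lambda>n. complex_of_real (1 / lam n - 1 / \<mu> n)) sums op_trace (inverse_difference lam w)"
      unfolding op_trace_eq enum using ordered_trace_sums[OF _ _ c] by (intro sums_of_real) blast
  qed
qed

end
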